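(* (Main Theorem.) For the online problem of minimizing total weighted flow-time on $m$ unrelated machines, there is a deterministic online algorithm that produces a non-preemptive schedule, rejects jobs of total weight at most an $\epsilon$-fraction of the total weight of the incoming jobs, and ensures that the total weighted flow-time $\sum_j w_j(C_j-r_j)$ of the non-rejected jobs is at most $O(1/\epsilon^3)$ times the optimal weighted flow-time of an offline schedule that is required to process all jobs (without any rejections).
   Context: Unrelated machines scheduling: there are $m$ machines; jobs arrive online, and job $j$ is revealed at its release time $r_j$, together with its weight $w_j>0$ and its processing time $p_{ij}>0$ on each machine $i$. A job that is not rejected must be processed on one machine $i$ non-preemptively, i.e. in a single contiguous interval of length $p_{ij}$ starting no earlier than $r_j$; each machine processes at most one job at a time. Its completion time is $C_j$ and its flow-time is $C_j-r_j$. The online algorithm may reject jobs (at any time, possibly after partial processing); rejected jobs contribute no flow-time. The offline optimum against which the algorithm is compared must process all jobs, and is allowed to preempt and migrate jobs. The parameter $\epsilon$ satisfies $\epsilon^2\le 1/2$ and $1/\epsilon\in\mathbb{Z}$. The constant hidden in $O(\cdot)$ is absolute. *)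

theory Defs
  imports "HOL-Analysis.Analysis"
begin

text \<open>
  Machines are the numbers \<open>i < m\<close>, jobs carry arbitrary natural numbers as names, and time is real.
  Fields of an instance are meaningful only at its jobs and at machines \<open>i < m\<close>;
  \<open>ptime I i j\<close> is $p_{ij}$.
\<close>

record job_instance =
  jobs :: "nat set"
  release :: "nat \<Rightarrow> real"
  weight :: "nat \<Rightarrow> real"
  ptime :: "nat \<Rightarrow> nat \<Rightarrow> real"

definition valid_instance :: "nat \<Rightarrow> job_instance \<Rightarrow> bool" where
  "valid_instance m I \<longleftrightarrow>
     finite (jobs I) \<and>
     (\<forall>j\<in>jobs I. weight I j > 0 \<and> (\<forall>i<m. ptime I i j > 0))"


subsection \<open>Non-preemptive schedules with rejections\<close>

text \<open>
  \<open>start S j = Some (i, s)\<close>: job \<open>j\<close> is started on machine \<open>i\<close> at time \<open>s\<close>.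
  \<open>rejection S j = Some r\<close>: job \<open>j\<close> is rejected at time \<open>r\<close>, which interrupts it if it has been started.
\<close>

record schedule =
  start :: "nat \<Rightarrow> (nat \<times> real) option"
  rejection :: "nat \<Rightarrow> real option"

definition rejected_jobs :: "job_instance \<Rightarrow> schedule \<Rightarrow> nat set" where
  "rejected_jobs I S = {j \<in> jobs I. rejection S j \<noteq> None}"

definition busy_interval :: "job_instance \<Rightarrow> schedule \<Rightarrow> nat \<Rightarrow> nat \<Rightarrow> real set" where
  "busy_interval I S i j =
     (case start S j of
        None \<Rightarrow> {}
      | Some (i', s) \<Rightarrow>
          if i' = i
          then {s ..< (case rejection S j of None \<Rightarrow> s + ptime I i j | Some r \<Rightarrow> r)}
          else {})"

text \<open>
  A rejected job may have been started earlier, but it must not have been completed by the time of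
  its rejection.
\<close>

definition feasible_schedule :: "nat \<Rightarrow> job_instance \<Rightarrow> schedule \<Rightarrow> bool" where
  "feasible_schedule m I S \<longleftrightarrow>
     (\<forall>j\<in>jobs I. rejection S j = None \<longrightarrow> start S j \<noteq> None) \<and>
     (\<forall>j\<in>jobs I. \<forall>i s. start S j = Some (i, s) \<longrightarrow> i < m \<and> release I j \<le> s) \<and>
     (\<forall>j\<in>jobs I. \<forall>r. rejection S j = Some r \<longrightarrow> release I j \<le> r) \<and>
     (\<forall>j\<in>jobs I. \<forall>i s r. start S j = Some (i, s) \<and> rejection S j = Some r
        \<longrightarrow> s \<le> r \<and> r < s + ptime I i j) \<and>
     (\<forall>i<m. \<forall>j\<in>jobs I. \<forall>k\<in>jobs I. j \<noteq> k
        \<longrightarrow> busy_interval I S i j \<inter> busy_interval I S i k = {})"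

definition completion_time :: "job_instance \<Rightarrow> schedule \<Rightarrow> nat \<Rightarrow> real" where
  "completion_time I S j = (case the (start S j) of (i, s) \<Rightarrow> s + ptime I i j)"

definition weighted_flow_time :: "job_instance \<Rightarrow> schedule \<Rightarrow> real" where
  "weighted_flow_time I S =
     (\<Sum>j \<in> jobs I - rejected_jobs I S. weight I j * (completion_time I S j - release I j))"


subsection \<open>Deterministic online algorithms\<close>

definition released :: "job_instance \<Rightarrow> real \<Rightarrow> nat set" where
  "released I t = {j \<in> jobs I. release I j \<le> t}"

definition same_revealed :: "nat \<Rightarrow> real \<Rightarrow> job_instance \<Rightarrow> job_instance \<Rightarrow> bool" where
  "same_revealed m t I I' \<longleftrightarrow>
     released I t = released I' t \<and>
     (\<forall>j\<in>released I t. release I j = release I' j \<and> weight I j = weight I' j \<and>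
        (\<forall>i<m. ptime I i j = ptime I' i j))"

definition same_decisions :: "nat set \<Rightarrow> real \<Rightarrow> schedule \<Rightarrow> schedule \<Rightarrow> bool" where
  "same_decisions J t S S' \<longleftrightarrow>
     (\<forall>j\<in>J.
        (\<forall>i. \<forall>s\<le>t. start S j = Some (i, s) \<longleftrightarrow> start S' j = Some (i, s)) \<and>
        (\<forall>r\<le>t. rejection S j = Some r \<longleftrightarrow> rejection S' j = Some r))"

text \<open>
  An algorithm maps the whole instance to the schedule it produces. It is online if everything it
  does up to and including time \<open>t\<close> is determined by the jobs released up to and including \<open>t\<close>.
\<close>

definition online_algorithm :: "nat \<Rightarrow> (job_instance \<Rightarrow> schedule) \<Rightarrow> bool" where
  "online_algorithm m A \<longleftrightarrow>
     (\<forall>I. valid_instance m I \<longrightarrow> feasible_schedule m I (A I)) \<and>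
     (\<forall>I I' t. valid_instance m I \<and> valid_instance m I' \<and> same_revealed m t I I'
        \<longrightarrow> same_decisions (released I t) t (A I) (A I'))"


subsection \<open>The preemptive, migratory offline optimum\<close>

text \<open>
  \<open>\<sigma> i t\<close> is the job (if any) that machine \<open>i\<close> processes at time \<open>t\<close>. Under migration, \<open>x\<close> time units
  on machine \<open>i\<close> complete the fraction $x / p_{ij}$ of job \<open>j\<close>.
\<close>

type_synonym offline_schedule = "nat \<Rightarrow> real \<Rightarrow> nat option"

definition processed_fraction ::
    "nat \<Rightarrow> job_instance \<Rightarrow> offline_schedule \<Rightarrow> nat \<Rightarrow> real \<Rightarrow> real" where
  "processed_fraction m I \<sigma> j t =
     (\<Sum>i<m. measure lborel {s. s \<le> t \<and> \<sigma> i s = Some j} / ptime I i j)"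

definition feasible_offline :: "nat \<Rightarrow> job_instance \<Rightarrow> offline_schedule \<Rightarrow> bool" where
  "feasible_offline m I \<sigma> \<longleftrightarrow>
     (\<forall>i<m. \<forall>j\<in>jobs I. {t. \<sigma> i t = Some j} \<in> sets lborel) \<and>
     (\<forall>i<m. \<forall>t j. \<sigma> i t = Some j \<longrightarrow> j \<in> jobs I \<and> release I j \<le> t) \<and>
     (\<forall>i<m. \<forall>i'<m. \<forall>t j. \<sigma> i t = Some j \<and> \<sigma> i' t = Some j \<longrightarrow> i = i') \<and>
     (\<forall>j\<in>jobs I. \<exists>t. processed_fraction m I \<sigma> j t \<ge> 1)"

definition offline_completion_time ::
    "nat \<Rightarrow> job_instance \<Rightarrow> offline_schedule \<Rightarrow> nat \<Rightarrow> real" where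
  "offline_completion_time m I \<sigma> j = Inf {t. processed_fraction m I \<sigma> j t \<ge> 1}"

definition offline_weighted_flow_time :: "nat \<Rightarrow> job_instance \<Rightarrow> offline_schedule \<Rightarrow> real" where
  "offline_weighted_flow_time m I \<sigma> =
     (\<Sum>j\<in>jobs I. weight I j * (offline_completion_time m I \<sigma> j - release I j))"

definition optimal_weighted_flow_time :: "nat \<Rightarrow> job_instance \<Rightarrow> real" where
  "optimal_weighted_flow_time m I =
     Inf (offline_weighted_flow_time m I ` {\<sigma>. feasible_offline m I \<sigma>})"

text \<open>
  Both infima above are over non-empty sets that are bounded below: some feasible offline schedule
  exists, and no job completes before its release.
\<close>

lemma single_machine_schedule_exists:
  assumes "finite J" "\<And>j. j \<in> J \<Longrightarrow> (p :: nat \<Rightarrow> real) j > 0"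
  shows "\<exists>(f :: real \<Rightarrow> nat option) T.
    (\<forall>t j. f t = Some j \<longrightarrow> j \<in> J \<and> r j \<le> t \<and> t < T) \<and>
    (\<forall>j\<in>J. \<exists>a. {t. f t = Some j} = {a ..< a + p j})"
  using assms
proof (induction J rule: finite_induct)
  case empty
  show ?case by (intro exI[of _ "\<lambda>_. None"]) auto
next
  case (insert j J)
  then obtain f T where f: "\<forall>t k. f t = Some k \<longrightarrow> k \<in> J \<and> r k \<le> t \<and> t < T"
    and a: "\<forall>k\<in>J. \<exists>a. {t. f t = Some k} = {a ..< a + p k}" by auto
  define b where "b = max T (r j)"
  define g where "g t = (if t \<in> {b ..< b + p j} then Some j else f t)" for t
  have pj: "p j > 0" using insert by auto
  have "{t. g t = Some j} = {b ..< b + p j}"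
    using f insert(2) by (auto simp: g_def)
  moreover have "{t. g t = Some k} = {t. f t = Some k}" if "k \<in> J" for k
  proof -
    have "t < b" if "f t = Some k" for t using f that by (force simp: b_def)
    then show ?thesis using that insert(2) by (force simp: g_def)
  qed
  moreover have "k \<in> insert j J \<and> r k \<le> t \<and> t < b + p j" if "g t = Some k" for t k
    using that f pj by (force simp: g_def b_def split: if_splits)
  ultimately show ?case using a by (intro exI[of _ g] exI[of _ "b + p j"]) auto
qed

lemma feasible_offline_exists:
  assumes "valid_instance m I" "m \<ge> 1"
  shows "\<exists>\<sigma>. feasible_offline m I \<sigma>"
proof -
  have p: "ptime I i j > 0" if "j \<in> jobs I" "i < m" for i j
    using assms that by (auto simp: valid_instance_def)
  obtain f T where f: "\<forall>t j. f t = Some j \<longrightarrow> j \<in> jobs I \<and> release I j \<le> t \<and> t < T"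
    and a: "\<forall>j\<in>jobs I. \<exists>a. {t. f t = Some j} = {a ..< a + ptime I 0 j}"
    using single_machine_schedule_exists[of "jobs I" "ptime I 0" "release I"] assms p
    by (auto simp: valid_instance_def)
  define \<sigma> where "\<sigma> i t = (if i = 0 then f t else None)" for i :: nat and t
  have "processed_fraction m I \<sigma> j T \<ge> 1" if j: "j \<in> jobs I" for j
  proof -
    obtain a where "{t. f t = Some j} = {a ..< a + ptime I 0 j}" using a j by blast
    moreover have "{s. s \<le> T \<and> \<sigma> 0 s = Some j} = {t. f t = Some j}"
      using f by (force simp: \<sigma>_def)
    ultimately have "measure lborel {s. s \<le> T \<and> \<sigma> 0 s = Some j} / ptime I 0 j = 1"
      using p[OF j, of 0] assms(2) by simp
    moreover have "processed_fraction m I \<sigma> j T \<ge>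
        (\<Sum>i\<in>{0}. measure lborel {s. s \<le> T \<and> \<sigma> i s = Some j} / ptime I i j)"
      unfolding processed_fraction_def using assms(2) p[OF j]
      by (intro sum_mono2) (auto intro!: divide_nonneg_pos measure_nonneg)
    ultimately show ?thesis by simp
  qed
  moreover have "{t. \<sigma> i t = Some j} \<in> sets lborel" if j: "j \<in> jobs I" for i j
  proof (cases "i = 0")
    case True
    obtain a where "{t. f t = Some j} = {a ..< a + ptime I 0 j}" using a j by blast
    then show ?thesis using True by (simp add: \<sigma>_def)
  qed (simp add: \<sigma>_def)
  ultimately have "feasible_offline m I \<sigma>"
    unfolding feasible_offline_def using f by (auto simp: \<sigma>_def split: if_splits)
  then show ?thesis by blast
qed

lemma release_le_if_processed:
  assumes "feasible_offline m I \<sigma>" "processed_fraction m I \<sigma> j t \<ge> 1"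
  shows "release I j \<le> t"
proof (rule ccontr)
  assume "\<not> release I j \<le> t"
  then have e: "{s. s \<le> t \<and> \<sigma> i s = Some j} = {}" if "i < m" for i
    using assms(1) that by (force simp: feasible_offline_def)
  have "processed_fraction m I \<sigma> j t = 0"
    unfolding processed_fraction_def by (intro sum.neutral ballI) (simp only: e lessThan_iff measure_empty div_0)
  then show False using assms(2) by simp
qed

end

theory Submission
  imports Defs
begin

text \<open>
  Let $K = 9/\epsilon$. Round the density of job $j$ on machine $i$ down to a power of 4 and denote it by
  $g_{ij}$. On every machine a \<^emph>\<open>virtual\<close> preemptive processor of speed $s = 1 + 1/(4K)$ serves all assigned
  jobs, densest first. Its backlog is described by the loads $V_\theta(t)$ of the jobs with
  $g_{ij} \ge \theta$; each $V_\theta$ is the workload of a single-server queue of its own, and the fractional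
  pending weight is $\int V_\theta \, d\theta$. A job is dispatched to the machine with the least
  $\frac{p_{ij}}{s} \int_0^{g_{ij}} V_\theta(r_j) \, d\theta + 2 w_j p_{ij}$. Since $V_\theta$ decreases at most
  at rate $s$, these prices and $\frac{1}{s} \int V_\theta(t) \, d\theta$ form a feasible dual solution; since
  $V_\theta^2 / 2$ decreases at rate $s V_\theta$, the prices sum up to at least the total load. The speed
  therefore leaves a gap that bounds the total load by $O(K) \cdot OPT$ and $\sum_j w_j p_{ij}$ by $O(OPT)$.

  The actual machine has unit speed and is not preemptive. It makes up for the speed by rejecting every $K$-th job
  of each class of assigned jobs with the same $g_{ij}$ and the same processing time up to a factor of 2, and for the
  lack of preemption by interrupting and rejecting a job once $K$ times its weight has been released during its run.
  On every level $\theta$ its waiting volume then exceeds $V_\theta$ only by rounding errors, at most one job per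
  class, and by the volume blocked by a run of a less dense job. Both are worked off at rate $1/(4K)$, the
  slack between the volume that is rejected and the additional volume that the virtual processor serves. As the classes
  form geometric sequences, these errors contribute $O(K^2) \sum_j w_j p_{ij}$ in total.
\<close>

subsection \<open>Runs of a single machine\<close>

text \<open>The price term \<open>2 * weight I j * ptime I i j\<close> frees the sum P of all w_j
  p_ij from the small speed gap: the prices collect 2 P, whereas the total load adds only P / 2 to
  the waiting part, so P is O(OPT) without a factor K. This is essential because the errors amount
  to K^2 P. The optimum can afford the term because it never runs a job on two machines at once. The
  virtual load contains the culled jobs as well: the optimum has to process them, so each of them
  needs a price.

  The main obstacle is the rounding in the culling, up to one job per class present. On level
  \<theta> a class may be charged to its job j only for a time proportional to K p_j (g_j /
  \<theta>)^(1/2) after the release of j; what is older has to be paid by the slack. With exponent 0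
  in place of 1/2 the contributions of the density classes would not decrease geometrically, with
  exponent 1 the integral over \<theta> would diverge at 0. The square root avoids both, and for its
  sake the densities are rounded to powers of 4, whose roots are powers of 2.\<close>

locale machine_queue =
  fixes J :: "nat set" and A :: "nat set" and r w p :: "nat \<Rightarrow> real"
    and d :: "nat \<Rightarrow> int" and \<kappa> :: real
begin

text \<open>Only release times are candidates, since the released weight changes nowhere else; this
  makes the set finite and gives it a minimum. The weight is counted over \<open>J\<close>, so jobs
  outside \<open>A\<close>, which never run, can also raise an alarm.\<close>

definition alarms :: "real \<Rightarrow> nat \<Rightarrow> real set" where
  "alarms S k = {u \<in> r ` J. S < u \<and> u < S + p k \<and> \<kappa> * w k \<le> (\<Sum>l | l \<in> J \<and> S < r l \<and> r l \<le> u. w l)}"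

definition run_end :: "real \<Rightarrow> nat \<Rightarrow> real" where
  "run_end S k = (if alarms S k = {} then S + p k else Min (alarms S k))"

definition next_start :: "nat set \<Rightarrow> real \<Rightarrow> real" where
  "next_start U \<tau> = max \<tau> (Min (r ` U))"

definition pick :: "nat set \<Rightarrow> real \<Rightarrow> nat" where
  "pick U S = (SOME j. j \<in> U \<and> r j \<le> S \<and> (\<forall>l\<in>U. r l \<le> S \<longrightarrow> d l \<le> d j))"

text \<open>Only the first \<open>card A\<close> runs are meaningful; afterwards no job is left to be picked.\<close>

primrec state :: "nat \<Rightarrow> nat set \<times> real" where
  "state 0 = (A, Min (r ` A))"
| "state (Suc n) = (case state n of (U, \<tau>) \<Rightarrow>
     let S = next_start U \<tau>; k = pick U S in (U - {k}, run_end S k))"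

definition unstarted :: "nat \<Rightarrow> nat set" where "unstarted n = fst (state n)"
definition run_start :: "nat \<Rightarrow> real" where
  "run_start n = next_start (fst (state n)) (snd (state n))"
definition run_job :: "nat \<Rightarrow> nat" where
  "run_job n = pick (unstarted n) (run_start n)"
definition run_stop :: "nat \<Rightarrow> real" where
  "run_stop n = run_end (run_start n) (run_job n)"
text \<open>\<open>LEAST\<close> selects the genuine run: past the first \<open>card A\<close> runs
  the picked value is arbitrary and may repeat an earlier job.\<close>

definition run_index :: "nat \<Rightarrow> nat" where
  "run_index j = (LEAST n. run_job n = j)"
definition job_start :: "nat \<Rightarrow> real" where
  "job_start j = run_start (run_index j)"
definition interrupted :: "nat \<Rightarrow> bool" where
  "interrupted j \<longleftrightarrow> alarms (job_start j) j \<noteq> {}"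
definition job_stop :: "nat \<Rightarrow> real" where
  "job_stop j = run_stop (run_index j)"

lemma unstarted_0: "unstarted 0 = A"
  by (simp add: unstarted_def)

lemma state_Suc: "state (Suc n) = (unstarted n - {run_job n}, run_stop n)"
  by (simp add: unstarted_def run_job_def run_stop_def run_start_def Let_def split: prod.splits)

lemma unstarted_Suc: "unstarted (Suc n) = unstarted n - {run_job n}"
  using state_Suc[of n] by (simp add: unstarted_def)

lemma run_start_0: "run_start 0 = Min (r ` A)"
  by (simp add: run_start_def next_start_def)

lemma run_start_Suc: "run_start (Suc n) = max (run_stop n) (Min (r ` unstarted (Suc n)))"
  by (simp only: run_start_def state_Suc next_start_def unstarted_Suc fst_conv snd_conv)

end

locale machine_queue_ok = machine_queue +
  assumes finJ: "finite J" and A_sub: "A \<subseteq> J"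
    and p_pos: "\<And>j. j \<in> J \<Longrightarrow> p j > 0" and w_pos: "\<And>j. j \<in> J \<Longrightarrow> w j > 0"
    and kappa_pos: "\<kappa> > 0"
begin

lemma finA: "finite A" using finJ A_sub finite_subset by blast

lemma unstarted_subset: "unstarted n \<subseteq> A"
  by (induction n) (auto simp: unstarted_0 unstarted_Suc)

lemma fin_unstarted: "finite (unstarted n)"
  using unstarted_subset finA finite_subset by blast

lemma pick_prop:
  assumes "finite U" "U \<noteq> {}" "Min (r ` U) \<le> S"
  shows "pick U S \<in> U \<and> r (pick U S) \<le> S \<and> (\<forall>l\<in>U. r l \<le> S \<longrightarrow> d l \<le> d (pick U S))"
proof -
  let ?P = "{j\<in>U. r j \<le> S}"
  have "Min (r ` U) \<in> r ` U" using assms by (intro Min_in) auto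
  then obtain j where "j \<in> U" "Min (r ` U) = r j" by (elim imageE) simp
  then have ne: "?P \<noteq> {}" using assms(3) by auto
  have fin: "finite ?P" using assms by auto
  have "Max (d ` ?P) \<in> d ` ?P" using ne fin by (intro Max_in) auto
  then obtain j where j: "j \<in> ?P" "d j = Max (d ` ?P)" by auto
  have "d l \<le> d j" if "l \<in> U" "r l \<le> S" for l
    using that fin by (auto simp: j(2))
  then have "\<exists>j. j \<in> U \<and> r j \<le> S \<and> (\<forall>l\<in>U. r l \<le> S \<longrightarrow> d l \<le> d j)" using j(1) by blast
  then show ?thesis unfolding pick_def by (rule someI_ex)
qed

lemma Min_le_run_start:
  assumes "unstarted n \<noteq> {}" shows "Min (r ` unstarted n) \<le> run_start n"
  by (simp add: run_start_def next_start_def unstarted_def)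

lemma run_job_prop:
  assumes "unstarted n \<noteq> {}"
  shows "run_job n \<in> unstarted n" "r (run_job n) \<le> run_start n"
    "\<And>l. l \<in> unstarted n \<Longrightarrow> r l \<le> run_start n \<Longrightarrow> d l \<le> d (run_job n)"
  using pick_prop[OF fin_unstarted assms Min_le_run_start[OF assms]] by (auto simp: run_job_def)

lemma card_unstarted: "n \<le> card A \<Longrightarrow> card (unstarted n) = card A - n"
proof (induction n)
  case (Suc n)
  then have "unstarted n \<noteq> {}" by auto
  then show ?case using Suc run_job_prop(1)[of n] fin_unstarted[of n] by (simp add: unstarted_Suc)
qed (simp add: unstarted_0)

lemma unstarted_nonempty: "n < card A \<Longrightarrow> unstarted n \<noteq> {}"
  using card_unstarted[of n] by auto

lemma unstarted_empty: "unstarted (card A) = {}"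
  using card_unstarted[of "card A"] fin_unstarted by auto

lemma unstarted_antimono: "n \<le> n' \<Longrightarrow> unstarted n' \<subseteq> unstarted n"
  by (rule lift_Suc_antimono_le[of unstarted]) (auto simp: unstarted_Suc)

lemma run_job_in: "n < card A \<Longrightarrow> run_job n \<in> A"
  using run_job_prop(1)[OF unstarted_nonempty] unstarted_subset by blast

lemma run_job_distinct: "n < n' \<Longrightarrow> n' < card A \<Longrightarrow> run_job n \<noteq> run_job n'"
  using run_job_prop(1)[OF unstarted_nonempty, of n'] unstarted_antimono[of "Suc n" n']
  by (auto simp: unstarted_Suc)

lemma run_job_inj: "inj_on run_job {..<card A}"
  by (rule linorder_inj_onI) (use run_job_distinct in auto)

lemma run_job_image: "run_job ` {..<card A} = A"
  by (rule card_subset_eq[OF finA]) (auto simp: run_job_in card_image[OF run_job_inj])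

lemma run_job_bij: "bij_betw run_job {..<card A} A"
  using run_job_inj run_job_image by (simp add: bij_betw_def)

lemma run_index_run_job: "n < card A \<Longrightarrow> run_index (run_job n) = n"
  unfolding run_index_def
proof (rule Least_equality)
  fix n' assume "n < card A" "run_job n' = run_job n"
  then show "n \<le> n'" using run_job_distinct[of n' n] by (metis not_le)
qed simp

lemma run_index_prop:
  assumes "j \<in> A" shows "run_index j < card A" "run_job (run_index j) = j"
proof -
  obtain n where "n < card A" "run_job n = j"
    using bij_betw_imp_surj_on[OF run_job_bij] assms by (metis imageE lessThan_iff)
  then show "run_index j < card A" "run_job (run_index j) = j" using run_index_run_job by auto
qed

lemma job_stop_eq: "j \<in> A \<Longrightarrow> job_stop j = run_end (job_start j) j"
  by (simp add: job_stop_def run_stop_def job_start_def run_index_prop)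

lemma fin_alarms: "finite (alarms S k)" using finJ by (simp add: alarms_def)

lemma run_end_bounds:
  assumes "k \<in> J" shows "S < run_end S k" "run_end S k \<le> S + p k"
proof -
  have "S < Min (alarms S k) \<and> Min (alarms S k) < S + p k" if "alarms S k \<noteq> {}"
    using Min_in[OF fin_alarms that] by (simp add: alarms_def)
  then have "S < run_end S k \<and> run_end S k \<le> S + p k"
    using p_pos[OF assms] unfolding run_end_def
    by (cases "alarms S k = {}") (simp_all only: if_True if_False less_imp_le simp_thms less_add_same_cancel1 order_refl)
  then show "S < run_end S k" "run_end S k \<le> S + p k" by auto
qed

lemma run_end_alarm:
  assumes "alarms S k \<noteq> {}"
  shows "run_end S k < S + p k" "\<kappa> * w k \<le> (\<Sum>l | l \<in> J \<and> S < r l \<and> r l \<le> run_end S k. w l)"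
proof -
  have "run_end S k \<in> alarms S k"
    using Min_in[OF fin_alarms assms] assms by (simp add: run_end_def)
  then show "run_end S k < S + p k" "\<kappa> * w k \<le> (\<Sum>l | l \<in> J \<and> S < r l \<and> r l \<le> run_end S k. w l)"
    by (auto simp: alarms_def)
qed

text \<open>The last release strictly before the end of the run is not an alarm, so the weight up to
  it stays below the threshold. The end itself has to be excluded: the release that raises the alarm
  may exceed the threshold by any amount.\<close>

lemma weight_before_run_end:
  assumes "k \<in> J"
  shows "(\<Sum>l | l \<in> J \<and> S < r l \<and> r l < run_end S k. w l) \<le> \<kappa> * w k"
proof (cases "{l\<in>J. S < r l \<and> r l < run_end S k} = {}")
  case True
  have "\<kappa> * w k > 0" using kappa_pos w_pos[OF assms] by simp
  then show ?thesis using True by (metis less_eq_real_def sum.empty)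
next
  case False
  let ?B = "{l\<in>J. S < r l \<and> r l < run_end S k}"
  define u where "u = Max (r ` ?B)"
  have fin: "finite ?B" using finJ by auto
  have "u \<in> r ` ?B" unfolding u_def using fin False by (intro Max_in) auto
  then have u: "u \<in> r ` J" "S < u" "u < run_end S k" by auto
  have le: "r l \<le> u" if "l \<in> ?B" for l unfolding u_def using fin that by (intro Max_ge) auto
  have "u \<notin> alarms S k"
  proof
    assume "u \<in> alarms S k"
    then have "run_end S k \<le> u" using fin_alarms by (auto simp: run_end_def)
    then show False using u by simp
  qed
  moreover have "u < S + p k" using u(3) run_end_bounds(2)[OF assms, of S] by simp
  ultimately have "(\<Sum>l | l \<in> J \<and> S < r l \<and> r l \<le> u. w l) < \<kappa> * w k"
    using u by (auto simp: alarms_def)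
  moreover have "?B = {l\<in>J. S < r l \<and> r l \<le> u}" using le u(3) by fastforce
  ultimately show ?thesis by simp
qed

lemma run_bounds:
  assumes "n < card A"
  shows "run_start n < run_stop n" "run_stop n \<le> run_start n + p (run_job n)"
  using run_end_bounds[of "run_job n" "run_start n"] run_job_in[OF assms] A_sub
  by (auto simp: run_stop_def)

lemma run_stop_le_start_Suc: "run_stop n \<le> run_start (Suc n)"
  by (simp add: run_start_Suc)

lemma run_stop_le_start: "n < n' \<Longrightarrow> n' < card A \<Longrightarrow> run_stop n \<le> run_start n'"
proof (induction n')
  case (Suc n')
  show ?case
  proof (cases "n = n'")
    case True then show ?thesis using run_stop_le_start_Suc by simp
  next
    case False
    then have "run_stop n \<le> run_start n'" using Suc by auto
    also have "\<dots> < run_stop n'" using run_bounds[of n'] Suc by auto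
    also have "\<dots> \<le> run_start (Suc n')" by (rule run_stop_le_start_Suc)
    finally show ?thesis by simp
  qed
qed simp

lemma run_start_strict: "n < n' \<Longrightarrow> n' < card A \<Longrightarrow> run_start n < run_start n'"
  using run_stop_le_start[of n n'] run_bounds(1)[of n] by simp

lemma run_intervals_disjoint:
  assumes "n < card A" "n' < card A" "n \<noteq> n'"
  shows "run_stop n \<le> run_start n' \<or> run_stop n' \<le> run_start n"
  using assms run_stop_le_start[of n n'] run_stop_le_start[of n' n] by (cases "n < n'") auto

lemma release_le_job_start: "j \<in> A \<Longrightarrow> r j \<le> job_start j"
  using run_job_prop(2)[OF unstarted_nonempty] run_index_prop[of j] by (metis job_start_def)

text \<open>Every interrupted run is paid for by the weight released after its start and up to its
  stop. Runs do not overlap, so these half-open windows are disjoint and no job pays twice.\<close>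

lemma interrupted_weight:
  "\<kappa> * (\<Sum>j | j \<in> A \<and> interrupted j. w j) \<le> (\<Sum>j\<in>J. w j)"
proof -
  let ?I = "\<lambda>j. {l \<in> J. job_start j < r l \<and> r l \<le> job_stop j}"
  let ?X = "{j\<in>A. interrupted j}"
  have finX: "finite ?X" using finA by auto
  have "\<kappa> * (\<Sum>j\<in>?X. w j) = (\<Sum>j\<in>?X. \<kappa> * w j)" by (simp add: sum_distrib_left)
  also have "\<dots> \<le> (\<Sum>j\<in>?X. \<Sum>l\<in>?I j. w l)"
    using run_end_alarm(2) by (intro sum_mono) (auto simp: interrupted_def job_stop_eq)
  also have "\<dots> = (\<Sum>l\<in>(\<Union>j\<in>?X. ?I j). w l)"
  proof (intro sum.UNION_disjoint[symmetric] finX ballI impI)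
    fix j j' assume jj: "j \<in> ?X" "j' \<in> ?X" "j \<noteq> j'"
    then have "run_index j \<noteq> run_index j'" using run_index_prop(2) by (metis mem_Collect_eq)
    then have "job_stop j \<le> job_start j' \<or> job_stop j' \<le> job_start j"
      unfolding job_stop_def job_start_def
      using jj run_intervals_disjoint run_index_prop(1) by auto
    then show "?I j \<inter> ?I j' = {}" by auto
  qed (use finJ in auto)
  also have "\<dots> \<le> (\<Sum>j\<in>J. w j)"
    using finJ w_pos by (intro sum_mono2) (auto intro: less_imp_le)
  finally show ?thesis by simp
qed

section \<open>Waiting volume of a set of jobs that is closed under higher density\<close>

definition waiting :: "nat set \<Rightarrow> real \<Rightarrow> real" where
  "waiting H t = (\<Sum>j | j \<in> A \<inter> H \<and> r j \<le> t \<and> t < job_start j. p j)"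

definition arrived :: "nat set \<Rightarrow> real \<Rightarrow> real \<Rightarrow> real" where
  "arrived H a b = (\<Sum>j | j \<in> H \<and> a \<le> r j \<and> r j \<le> b. p j)"

text \<open>Both ends are excluded: a job released at the start of the run was available when
  \<open>k\<close> was picked, and a job released at its stop is counted by \<open>arrived\<close>
  from the stop on.\<close>

definition blocked :: "nat set \<Rightarrow> nat \<Rightarrow> real" where
  "blocked H k = (\<Sum>j | j \<in> J \<inter> H \<and> job_start k < r j \<and> r j < job_stop k. p j)"

lemma A_p_nonneg: "j \<in> A \<Longrightarrow> 0 \<le> p j" using A_sub p_pos less_imp_le by blast

text \<open>The machine does not idle while a job waits. If \<open>n\<close> is the last run started
  by \<open>t\<close> and \<open>j0\<close> waits at \<open>t\<close>, then run \<open>Suc n\<close>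
  starts at the later of the stop of run \<open>n\<close> and a release that is at most
  \<open>r j0\<close>; since it starts after \<open>t\<close>, run \<open>n\<close> is still going
  on.\<close>

lemma waiting_cases:
  assumes "waiting H t > 0"
  shows "(\<exists>n<card A. run_start n \<le> t \<and> t < run_stop n \<and>
     waiting H t = (\<Sum>j | j \<in> unstarted (Suc n) \<inter> H \<and> r j \<le> t. p j))"
proof -
  have "{j \<in> A \<inter> H. r j \<le> t \<and> t < job_start j} \<noteq> {}"
    using assms unfolding waiting_def by (metis (no_types, lifting) less_irrefl sum.empty)
  then obtain j0 where j0: "j0 \<in> A" "j0 \<in> H" "r j0 \<le> t" "t < job_start j0" by auto
  let ?i0 = "run_index j0"
  have i0: "?i0 < card A" "run_job ?i0 = j0" using run_index_prop j0(1) by auto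
  have *: "run_start 0 \<le> t" unfolding run_start_0
    using j0 finA by (intro order.trans[OF Min_le[of _ "r j0"]]) auto
  define n where "n = Max {n. n < card A \<and> run_start n \<le> t}"
  have fin: "finite {n. n < card A \<and> run_start n \<le> t}" by auto
  have "n \<in> {n. n < card A \<and> run_start n \<le> t}"
    unfolding n_def using * i0 by (intro Max_in fin) (auto intro!: exI[of _ 0])
  then have n: "n < card A" "run_start n \<le> t" by auto
  have nmax: "n' \<le> n" if "n' < card A" "run_start n' \<le> t" for n'
    unfolding n_def using that by (intro Max_ge fin) auto
  have i0n: "n < ?i0"
  proof (rule ccontr)
    assume "\<not> n < ?i0"
    then have "run_start ?i0 \<le> run_start n"
      using run_start_strict[of ?i0 n] n(1) by (cases "?i0 = n") auto
    then show False using j0(4) n by (simp add: job_start_def)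
  qed
  have Sn: "Suc n < card A" using i0n i0 by simp
  have tlt: "t < run_start (Suc n)" using nmax[of "Suc n"] Sn by force
  have j0u: "j0 \<in> unstarted (Suc n)"
    using run_job_prop(1)[OF unstarted_nonempty[OF i0(1)]] unstarted_antimono[of "Suc n" ?i0] i0n i0 by auto
  have "Min (r ` unstarted (Suc n)) \<le> r j0" using j0u fin_unstarted by (intro Min_le) auto
  then have "t < run_stop n" using tlt j0(3) by (simp add: run_start_Suc)
  moreover have "{j \<in> A \<inter> H. r j \<le> t \<and> t < job_start j} = {j \<in> unstarted (Suc n) \<inter> H. r j \<le> t}"
  proof -
    have "t < job_start j \<longleftrightarrow> j \<in> unstarted (Suc n)" if j: "j \<in> A" for j
    proof
      assume "t < job_start j"
      then have "n < run_index j"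
        using run_start_strict[of "run_index j" n] n by (cases "run_index j" n rule: linorder_cases)
           (auto simp: job_start_def)
      then show "j \<in> unstarted (Suc n)"
        using run_index_prop[OF j] run_job_prop(1)[OF unstarted_nonempty, of "run_index j"]
          unstarted_antimono[of "Suc n" "run_index j"] by auto
    next
      assume ju: "j \<in> unstarted (Suc n)"
      have "n < run_index j"
      proof (rule ccontr)
        assume "\<not> n < run_index j"
        then have "unstarted (Suc n) \<subseteq> unstarted (Suc (run_index j))"
          by (intro unstarted_antimono) auto
        then show False using ju run_index_prop(2)[OF j] by (auto simp: unstarted_Suc)
      qed
      then have "run_start (Suc n) \<le> run_start (run_index j)"
        using run_start_strict[of "Suc n" "run_index j"] run_index_prop[OF j]
        by (cases "Suc n = run_index j") auto
      then show "t < job_start j" using tlt by (simp add: job_start_def)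
    qed
    then show ?thesis using unstarted_subset by blast
  qed
  ultimately show ?thesis using n by (auto simp: waiting_def)
qed

text \<open>
  The three cases record how the current stretch of runs of jobs in \<open>H\<close> began: after a moment
  without waiting jobs of \<open>H\<close>, after a job outside of \<open>H\<close> whose run blocked \<open>H\<close>, or not yet,
  because the current run is itself such a blocking run.
\<close>

lemma busy_stretch:
  assumes H: "\<forall>j\<in>H. \<forall>l. d j \<le> d l \<longrightarrow> l \<in> H" and "n < card A"
  defines "Q \<equiv> \<lambda>n t. (\<Sum>j | j \<in> unstarted (Suc n) \<inter> H \<and> r j \<le> t. p j)"
  shows "(\<exists>t0\<le>run_start n. \<forall>t\<ge>run_start n. Q n t + (run_stop n - t0) \<le> arrived (A \<inter> H) t0 t) \<or>
    (\<exists>m<n. \<forall>t\<ge>run_start n. Q n t + (run_stop n - run_stop m) \<le>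
        (\<Sum>j | j \<in> A \<inter> H \<and> run_start m < r j \<and> r j \<le> t. p j)) \<or>
    (\<forall>j\<in>unstarted (Suc n) \<inter> H. run_start n < r j)"
  using assms(2)
proof (induction n)
  have QH: "Q n t = (\<Sum>j | j \<in> unstarted n \<inter> H \<and> r j \<le> t. p j) - p (run_job n)"
    if "n < card A" "run_job n \<in> H" "t \<ge> run_start n" for n t
  proof -
    have "{j \<in> unstarted (Suc n) \<inter> H. r j \<le> t} = {j \<in> unstarted n \<inter> H. r j \<le> t} - {run_job n}"
      by (auto simp: unstarted_Suc)
    moreover have "run_job n \<in> {j \<in> unstarted n \<inter> H. r j \<le> t}"
      using that run_job_prop[OF unstarted_nonempty[OF that(1)]] by auto
    ultimately show ?thesis unfolding Q_def
      using fin_unstarted[of n] by (simp add: sum_diff1)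
  qed
  \<comment> \<open>The densest available job was picked. If it is outside of \<open>H\<close>,
    which contains with each job all at least equally dense ones, then no job of \<open>H\<close>
    was available.\<close>
  have notH: "\<forall>j\<in>unstarted (Suc n) \<inter> H. run_start n < r j" if "n < card A" "run_job n \<notin> H" for n
    using that run_job_prop(3)[OF unstarted_nonempty[OF that(1)]] H
    by (force simp: unstarted_Suc not_less[symmetric])
  \<comment> \<open>If no remaining job is older than the start of the run, all volume still to come
    arrives from that start on, and the account can be opened there.\<close>
  have fresh: "\<exists>t0\<le>run_start n. \<forall>t\<ge>run_start n. Q n t + (run_stop n - t0) \<le> arrived (A \<inter> H) t0 t"
    if n: "n < card A" "run_job n \<in> H" "\<And>j. j \<in> unstarted n \<Longrightarrow> run_start n \<le> r j" for n
  proof (intro exI[of _ "run_start n"] conjI allI impI)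
    fix t assume t: "run_start n \<le> t"
    have "Q n t + (run_stop n - run_start n) \<le> (\<Sum>j | j \<in> unstarted n \<inter> H \<and> r j \<le> t. p j)"
      using QH[OF n(1,2) t] run_bounds(2)[OF n(1)] by simp
    also have "\<dots> \<le> arrived (A \<inter> H) (run_start n) t"
      unfolding arrived_def using n(3) unstarted_subset A_p_nonneg finA by (intro sum_mono2) auto
    finally show "Q n t + (run_stop n - run_start n) \<le> arrived (A \<inter> H) (run_start n) t" .
  qed simp
  {
    case 0
    show ?case
    proof (cases "run_job 0 \<in> H")
      case True
      then show ?thesis using fresh[of 0] 0 finA by (auto simp: run_start_0 unstarted_0)
    qed (use notH[of 0] 0 in auto)
  next
    case (Suc n)
    show ?case
    proof (cases "run_job (Suc n) \<in> H")
      case False then show ?thesis using notH[of "Suc n"] Suc by auto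
    next
      case True
      show ?thesis
      proof (cases "run_start (Suc n) = run_stop n")
        case False
        then have "run_start (Suc n) = Min (r ` unstarted (Suc n))"
          by (auto simp: run_start_Suc max_def split: if_splits)
        then have "run_start (Suc n) \<le> r j" if "j \<in> unstarted (Suc n)" for j
          using that fin_unstarted by auto
        then show ?thesis using fresh[of "Suc n"] Suc True by auto
      next
        case eq: True
        \<comment> \<open>Without a gap, the time that passes until the next stop is at most the
          size of the job of \<open>H\<close> that leaves the queue; an interruption only shortens
          it.\<close>
        have step: "Q (Suc n) t + (run_stop (Suc n) - run_stop n) \<le> Q n t"
          if "t \<ge> run_start (Suc n)" for t
          using QH[of "Suc n" t] that Suc True run_bounds(2)[of "Suc n"] by (simp add: Q_def eq)
        have nn: "n < card A" "run_start n \<le> run_start (Suc n)"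
          using Suc run_start_strict[of n "Suc n"] by auto
        from Suc.IH[OF nn(1)] show ?thesis
        proof (elim disjE exE conjE)
          fix t0 assume t0: "t0 \<le> run_start n"
            "\<forall>t\<ge>run_start n. Q n t + (run_stop n - t0) \<le> arrived (A \<inter> H) t0 t"
          have "Q (Suc n) t + (run_stop (Suc n) - t0) \<le> arrived (A \<inter> H) t0 t"
            if "t \<ge> run_start (Suc n)" for t
            using step[OF that] t0(2)[rule_format, of t] that nn by linarith
          then show ?thesis using t0 nn by (intro disjI1 exI[of _ t0]) auto
        next
          fix m assume m: "m < n" "\<forall>t\<ge>run_start n. Q n t + (run_stop n - run_stop m)
                \<le> (\<Sum>j | j \<in> A \<inter> H \<and> run_start m < r j \<and> r j \<le> t. p j)"
          have "Q (Suc n) t + (run_stop (Suc n) - run_stop m)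
                \<le> (\<Sum>j | j \<in> A \<inter> H \<and> run_start m < r j \<and> r j \<le> t. p j)"
            if "t \<ge> run_start (Suc n)" for t
            using step[OF that] m(2)[rule_format, of t] that nn by linarith
          then show ?thesis using m by (intro disjI2 disjI1 exI[of _ m]) auto
        next
          assume c: "\<forall>j\<in>unstarted (Suc n) \<inter> H. run_start n < r j"
          have "Q (Suc n) t + (run_stop (Suc n) - run_stop n)
                \<le> (\<Sum>j | j \<in> A \<inter> H \<and> run_start n < r j \<and> r j \<le> t. p j)"
            if "t \<ge> run_start (Suc n)" for t
          proof -
            have "Q n t \<le> (\<Sum>j | j \<in> A \<inter> H \<and> run_start n < r j \<and> r j \<le> t. p j)"
              unfolding Q_def using c unstarted_subset A_p_nonneg finA by (intro sum_mono2) auto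
            then show ?thesis using step[OF that] by simp
          qed
          then show ?thesis by (intro disjI2 disjI1 exI[of _ n]) auto
        qed
      qed
    qed
  }
qed

text \<open>For a stretch behind a blocking run of \<open>k\<close> there are two accounts. The one
  opened at the stop of \<open>k\<close> shows the blocked volume explicitly; the one opened at its
  start counts the blocked jobs among the arrivals and loses only the time spent on
  \<open>k\<close>, at most \<open>p k\<close>. The first serves shortly after the run, the second
  once slack has built up to absorb \<open>p k\<close>.\<close>

lemma waiting_bound:
  assumes H: "\<forall>j\<in>H. \<forall>l. d j \<le> d l \<longrightarrow> l \<in> H" and pos: "waiting H t > 0"
  shows "(\<exists>k\<in>A. job_start k \<le> t \<and> t < job_stop k \<and> waiting H t \<le> blocked H k) \<or>
    (\<exists>t0\<le>t. waiting H t \<le> arrived (A \<inter> H) t0 t - (t - t0)) \<or>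
    (\<exists>k\<in>A. job_stop k \<le> t \<and> waiting H t \<le> blocked H k + arrived (A \<inter> H) (job_stop k) t - (t - job_stop k) \<and>
      waiting H t \<le> arrived (A \<inter> H) (job_start k) t - (t - job_start k) + p k)"
proof -
  have pJ: "\<And>j. j \<in> J \<Longrightarrow> 0 \<le> p j" using p_pos less_imp_le by blast
  obtain n where n: "n < card A" "run_start n \<le> t" "t < run_stop n"
    and eq: "waiting H t = (\<Sum>j | j \<in> unstarted (Suc n) \<inter> H \<and> r j \<le> t. p j)"
    using waiting_cases[OF pos] by auto
  have conv: "job_start (run_job m) = run_start m" "job_stop (run_job m) = run_stop m"
    if "m < card A" for m using that run_index_run_job by (auto simp: job_start_def job_stop_def)
  from busy_stretch[OF H n(1), folded eq] show ?thesis
  proof (elim disjE exE conjE)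
    fix t0 assume t0: "t0 \<le> run_start n" "\<forall>t'\<ge>run_start n. (\<Sum>j | j \<in> unstarted (Suc n) \<inter> H \<and> r j \<le> t'. p j)
       + (run_stop n - t0) \<le> arrived (A \<inter> H) t0 t'"
    have "waiting H t \<le> arrived (A \<inter> H) t0 t - (t - t0)"
      using t0(2)[rule_format, of t] n eq by linarith
    then show ?thesis using t0 n by (intro disjI2 disjI1 exI[of _ t0]) auto
  next
    fix m assume m: "m < n" "\<forall>t'\<ge>run_start n. (\<Sum>j | j \<in> unstarted (Suc n) \<inter> H \<and> r j \<le> t'. p j)
       + (run_stop n - run_stop m) \<le> (\<Sum>j | j \<in> A \<inter> H \<and> run_start m < r j \<and> r j \<le> t'. p j)"
    let ?k = "run_job m"
    let ?B = "(\<Sum>j | j \<in> A \<inter> H \<and> run_start m < r j \<and> r j \<le> t. p j)"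
    have mA: "m < card A" using m n by auto
    have le: "waiting H t \<le> ?B - (t - run_stop m)"
      using m(2)[rule_format, of t] n eq by linarith
    have sm: "run_stop m \<le> t" using run_stop_le_start[OF m(1) n(1)] n by simp
    have "?B \<le> arrived (A \<inter> H) (run_start m) t"
      unfolding arrived_def using A_p_nonneg finA by (intro sum_mono2) auto
    then have 1: "waiting H t \<le> arrived (A \<inter> H) (run_start m) t - (t - run_start m) + p ?k"
      using le run_bounds(2)[OF mA] by linarith
    have "?B = (\<Sum>j | j \<in> A \<inter> H \<and> run_start m < r j \<and> r j < run_stop m. p j) + arrived (A \<inter> H) (run_stop m) t"
      unfolding arrived_def
    proof (subst sum.union_disjoint[symmetric])
      show "(\<Sum>j | j \<in> A \<inter> H \<and> run_start m < r j \<and> r j \<le> t. p j) =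
        sum p ({j \<in> A \<inter> H. run_start m < r j \<and> r j < run_stop m} \<union> {j \<in> A \<inter> H. run_stop m \<le> r j \<and> r j \<le> t})"
        by (rule sum.cong) (use sm run_bounds(1)[OF mA] in auto)
    qed (use finA in auto)
    moreover have "(\<Sum>j | j \<in> A \<inter> H \<and> run_start m < r j \<and> r j < run_stop m. p j) \<le> blocked H ?k"
      unfolding blocked_def conv[OF mA] using pJ finJ A_sub by (intro sum_mono2) auto
    ultimately have 2: "waiting H t \<le> blocked H ?k + arrived (A \<inter> H) (run_stop m) t - (t - run_stop m)"
      using le by linarith
    show ?thesis using 1 2 sm run_job_in[OF mA] conv[OF mA] by (intro disjI2 bexI[of _ ?k]) auto
  next
    assume c: "\<forall>j\<in>unstarted (Suc n) \<inter> H. run_start n < r j"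
    let ?k = "run_job n"
    have "waiting H t \<le> blocked H ?k"
      unfolding blocked_def conv[OF n(1)] eq using pJ finJ A_sub unstarted_subset[of "Suc n"] c n
      by (intro sum_mono2) auto
    then show ?thesis using n run_job_in[OF n(1)] conv[OF n(1)] by (intro disjI1 bexI[of _ ?k]) auto
  qed
qed

end

section \<open>Online behaviour of a single machine\<close>

locale machine_queue_pair =
  Q: machine_queue_ok J A r w p d \<kappa> + Q': machine_queue_ok J' A' r' w' p' d' \<kappa>
  for J A r w p d J' A' r' w' p' d' \<kappa> +
  fixes t :: real
  assumes same_J: "{j\<in>J. r j \<le> t} = {j\<in>J'. r' j \<le> t}"
    and same_A: "{j\<in>A. r j \<le> t} = {j\<in>A'. r' j \<le> t}"
    and same: "\<And>j. j \<in> J \<Longrightarrow> r j \<le> t \<Longrightarrow> r' j = r j \<and> w' j = w j \<and> p' j = p j \<and> d' j = d j"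
begin

lemma same_J_iff: "j \<in> J \<and> r j \<le> t \<longleftrightarrow> j \<in> J' \<and> r' j \<le> t"
  using same_J by blast

text \<open>The minimum is at most \<open>t\<close>, so it is attained by a job visible in both
  instances, and later jobs cannot undercut it.\<close>

lemma same_Min:
  assumes U: "U \<subseteq> A" "U' \<subseteq> A'" "{j\<in>U. r j \<le> t} = {j\<in>U'. r' j \<le> t}"
    and "U \<noteq> {}" "Min (r ` U) \<le> t"
  shows "U' \<noteq> {}" "Min (r' ` U') = Min (r ` U)"
proof -
  have fin: "finite U" "finite U'"
    using finite_subset[OF U(1) Q.finA] finite_subset[OF U(2) Q'.finA] by auto
  have UJ: "\<And>j. j \<in> U \<Longrightarrow> j \<in> J" using U Q.A_sub by auto
  have "Min (r ` U) \<in> r ` U" using fin assms by (intro Min_in) auto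
  then obtain j where j: "j \<in> U" "r j = Min (r ` U)" by (metis imageE)
  then have j': "j \<in> U'" "r' j = r j" using assms same[of j] UJ by auto
  then show "U' \<noteq> {}" by auto
  show "Min (r' ` U') = Min (r ` U)"
  proof (rule Min_eqI)
    fix y assume "y \<in> r' ` U'"
    then obtain l where l: "l \<in> U'" "y = r' l" by auto
    show "Min (r ` U) \<le> y"
    proof (cases "r' l \<le> t")
      case True
      then have "l \<in> U" "r' l = r l" using U(3) l UJ same[of l] by auto
      then show ?thesis using fin l by auto
    qed (use assms l in auto)
  next
    show "Min (r ` U) \<in> r' ` U'" using j' j(2) by (metis imageI)
  qed (use fin in auto)
qed

text \<open>The predicates under \<open>SOME\<close> agree on every job, not just on its density;
  hence the choice is the same even among equally dense jobs.\<close>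

lemma same_pick:
  assumes U: "U \<subseteq> A" "{j\<in>U. r j \<le> t} = {j\<in>U'. r' j \<le> t}" and "S \<le> t"
  shows "Q'.pick U' S = Q.pick U S"
proof -
  have UJ: "\<And>j. j \<in> U \<Longrightarrow> j \<in> J" using U Q.A_sub by auto
  have in_iff: "j \<in> U' \<and> r' j \<le> S \<longleftrightarrow> j \<in> U \<and> r j \<le> S" for j
  proof (cases "j \<in> U \<and> r j \<le> t")
    case True then show ?thesis using U(2) same[of j] UJ by auto
  next
    case False
    then have "\<not> (j \<in> U' \<and> r' j \<le> t)" using U(2) by blast
    then show ?thesis using False assms(3) by auto
  qed
  have d: "d' j = d j" if "j \<in> U \<and> r j \<le> S" for j using same[of j] UJ assms(3) that by auto
  have "(\<forall>l\<in>U'. r' l \<le> S \<longrightarrow> d' l \<le> x) \<longleftrightarrow> (\<forall>l\<in>U. r l \<le> S \<longrightarrow> d l \<le> x)" for x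
  proof (intro iffI ballI impI)
    fix l assume "\<forall>l\<in>U'. r' l \<le> S \<longrightarrow> d' l \<le> x" "l \<in> U" "r l \<le> S"
    then show "d l \<le> x" using in_iff[of l] d[of l] by auto
  next
    fix l assume "\<forall>l\<in>U. r l \<le> S \<longrightarrow> d l \<le> x" "l \<in> U'" "r' l \<le> S"
    then show "d' l \<le> x" using in_iff[of l] d[of l] by auto
  qed
  note all_iff = this
  have "(j \<in> U' \<and> r' j \<le> S \<and> (\<forall>l\<in>U'. r' l \<le> S \<longrightarrow> d' l \<le> d' j)) \<longleftrightarrow>
        (j \<in> U \<and> r j \<le> S \<and> (\<forall>l\<in>U. r l \<le> S \<longrightarrow> d l \<le> d j))" for j
    using in_iff[of j] d[of j] all_iff[of "d j"] by auto
  then show ?thesis by (simp add: Q.pick_def Q'.pick_def)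
qed

lemma same_alarms:
  assumes "k \<in> J" "r k \<le> t" "u \<le> t"
  shows "u \<in> Q'.alarms S k \<longleftrightarrow> u \<in> Q.alarms S k"
proof -
  have pw: "p' k = p k" "w' k = w k" using same[OF assms(1,2)] by auto
  have in_iff: "l \<in> J' \<and> r' l \<le> u \<longleftrightarrow> l \<in> J \<and> r l \<le> u" for l
    using same_J_iff[of l] same[of l] assms(3) by (cases "l \<in> J \<and> r l \<le> t") auto
  have req: "r' l = r l" if "l \<in> J \<and> r l \<le> u" for l using same[of l] that assms(3) by auto
  have img: "u \<in> r' ` J' \<longleftrightarrow> u \<in> r ` J"
  proof
    assume "u \<in> r' ` J'"
    then obtain l where "l \<in> J'" "u = r' l" by (rule imageE) simp
    then have "l \<in> J" "u = r l" using in_iff[of l] req[of l] by auto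
    then show "u \<in> r ` J" by simp
  next
    assume "u \<in> r ` J"
    then obtain l where "l \<in> J" "u = r l" by (rule imageE) simp
    then have "l \<in> J'" "u = r' l" using in_iff[of l] req[of l] by auto
    then show "u \<in> r' ` J'" by simp
  qed
  have set: "{l \<in> J'. S < r' l \<and> r' l \<le> u} = {l \<in> J. S < r l \<and> r l \<le> u}"
  proof (rule Collect_cong)
    fix l show "(l \<in> J' \<and> S < r' l \<and> r' l \<le> u) = (l \<in> J \<and> S < r l \<and> r l \<le> u)"
      using in_iff[of l] req[of l] by auto
  qed
  have "(\<Sum>l | l \<in> J' \<and> S < r' l \<and> r' l \<le> u. w' l) = (\<Sum>l | l \<in> J \<and> S < r l \<and> r l \<le> u. w l)"
    unfolding set using same assms(3) by (intro sum.cong) auto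
  then show ?thesis by (simp add: Q.alarms_def Q'.alarms_def img pw)
qed

text \<open>All alarms up to \<open>t\<close> are common to both instances. If the run completes by
  \<open>t\<close>, an alarm of the other instance would also lie before \<open>t\<close>; if it is
  interrupted by \<open>t\<close>, the earliest alarm is a common one.\<close>

lemma same_run_end:
  assumes k: "k \<in> J" "r k \<le> t" and le: "Q.run_end S k \<le> t"
  shows "Q'.run_end S k = Q.run_end S k" "Q'.alarms S k = {} \<longleftrightarrow> Q.alarms S k = {}"
proof -
  have pk: "p' k = p k" using same[OF k] by auto
  have "Q'.run_end S k = Q.run_end S k \<and> (Q'.alarms S k = {} \<longleftrightarrow> Q.alarms S k = {})"
  proof (cases "Q.alarms S k = {}")
    case True
    then have "S + p k \<le> t" using le by (simp add: Q.run_end_def)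
    have "u \<notin> Q'.alarms S k" for u
    proof
      assume u: "u \<in> Q'.alarms S k"
      then have "u < S + p k" by (simp add: Q'.alarms_def pk)
      then show False using same_alarms[OF k, of u S] u \<open>S + p k \<le> t\<close> True by simp
    qed
    then have "Q'.alarms S k = {}" by blast
    then show ?thesis using True pk by (simp add: Q.run_end_def Q'.run_end_def)
  next
    case False
    let ?u = "Min (Q.alarms S k)"
    have u: "?u \<in> Q.alarms S k" "?u \<le> t"
      using Min_in[OF Q.fin_alarms False] le False by (auto simp: Q.run_end_def)
    then have u': "?u \<in> Q'.alarms S k" using same_alarms[OF k] by auto
    have "Min (Q'.alarms S k) = ?u"
    proof (rule Min_eqI[OF Q'.fin_alarms _ u'])
      fix y assume "y \<in> Q'.alarms S k"
      then show "?u \<le> y" using same_alarms[OF k, of y] Q.fin_alarms u(2)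
        by (cases "y \<le> t") auto
    qed
    then show ?thesis using False u' by (auto simp: Q.run_end_def Q'.run_end_def)
  qed
  then show "Q'.run_end S k = Q.run_end S k" "Q'.alarms S k = {} \<longleftrightarrow> Q.alarms S k = {}" by auto
qed

text \<open>A run that starts by \<open>t\<close> is preceded by a run that ends by
  \<open>t\<close>, on whose end both instances agree. The queues may differ in jobs released after
  \<open>t\<close>, but the next start is governed by a release not later than
  \<open>t\<close>.\<close>

lemma same_run:
  assumes "n < card A" "Q.run_start n \<le> t"
  shows "n < card A' \<and> Q'.run_start n = Q.run_start n \<and> Q'.run_job n = Q.run_job n \<and>
    {j \<in> Q.unstarted n. r j \<le> t} = {j \<in> Q'.unstarted n. r' j \<le> t}"
  using assms
proof (induction n)
  have conclude: "n < card A' \<and> Q'.run_start n = Q.run_start n \<and> Q'.run_job n = Q.run_job n \<and>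
    {j \<in> Q.unstarted n. r j \<le> t} = {j \<in> Q'.unstarted n. r' j \<le> t}"
    if n: "n < card A" "Q.run_start n \<le> t"
      and u: "{j \<in> Q.unstarted n. r j \<le> t} = {j \<in> Q'.unstarted n. r' j \<le> t}"
      and st: "Min (r' ` Q'.unstarted n) = Min (r ` Q.unstarted n) \<Longrightarrow> Q'.run_start n = Q.run_start n"
    for n
  proof -
    have ne: "Q.unstarted n \<noteq> {}" by (rule Q.unstarted_nonempty[OF n(1)])
    note M = same_Min[OF Q.unstarted_subset Q'.unstarted_subset u ne
        order.trans[OF Q.Min_le_run_start[OF ne] n(2)]]
    have "n < card A'"
    proof (rule ccontr)
      assume "\<not> n < card A'"
      then show False using M(1) Q'.unstarted_antimono[of "card A'" n] Q'.unstarted_empty by auto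
    qed
    moreover have "Q'.run_start n = Q.run_start n" using st M by simp
    moreover from this have "Q'.run_job n = Q.run_job n"
      using same_pick[OF Q.unstarted_subset u n(2)] by (simp add: Q.run_job_def Q'.run_job_def)
    ultimately show ?thesis using u by auto
  qed
  {
    case 0
    then show ?case using conclude[of 0] same_A
      by (simp add: Q.unstarted_0 Q'.unstarted_0 Q.run_start_0 Q'.run_start_0)
  next
    case (Suc n)
    have n: "n < card A" "Q.run_start n < Q.run_stop n" "Q.run_stop n \<le> t"
      using Suc Q.run_bounds(1)[of n] Q.run_stop_le_start_Suc[of n] by auto
    then have IH: "Q'.run_start n = Q.run_start n" "Q'.run_job n = Q.run_job n"
      "{j \<in> Q.unstarted n. r j \<le> t} = {j \<in> Q'.unstarted n. r' j \<le> t}" using Suc by auto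
    have k: "Q.run_job n \<in> J" "r (Q.run_job n) \<le> t"
      using Q.run_job_in[OF n(1)] Q.A_sub Q.run_job_prop(2)[OF Q.unstarted_nonempty[OF n(1)]] n by auto
    have stop: "Q'.run_stop n = Q.run_stop n"
      using same_run_end(1)[OF k, of "Q.run_start n"] n(3) by (simp add: Q.run_stop_def Q'.run_stop_def IH)
    have u: "{j \<in> Q.unstarted (Suc n). r j \<le> t} = {j \<in> Q'.unstarted (Suc n). r' j \<le> t}"
      using IH by (auto simp: Q.unstarted_Suc Q'.unstarted_Suc)
    show ?case
      by (rule conclude[OF Suc.prems u]) (simp add: Q.run_start_Suc Q'.run_start_Suc stop)
  }
qed

lemma same_job_start:
  assumes "j \<in> A" "Q.job_start j \<le> t"
  shows "j \<in> A'" "Q'.job_start j = Q.job_start j"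
proof -
  let ?n = "Q.run_index j"
  have n: "?n < card A" "Q.run_job ?n = j" using Q.run_index_prop[OF assms(1)] by auto
  have s: "?n < card A'" "Q'.run_start ?n = Q.run_start ?n" "Q'.run_job ?n = j"
    using same_run[OF n(1)] assms(2) n(2) by (auto simp: Q.job_start_def)
  then show "j \<in> A'" using Q'.run_job_in[of ?n] by auto
  have "Q'.run_index j = ?n" using s Q'.run_index_run_job[of ?n] by auto
  then show "Q'.job_start j = Q.job_start j" using s by (simp add: Q.job_start_def Q'.job_start_def)
qed

lemma same_interruption:
  assumes "j \<in> A" "Q.interrupted j" "Q.job_stop j \<le> t"
  shows "j \<in> A'" "Q'.interrupted j" "Q'.job_stop j = Q.job_stop j"
proof -
  have jJ: "j \<in> J" using assms Q.A_sub by auto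
  have s: "Q.job_start j \<le> t"
    using Q.run_end_bounds(1)[OF jJ, of "Q.job_start j"] assms by (simp add: Q.job_stop_eq)
  then have r: "r j \<le> t" using Q.release_le_job_start[OF assms(1)] by simp
  note js = same_job_start[OF assms(1) s]
  show "j \<in> A'" by (fact js)
  show "Q'.interrupted j" "Q'.job_stop j = Q.job_stop j"
    using same_run_end[OF jJ r, of "Q.job_start j"] assms js
    by (simp_all add: Q.interrupted_def Q'.interrupted_def Q.job_stop_eq Q'.job_stop_eq)
qed

end

subsection \<open>Dispatching and culling\<close>

definition dclass :: "job_instance \<Rightarrow> nat \<Rightarrow> nat \<Rightarrow> int" where
  "dclass I i j = \<lfloor>log 4 (weight I j / ptime I i j)\<rfloor>"

definition sclass :: "job_instance \<Rightarrow> nat \<Rightarrow> nat \<Rightarrow> int" where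
  "sclass I i j = \<lfloor>log 2 (ptime I i j)\<rfloor>"

definition rdens :: "job_instance \<Rightarrow> nat \<Rightarrow> nat \<Rightarrow> real" where
  "rdens I i j = 4 powr real_of_int (dclass I i j)"

text \<open>Lindley's recursion for the backlog of a server of rate \<open>s\<close>. The latest job
  heads the list, and the value is meaningful for \<open>u\<close> at or after its release. Jobs of
  other machines or lower levels enter with size 0, which merely splits a draining phase in
  two.\<close>

primrec workload :: "job_instance \<Rightarrow> real \<Rightarrow> (nat \<Rightarrow> nat) \<Rightarrow> nat \<Rightarrow> real \<Rightarrow> nat list \<Rightarrow> real \<Rightarrow> real" where
  "workload I s f i \<theta> [] u = 0"
| "workload I s f i \<theta> (j # xs) u = max 0 (workload I s f i \<theta> xs (release I j) +
     (if f j = i \<and> \<theta> \<le> rdens I i j then ptime I i j else 0) - s * (u - release I j))"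

text \<open>Values in \<open>ennreal\<close> make the definition independent of integrability;
  finiteness is proved later. The list \<open>xs\<close> holds the jobs before \<open>j\<close>, so
  \<open>j\<close> does not see its own size in the workload.\<close>

definition price :: "job_instance \<Rightarrow> real \<Rightarrow> (nat \<Rightarrow> nat) \<Rightarrow> nat list \<Rightarrow> nat \<Rightarrow> nat \<Rightarrow> ennreal" where
  "price I s f xs j i = ennreal (ptime I i j / s) * (\<integral>\<^sup>+\<theta>. indicator {0<..rdens I i j} \<theta> *
       ennreal (workload I s f i \<theta> xs (release I j)) \<partial>lborel) + ennreal (2 * weight I j * ptime I i j)"

definition cheapest :: "nat \<Rightarrow> job_instance \<Rightarrow> real \<Rightarrow> (nat \<Rightarrow> nat) \<Rightarrow> nat list \<Rightarrow> nat \<Rightarrow> nat" where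
  "cheapest m I s f xs j = (SOME i. i < m \<and> (\<forall>i'<m. price I s f xs j i \<le> price I s f xs j i'))"

primrec assign :: "nat \<Rightarrow> job_instance \<Rightarrow> real \<Rightarrow> nat list \<Rightarrow> nat \<Rightarrow> nat" where
  "assign m I s [] = (\<lambda>_. 0)"
| "assign m I s (j # xs) = (assign m I s xs)(j := cheapest m I s (assign m I s xs) xs j)"

definition job_class :: "job_instance \<Rightarrow> (nat \<Rightarrow> nat) \<Rightarrow> nat \<Rightarrow> nat \<times> int \<times> int" where
  "job_class I f j = (f j, dclass I (f j) j, sclass I (f j) j)"

primrec culled :: "nat \<Rightarrow> job_instance \<Rightarrow> (nat \<Rightarrow> nat) \<Rightarrow> nat list \<Rightarrow> nat set" where
  "culled K I f [] = {}"
| "culled K I f (j # xs) =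
     (if K dvd Suc (length (filter (\<lambda>l. job_class I f l = job_class I f j) xs)) then {j} else {})
       \<union> culled K I f xs"

text \<open>The sort is stable, so simultaneous releases are ordered by job name. The order of the
  jobs released by some time is therefore not affected by later ones.\<close>

definition arrivals :: "job_instance \<Rightarrow> nat list" where
  "arrivals I = rev (sort_key (release I) (sorted_list_of_set (jobs I)))"

lemma set_arrivals: "finite (jobs I) \<Longrightarrow> set (arrivals I) = jobs I"
  by (simp add: arrivals_def)

lemma distinct_arrivals: "distinct (arrivals I)"
  by (simp add: arrivals_def)

lemma sorted_arrivals: "sorted_wrt (\<lambda>j l. release I l \<le> release I j) (arrivals I)"
proof -
  have "sorted (map (release I) (sort_key (release I) (sorted_list_of_set (jobs I))))" by simp
  then show ?thesis by (simp add: arrivals_def sorted_wrt_rev sorted_wrt_map)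
qed

section \<open>Dependence of dispatching and culling on the revealed jobs\<close>

definition same_on :: "nat \<Rightarrow> nat set \<Rightarrow> job_instance \<Rightarrow> job_instance \<Rightarrow> bool" where
  "same_on m X I I' \<longleftrightarrow> (\<forall>j\<in>X. release I j = release I' j \<and> weight I j = weight I' j \<and>
     (\<forall>i<m. ptime I i j = ptime I' i j))"

lemma same_on_class:
  assumes "same_on m X I I'" "j \<in> X" "i < m"
  shows "dclass I i j = dclass I' i j" "sclass I i j = sclass I' i j" "rdens I i j = rdens I' i j"
  using assms by (simp_all add: same_on_def dclass_def sclass_def rdens_def)

lemma same_on_subset: "same_on m X I I' \<Longrightarrow> Y \<subseteq> X \<Longrightarrow> same_on m Y I I'"
  by (auto simp: same_on_def)

lemma workload_cong:
  assumes "same_on m (set xs) I I'" "i < m" "\<And>j. j \<in> set xs \<Longrightarrow> f j = f' j"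
  shows "workload I s f i \<theta> xs u = workload I' s f' i \<theta> xs u"
  using assms
proof (induction xs arbitrary: u)
  case (Cons j xs)
  have "same_on m (set xs) I I'" by (rule same_on_subset[OF Cons.prems(1)]) auto
  then have IH: "workload I s f i \<theta> xs u = workload I' s f' i \<theta> xs u" for u using Cons by auto
  have j: "rdens I i j = rdens I' i j" "release I j = release I' j" "ptime I i j = ptime I' i j" "f j = f' j"
    using Cons.prems same_on_class[OF Cons.prems(1), of j i] by (auto simp: same_on_def)
  show ?case by (simp add: IH j)
qed simp

lemma price_cong:
  assumes "same_on m (insert j (set xs)) I I'" "i < m" "\<And>l. l \<in> set xs \<Longrightarrow> f l = f' l"
  shows "price I s f xs j i = price I' s f' xs j i"
proof -
  have "same_on m (set xs) I I'" by (rule same_on_subset[OF assms(1)]) auto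
  note wl = workload_cong[OF this assms(2,3)]
  have j: "rdens I i j = rdens I' i j" "release I j = release I' j" "ptime I i j = ptime I' i j"
    "weight I j = weight I' j"
    using assms same_on_class[OF assms(1), of j i] by (auto simp: same_on_def)
  show ?thesis by (simp add: price_def wl j)
qed

lemma cheapest_cong:
  assumes "same_on m (insert j (set xs)) I I'" "\<And>l. l \<in> set xs \<Longrightarrow> f l = f' l"
  shows "cheapest m I s f xs j = cheapest m I' s f' xs j"
proof -
  note pc = price_cong[OF assms(1) _ assms(2)]
  have "(i < m \<and> (\<forall>i'<m. price I s f xs j i \<le> price I s f xs j i')) \<longleftrightarrow>
      (i < m \<and> (\<forall>i'<m. price I' s f' xs j i \<le> price I' s f' xs j i'))" for i
    using pc by auto
  then show ?thesis by (simp add: cheapest_def)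
qed

lemma assign_cong: "same_on m (set xs) I I' \<Longrightarrow> assign m I s xs = assign m I' s xs"
proof (induction xs)
  case (Cons j xs)
  have "same_on m (set xs) I I'" by (rule same_on_subset[OF Cons.prems]) auto
  then have "assign m I s xs = assign m I' s xs" by (rule Cons.IH)
  then show ?case using cheapest_cong[of m j xs I I'] Cons.prems by simp
qed simp

lemma assign_append:
  "distinct (ys @ zs) \<Longrightarrow> j \<in> set zs \<Longrightarrow> assign m I s (ys @ zs) j = assign m I s zs j"
  by (induction ys) auto

lemma cheapest_prop:
  assumes "m \<ge> 1"
  shows "cheapest m I s f xs j < m"
    "i < m \<Longrightarrow> price I s f xs j (cheapest m I s f xs j) \<le> price I s f xs j i"
proof -
  let ?P = "price I s f xs j"
  have "Min (?P ` {..<m}) \<in> ?P ` {..<m}" using assms by (intro Min_in) (auto simp: lessThan_empty_iff)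
  then obtain i0 where i0: "i0 < m" "Min (?P ` {..<m}) = ?P i0" by (elim imageE) simp
  have "?P i0 \<le> ?P i'" if "i' < m" for i'
    unfolding i0(2)[symmetric] using that by (intro Min_le) auto
  then have "\<exists>i. i < m \<and> (\<forall>i'<m. ?P i \<le> ?P i')" using i0 by blast
  from someI_ex[OF this] show "cheapest m I s f xs j < m"
    "i < m \<Longrightarrow> price I s f xs j (cheapest m I s f xs j) \<le> price I s f xs j i"
    unfolding cheapest_def by auto
qed

lemma assign_less: "m \<ge> 1 \<Longrightarrow> assign m I s xs j < m"
  by (induction xs) (auto simp: cheapest_prop)

lemma culled_subset: "culled K I f xs \<subseteq> set xs"
  by (induction xs) auto

lemma culled_append:
  "distinct (ys @ zs) \<Longrightarrow> j \<in> set zs \<Longrightarrow> j \<in> culled K I f (ys @ zs) \<longleftrightarrow> j \<in> culled K I f zs"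
  by (induction ys) auto

lemma culled_cong:
  assumes "\<And>j. j \<in> set xs \<Longrightarrow> job_class I f j = job_class I' f' j"
  shows "culled K I f xs = culled K I' f' xs"
  using assms
proof (induction xs)
  case (Cons j xs)
  have "filter (\<lambda>l. job_class I f l = job_class I f j) xs = filter (\<lambda>l. job_class I' f' l = job_class I' f' j) xs"
    using Cons.prems by (intro filter_cong) auto
  then show ?case using Cons by simp
qed simp

lemma job_class_cong:
  assumes "same_on m X I I'" "j \<in> X" "f j < m" "f' j = f j"
  shows "job_class I f j = job_class I' f' j"
  using assms same_on_class[OF assms(1,2,3)] by (simp add: job_class_def)

lemma filter_partition_sorted:
  fixes g :: "'a \<Rightarrow> 'b :: linorder"
  assumes "sorted (map g xs)"
  shows "xs = filter (\<lambda>x. g x \<le> t) xs @ filter (\<lambda>x. \<not> g x \<le> t) xs"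
  using assms
proof (induction xs)
  case (Cons x xs)
  then show ?case
  proof (cases "g x \<le> t")
    case False
    then have "\<forall>y\<in>set xs. \<not> g y \<le> t" using Cons.prems by auto
    then have "filter (\<lambda>x. g x \<le> t) xs = []" "filter (\<lambda>x. \<not> g x \<le> t) xs = xs" by (auto simp: filter_empty_conv)
    then show ?thesis using False by simp
  qed auto
qed simp

lemma sort_key_cong:
  assumes "\<And>x. x \<in> set xs \<Longrightarrow> g x = h x"
  shows "sort_key g xs = sort_key h xs"
proof (rule properties_for_sort_key)
  show "filter (\<lambda>x. g k = g x) (sort_key h xs) = filter (\<lambda>x. g k = g x) xs" if "k \<in> set (sort_key h xs)" for k
  proof -
    have k: "g k = h k" using that assms by simp
    have "filter (\<lambda>x. g k = g x) (sort_key h xs) = filter (\<lambda>x. h k = h x) (sort_key h xs)"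
      using assms k by (intro filter_cong) auto
    also have "\<dots> = filter (\<lambda>x. h k = h x) xs" using sort_key_stable[of h "h k" xs] by (simp add: eq_commute)
    also have "\<dots> = filter (\<lambda>x. g k = g x) xs" using assms k by (intro filter_cong) auto
    finally show ?thesis .
  qed
  have "map g (sort_key h xs) = map h (sort_key h xs)" using assms by auto
  then show "sorted (map g (sort_key h xs))" by (metis sorted_sort_key)
qed simp

definition arrivals_until :: "job_instance \<Rightarrow> real \<Rightarrow> nat list" where
  "arrivals_until I t = filter (\<lambda>j. release I j \<le> t) (arrivals I)"

lemma arrivals_split:
  "arrivals I = filter (\<lambda>j. \<not> release I j \<le> t) (arrivals I) @ arrivals_until I t"
proof -
  let ?xs = "sort_key (release I) (sorted_list_of_set (jobs I))"
  have "rev ?xs = rev (filter (\<lambda>j. release I j \<le> t) ?xs @ filter (\<lambda>j. \<not> release I j \<le> t) ?xs)"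
    using filter_partition_sorted[of "release I" ?xs t] by simp
  then show ?thesis by (simp add: arrivals_def arrivals_until_def rev_filter)
qed

lemma set_arrivals_until: "finite (jobs I) \<Longrightarrow> set (arrivals_until I t) = released I t"
  by (auto simp: arrivals_until_def set_arrivals released_def)

lemma filter_sorted_list_of_set:
  assumes "finite X" shows "filter P (sorted_list_of_set X) = sorted_list_of_set {x\<in>X. P x}"
proof (rule sorted_distinct_set_unique)
  show "sorted (filter P (sorted_list_of_set X))" using sorted_filter[of "\<lambda>x. x" "sorted_list_of_set X" P] by simp
qed (use assms in auto)

text \<open>Filtering commutes with stable sorting; on the right only released jobs occur, which is
  what an online algorithm may look at.\<close>

lemma arrivals_until_alt:
  assumes "finite (jobs I)"
  shows "arrivals_until I t = rev (sort_key (release I) (sorted_list_of_set (released I t)))"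
  using assms by (simp add: arrivals_until_def arrivals_def rev_filter[symmetric] filter_sort
      filter_sorted_list_of_set released_def)

lemma arrivals_until_cong:
  assumes "finite (jobs I)" "finite (jobs I')" "same_revealed m t I I'"
  shows "arrivals_until I t = arrivals_until I' t"
proof -
  have "finite (released I' t)" using assms by (simp add: released_def)
  then show ?thesis
    using assms sort_key_cong[of "sorted_list_of_set (released I' t)" "release I" "release I'"]
    by (simp add: arrivals_until_alt same_revealed_def)
qed

subsection \<open>The virtual load\<close>

text \<open>At times before the release of the head of the list, \<open>workload\<close> would
  extrapolate the drain backwards. Removing the jobs released after \<open>t\<close> first gives the
  backlog at an arbitrary time.\<close>

primrec virtual_load :: "job_instance \<Rightarrow> real \<Rightarrow> (nat \<Rightarrow> nat) \<Rightarrow> nat \<Rightarrow> real \<Rightarrow> nat list \<Rightarrow> real \<Rightarrow> real" where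
  "virtual_load I s f i \<theta> [] t = 0"
| "virtual_load I s f i \<theta> (j # xs) t =
     (if t < release I j then virtual_load I s f i \<theta> xs t else workload I s f i \<theta> (j # xs) t)"

lemma workload_nonneg: "0 \<le> workload I s f i \<theta> xs u"
  by (cases xs) auto

lemma virtual_load_nonneg: "0 \<le> virtual_load I s f i \<theta> xs t"
  by (induction xs) (auto simp: workload_nonneg)

lemma virtual_load_eq:
  assumes "\<And>j. j \<in> set ys \<Longrightarrow> t < release I j" "\<And>j. j \<in> set zs \<Longrightarrow> release I j \<le> t"
  shows "virtual_load I s f i \<theta> (ys @ zs) t = workload I s f i \<theta> zs t"
  using assms
proof (induction ys)
  case Nil
  then show ?case
  proof (cases zs)
    case (Cons j zs')
    then have "\<not> t < release I j" using Nil(2)[of j] by simp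
    then show ?thesis by (simp add: Cons del: workload.simps)
  qed simp
qed (auto simp del: workload.simps)

definition level_size :: "job_instance \<Rightarrow> (nat \<Rightarrow> nat) \<Rightarrow> nat \<Rightarrow> real \<Rightarrow> nat \<Rightarrow> real" where
  "level_size I f i \<theta> j = (if f j = i \<and> \<theta> \<le> rdens I i j then ptime I i j else 0)"

lemma workload_Cons_ge:
  "workload I s f i \<theta> xs (release I j) + level_size I f i \<theta> j - s * (u - release I j) \<le> workload I s f i \<theta> (j # xs) u"
  by (simp add: level_size_def)

lemma workload_ge_arrived:
  assumes "\<And>j. j \<in> set ys \<Longrightarrow> t0 \<le> release I j" "t0 \<le> t" "s \<ge> 0"
  shows "(\<Sum>j\<leftarrow>ys. level_size I f i \<theta> j) - s * (t - t0) \<le> workload I s f i \<theta> (ys @ zs) t"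
  using assms
proof (induction ys arbitrary: t)
  case Nil
  have "0 \<le> s * (t - t0)" using Nil by simp
  then show ?case using workload_nonneg[of I s f i \<theta> zs t] by simp
next
  case (Cons j ys)
  then have "(\<Sum>j\<leftarrow>ys. level_size I f i \<theta> j) - s * (release I j - t0) \<le> workload I s f i \<theta> (ys @ zs) (release I j)"
    by auto
  then show ?case using workload_Cons_ge[of I s f i \<theta> "ys @ zs" j t] by (simp add: algebra_simps del: workload.simps)
qed

lemma workload_decay:
  assumes "\<And>j. j \<in> set ys \<Longrightarrow> u \<le> release I j" "u \<le> t" "s \<ge> 0" "\<And>j. j \<in> set ys \<Longrightarrow> 0 \<le> level_size I f i \<theta> j"
  shows "workload I s f i \<theta> zs u - s * (t - u) \<le> workload I s f i \<theta> (ys @ zs) t"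
  using assms
proof (induction ys arbitrary: t)
  case Nil
  have le: "0 \<le> s * (t - u)" using Nil by simp
  show ?case
  proof (cases zs)
    case (Cons j zs')
    then show ?thesis using le by (simp add: algebra_simps max_def)
  qed (use le in simp)
next
  case (Cons j ys)
  then have "workload I s f i \<theta> zs u - s * (release I j - u) \<le> workload I s f i \<theta> (ys @ zs) (release I j)"
    by auto
  moreover have "0 \<le> level_size I f i \<theta> j" using Cons by auto
  ultimately show ?case using workload_Cons_ge[of I s f i \<theta> "ys @ zs" j t]
    by (simp add: algebra_simps del: workload.simps)
qed

lemma workload_le_total:
  assumes "\<And>j. j \<in> set xs \<Longrightarrow> 0 \<le> level_size I f i \<theta> j" "s \<ge> 0"
    "sorted_wrt (\<lambda>j l. release I l \<le> release I j) xs" "\<And>j. j \<in> set xs \<Longrightarrow> release I j \<le> u"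
  shows "workload I s f i \<theta> xs u \<le> (\<Sum>j\<leftarrow>xs. level_size I f i \<theta> j)"
  using assms
proof (induction xs arbitrary: u)
  case (Cons j xs)
  have "workload I s f i \<theta> xs (release I j) \<le> (\<Sum>j\<leftarrow>xs. level_size I f i \<theta> j)"
    using Cons.prems by (intro Cons.IH) auto
  moreover have "0 \<le> s * (u - release I j)" using Cons.prems by simp
  moreover have "0 \<le> level_size I f i \<theta> j" using Cons.prems by auto
  ultimately show ?case using workload_nonneg[of I s f i \<theta> xs "release I j"]
    by (auto simp: level_size_def max_def)
qed simp

lemma workload_measurable [measurable (raw)]:
  fixes g h :: "'a \<Rightarrow> real"
  assumes [measurable]: "g \<in> borel_measurable M" "h \<in> borel_measurable M"
  shows "(\<lambda>x. workload I s f i (g x) xs (h x)) \<in> borel_measurable M"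
  using assms(2)
proof (induction xs arbitrary: h)
  case (Cons j xs)
  note Cons.prems[measurable]
  have [measurable]: "(\<lambda>x. workload I s f i (g x) xs (release I j)) \<in> borel_measurable M"
    by (rule Cons.IH) simp
  show ?case by simp
qed simp

lemma virtual_load_measurable [measurable (raw)]:
  fixes g h :: "'a \<Rightarrow> real"
  assumes [measurable]: "g \<in> borel_measurable M" "h \<in> borel_measurable M"
  shows "(\<lambda>x. virtual_load I s f i (g x) xs (h x)) \<in> borel_measurable M"
proof (induction xs)
  case (Cons j xs)
  note Cons.IH[measurable]
  show ?case by (simp del: workload.simps)
qed simp

section \<open>The quadratic potential of the virtual queue\<close>

lemma ramp_integral:
  assumes "0 \<le> y" "r \<le> T" "0 < s"
  shows "ennreal s * (\<integral>\<^sup>+t. indicator {r..T} t * ennreal (max 0 (y - s * (t - r))) \<partial>lborel)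
    = ennreal (y\<^sup>2 / 2 - (max 0 (y - s * (T - r)))\<^sup>2 / 2)"
proof -
  \<comment> \<open>The ramp is positive up to the moment at which it has drained; cut off at
    \<open>T\<close>, this leaves an interval on which the integrand is affine.\<close>
  define T' where "T' = min T (r + y / s)"
  have T': "r \<le> T'" "T' \<le> T" "T' \<le> r + y / s" using assms by (auto simp: T'_def)
  have pos: "0 \<le> y - s * (t - r)" if "t \<le> r + y / s" for t
    using that assms by (simp add: field_simps)
  have neg: "y - s * (t - r) \<le> 0" if "r + y / s \<le> t" for t
    using that assms by (simp add: field_simps)
  have "(\<integral>\<^sup>+t. indicator {r..T} t * ennreal (max 0 (y - s * (t - r))) \<partial>lborel)
      = (\<integral>\<^sup>+t. ennreal (y - s * (t - r)) * indicator {r..T'} t \<partial>lborel)"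
  proof (rule nn_integral_cong)
    fix t show "indicator {r..T} t * ennreal (max 0 (y - s * (t - r))) = ennreal (y - s * (t - r)) * indicator {r..T'} t"
      using pos[of t] neg[of t] T' by (auto simp: indicator_def T'_def max_def min_def mult.commute)
  qed
  also have "\<dots> = ennreal ((y * T' - s * (T' - r)\<^sup>2 / 2) - (y * r - s * (r - r)\<^sup>2 / 2))"
  proof (rule nn_integral_FTC_Icc)
    fix t assume "t \<in> {r..T'}"
    show "((\<lambda>t. y * t - s * (t - r)\<^sup>2 / 2) has_real_derivative y - s * (t - r)) (at t)"
      by (auto intro!: derivative_eq_intros)
    show "0 \<le> y - s * (t - r)" using \<open>t \<in> {r..T'}\<close> T' by (intro pos) auto
  qed (use T' in auto)
  also have "ennreal s * \<dots> = ennreal (s * ((y * T' - s * (T' - r)\<^sup>2 / 2) - (y * r - s * (r - r)\<^sup>2 / 2)))"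
    using assms by (subst ennreal_mult') auto
  also have "s * ((y * T' - s * (T' - r)\<^sup>2 / 2) - (y * r - s * (r - r)\<^sup>2 / 2))
      = y\<^sup>2 / 2 - (max 0 (y - s * (T - r)))\<^sup>2 / 2"
  proof (cases "T \<le> r + y / s")
    case True
    then have "T' = T" "max 0 (y - s * (T - r)) = y - s * (T - r)" using pos[of T] by (auto simp: T'_def)
    then show ?thesis by (simp add: power2_eq_square field_simps)
  next
    case False
    define z where "z = y / s"
    have "T' = r + z" "max 0 (y - s * (T - r)) = 0" "y = s * z"
      using neg[of T] False assms by (auto simp: T'_def z_def)
    then show ?thesis by (simp add: power2_eq_square field_simps)
  qed
  finally show ?thesis .
qed

text \<open>The sum of the upward jumps of the potential: a job of size c that meets workload W
  raises half the square of the load by c (W + c / 2).\<close>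

primrec load_cost :: "job_instance \<Rightarrow> real \<Rightarrow> (nat \<Rightarrow> nat) \<Rightarrow> nat \<Rightarrow> real \<Rightarrow> nat list \<Rightarrow> real" where
  "load_cost I s f i \<theta> [] = 0"
| "load_cost I s f i \<theta> (j # xs) = level_size I f i \<theta> j * (workload I s f i \<theta> xs (release I j) + level_size I f i \<theta> j / 2)
     + load_cost I s f i \<theta> xs"

lemma load_cost_nonneg:
  assumes "\<And>j. j \<in> set xs \<Longrightarrow> 0 \<le> level_size I f i \<theta> j"
  shows "0 \<le> load_cost I s f i \<theta> xs"
  using assms by (induction xs) (auto simp: workload_nonneg)

text \<open>Half the square of the load is a potential: it decreases at rate \<open>s\<close> times the load.\<close>

lemma virtual_load_integral_upto:
  assumes "\<And>j. j \<in> set xs \<Longrightarrow> 0 \<le> level_size I f i \<theta> j" "s > 0"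
    "sorted_wrt (\<lambda>j l. release I l \<le> release I j) xs" "\<And>j. j \<in> set xs \<Longrightarrow> release I j \<le> T"
  shows "ennreal s * (\<integral>\<^sup>+t. indicator {..T} t * ennreal (virtual_load I s f i \<theta> xs t) \<partial>lborel)
    + ennreal ((workload I s f i \<theta> xs T)\<^sup>2 / 2) \<le> ennreal (load_cost I s f i \<theta> xs)"
  using assms
proof (induction xs arbitrary: T)
  case (Cons j xs)
  let ?V = "virtual_load I s f i \<theta>" and ?W = "workload I s f i \<theta>"
  define r where "r = release I j"
  define c where "c = level_size I f i \<theta> j"
  define y where "y = ?W xs r + c"
  have c: "0 \<le> c" unfolding c_def using Cons.prems by auto
  have X: "0 \<le> ?W xs r" by (rule workload_nonneg)
  have rT: "r \<le> T" using Cons.prems by (auto simp: r_def)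
  have WT: "?W (j # xs) t = max 0 (y - s * (t - r))" for t
    by (simp add: y_def c_def r_def level_size_def)
  have IH: "ennreal s * (\<integral>\<^sup>+t. indicator {..r} t * ennreal (?V xs t) \<partial>lborel) + ennreal ((?W xs r)\<^sup>2 / 2)
      \<le> ennreal (load_cost I s f i \<theta> xs)"
    using Cons.prems unfolding r_def by (intro Cons.IH) auto
  \<comment> \<open>Only an inequality, because the two ranges share the point \<open>r\<close>,
    where both summands are counted.\<close>
  have "(\<integral>\<^sup>+t. indicator {..T} t * ennreal (?V (j # xs) t) \<partial>lborel)
     \<le> (\<integral>\<^sup>+t. indicator {..r} t * ennreal (?V xs t) + indicator {r..T} t * ennreal (max 0 (y - s * (t - r))) \<partial>lborel)"
    by (rule nn_integral_mono) (auto simp: indicator_def r_def[symmetric] WT simp del: workload.simps)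
  also have "\<dots> = (\<integral>\<^sup>+t. indicator {..r} t * ennreal (?V xs t) \<partial>lborel)
      + (\<integral>\<^sup>+t. indicator {r..T} t * ennreal (max 0 (y - s * (t - r))) \<partial>lborel)"
    by (rule nn_integral_add) measurable
  finally have "ennreal s * (\<integral>\<^sup>+t. indicator {..T} t * ennreal (?V (j # xs) t) \<partial>lborel)
     \<le> ennreal s * ((\<integral>\<^sup>+t. indicator {..r} t * ennreal (?V xs t) \<partial>lborel)
      + (\<integral>\<^sup>+t. indicator {r..T} t * ennreal (max 0 (y - s * (t - r))) \<partial>lborel))"
    by (rule mult_left_mono) simp
  then have "ennreal s * (\<integral>\<^sup>+t. indicator {..T} t * ennreal (?V (j # xs) t) \<partial>lborel)
     \<le> ennreal s * (\<integral>\<^sup>+t. indicator {..r} t * ennreal (?V xs t) \<partial>lborel)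
      + ennreal (y\<^sup>2 / 2 - (max 0 (y - s * (T - r)))\<^sup>2 / 2)"
    using ramp_integral[OF _ rT Cons.prems(2), of y] c X
    by (simp only: distrib_left y_def add_nonneg_nonneg)
  moreover have le: "0 \<le> y\<^sup>2 / 2 - (max 0 (y - s * (T - r)))\<^sup>2 / 2"
  proof -
    have "max 0 (y - s * (T - r)) \<le> y" using c X rT Cons.prems(2) by (simp add: y_def)
    then have "(max 0 (y - s * (T - r)))\<^sup>2 \<le> y\<^sup>2" by (intro power_mono) auto
    then show ?thesis by simp
  qed
  ultimately have "ennreal s * (\<integral>\<^sup>+t. indicator {..T} t * ennreal (?V (j # xs) t) \<partial>lborel) + ennreal ((?W (j # xs) T)\<^sup>2 / 2)
     \<le> (ennreal s * (\<integral>\<^sup>+t. indicator {..r} t * ennreal (?V xs t) \<partial>lborel))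
      + ennreal (y\<^sup>2 / 2 - (max 0 (y - s * (T - r)))\<^sup>2 / 2) + ennreal ((max 0 (y - s * (T - r)))\<^sup>2 / 2)"
    by (simp only: WT add_right_mono)
  also have "\<dots> = ennreal s * (\<integral>\<^sup>+t. indicator {..r} t * ennreal (?V xs t) \<partial>lborel) + ennreal (y\<^sup>2 / 2)"
    using le by (simp add: add.assoc ennreal_plus[symmetric] del: ennreal_plus)
  also have "y\<^sup>2 / 2 = (?W xs r)\<^sup>2 / 2 + c * (?W xs r + c / 2)"
    by (simp add: y_def power2_eq_square algebra_simps)
  also have "ennreal \<dots> = ennreal ((?W xs r)\<^sup>2 / 2) + ennreal (c * (?W xs r + c / 2))"
    using c X by (intro ennreal_plus) auto
  also have "ennreal s * (\<integral>\<^sup>+t. indicator {..r} t * ennreal (?V xs t) \<partial>lborel) + \<dots>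
     \<le> ennreal (load_cost I s f i \<theta> xs) + ennreal (c * (?W xs r + c / 2))"
    unfolding add.assoc[symmetric] by (intro add_right_mono IH)
  also have "\<dots> = ennreal (load_cost I s f i \<theta> (j # xs))"
    using c X load_cost_nonneg[of xs I f i \<theta> s] Cons.prems
    by (simp add: c_def r_def add.commute)
  finally show ?case .
qed simp

lemma virtual_load_integral:
  assumes "\<And>j. j \<in> set xs \<Longrightarrow> 0 \<le> level_size I f i \<theta> j" "s > 0"
    "sorted_wrt (\<lambda>j l. release I l \<le> release I j) xs"
  shows "ennreal s * (\<integral>\<^sup>+t. ennreal (virtual_load I s f i \<theta> xs t) \<partial>lborel) \<le> ennreal (load_cost I s f i \<theta> xs)"
proof (cases xs)
  case (Cons j ys)
  define y where "y = workload I s f i \<theta> ys (release I j) + level_size I f i \<theta> j"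
  \<comment> \<open>By this time the backlog left by the last job has drained, and the load vanishes
    afterwards.\<close>
  define T where "T = release I j + y / s"
  have y: "0 \<le> y" using assms(1)[of j] Cons workload_nonneg by (simp add: y_def)
  have T: "release I l \<le> T" if "l \<in> set xs" for l
  proof -
    have "release I l \<le> release I j" using that Cons assms(3) by auto
    also have "\<dots> \<le> T" using y assms(2) by (simp add: T_def)
    finally show ?thesis .
  qed
  have "virtual_load I s f i \<theta> xs t = 0" if "T < t" for t
  proof -
    have "y - s * (t - release I j) \<le> 0"
      using that assms(2) by (simp add: T_def field_simps)
    moreover have "release I j < t" using that T[of j] Cons by simp
    ultimately show ?thesis by (simp add: Cons y_def level_size_def)
  qed
  then have "(\<integral>\<^sup>+t. ennreal (virtual_load I s f i \<theta> xs t) \<partial>lborel)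
    = (\<integral>\<^sup>+t. indicator {..T} t * ennreal (virtual_load I s f i \<theta> xs t) \<partial>lborel)"
    by (intro nn_integral_cong) (auto simp: indicator_def)
  then have "ennreal s * (\<integral>\<^sup>+t. ennreal (virtual_load I s f i \<theta> xs t) \<partial>lborel)
    \<le> ennreal s * (\<integral>\<^sup>+t. indicator {..T} t * ennreal (virtual_load I s f i \<theta> xs t) \<partial>lborel)
      + ennreal ((workload I s f i \<theta> xs T)\<^sup>2 / 2)" by simp
  also have "\<dots> \<le> ennreal (load_cost I s f i \<theta> xs)"
    using assms T by (intro virtual_load_integral_upto) auto
  finally show ?thesis .
qed simp

text \<open>Along the arrival order, the quotient by \<open>K\<close> of the number of jobs of the
  class increases exactly at the culled ones.\<close>

lemma length_culled:
  assumes "K > 0" "distinct xs"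
  shows "length (filter (\<lambda>j. job_class I f j = c \<and> j \<in> culled K I f xs) xs)
    = length (filter (\<lambda>j. job_class I f j = c) xs) div K"
  using assms(2)
proof (induction xs)
  case (Cons j xs)
  have "filter (\<lambda>l. job_class I f l = c \<and> l \<in> culled K I f (j # xs)) xs
      = filter (\<lambda>l. job_class I f l = c \<and> l \<in> culled K I f xs) xs"
    using Cons.prems by (intro filter_cong) auto
  moreover have "j \<notin> culled K I f xs" using culled_subset[of K I f xs] Cons.prems by auto
  ultimately show ?case using Cons assms(1) by (auto simp: div_Suc dvd_eq_mod_eq_0)
qed simp

subsection \<open>Weak duality\<close>

text \<open>The constraint for \<open>lam\<close> is integrated over the times at which \<sigma>
  works on \<open>j\<close>. The delay term costs at most w (T - r); the term 2 w is paid for each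
  unit of time in which \<open>j\<close> is processed, at most T - r units in total. Together this
  is the factor 3.\<close>

lemma weak_duality_job:
  assumes valid: "valid_instance m I" and feas: "feasible_offline m I \<sigma>" and j: "j \<in> jobs I"
    and T: "processed_fraction m I \<sigma> j T \<ge> 1" and lam: "0 \<le> lam"
    and beta [measurable]: "\<And>i. i < m \<Longrightarrow> \<beta> i \<in> borel_measurable borel"
    and dual: "\<And>i t. i < m \<Longrightarrow> release I j \<le> t \<Longrightarrow> ennreal (lam / ptime I i j) \<le>
        \<beta> i t + ennreal (weight I j / ptime I i j * (t - release I j)) + ennreal (2 * weight I j)"
  shows "ennreal lam \<le> (\<Sum>i<m. \<integral>\<^sup>+t. \<beta> i t * indicator {t. \<sigma> i t = Some j} t \<partial>lborel)
           + ennreal (3 * (weight I j * (T - release I j)))"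
proof -
  let ?r = "release I j" and ?w = "weight I j"
  have p: "\<And>i. i < m \<Longrightarrow> 0 < ptime I i j" and w: "0 < ?w" using valid j by (auto simp: valid_instance_def)
  have rT: "?r \<le> T" by (rule release_le_if_processed[OF feas T])
  define X where "X i = {s. s \<le> T \<and> \<sigma> i s = Some j}" for i
  have Y [measurable]: "{t. \<sigma> i t = Some j} \<in> sets borel" if "i < m" for i
    using feas that j by (auto simp: feasible_offline_def)
  have X_eq: "X i = {..T} \<inter> {t. \<sigma> i t = Some j}" for i by (auto simp: X_def)
  have X [measurable]: "X i \<in> sets borel" if "i < m" for i using Y[OF that] by (auto simp: X_eq)
  have Xsub: "X i \<subseteq> {?r..T}" if "i < m" for i using feas that by (auto simp: feasible_offline_def X_def)
  have em: "emeasure lborel (X i) = ennreal (measure lborel (X i))" if "i < m" for i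
  proof (rule emeasure_eq_ennreal_measure)
    have "emeasure lborel (X i) \<le> emeasure lborel {?r..T}" using Xsub[OF that] by (intro emeasure_mono) auto
    then show "emeasure lborel (X i) \<noteq> top" using rT by (auto simp: top_unique)
  qed
  show ?thesis
  proof (cases "lam \<le> ?w * (T - ?r)")
    case True
    moreover have "0 \<le> ?w * (T - ?r)" using w rT by simp
    ultimately have "lam \<le> 3 * (?w * (T - ?r))" by simp
    then have "ennreal lam \<le> ennreal (3 * (?w * (T - ?r)))" by (rule ennreal_leI)
    then show ?thesis by (rule order.trans) simp
  next
    case False
    \<comment> \<open>The processed fraction may exceed 1, so the delay term is replaced by its
      bound w (T - r) and subtracted before integrating. The remainder \<open>q\<close> is positive
      and only grows when multiplied by a fraction of at least 1.\<close>
    define q where "q = lam - ?w * (T - ?r)"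
    have q: "0 < q" using False by (simp add: q_def)
    have bound: "ennreal (q / ptime I i j) \<le> \<beta> i t + ennreal (2 * ?w)" if i: "i < m" and t: "t \<in> X i" for i t
    proof -
      let ?c = "?w / ptime I i j * (T - ?r)"
      have tr: "?r \<le> t" "t \<le> T" using Xsub[OF i] t by auto
      have "ennreal (q / ptime I i j) + ennreal ?c = ennreal (q / ptime I i j + ?c)"
        using q w rT p[OF i] by (intro ennreal_plus[symmetric]) auto
      also have "q / ptime I i j + ?c = lam / ptime I i j" by (simp add: q_def diff_divide_distrib)
      also have "ennreal \<dots> \<le> \<beta> i t + ennreal (?w / ptime I i j * (t - ?r)) + ennreal (2 * ?w)"
        by (rule dual[OF i tr(1)])
      also have "\<dots> \<le> \<beta> i t + ennreal ?c + ennreal (2 * ?w)"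
        using w tr p[OF i] by (intro add_mono order.refl ennreal_leI mult_left_mono) auto
      finally have "ennreal ?c + ennreal (q / ptime I i j) \<le> ennreal ?c + (\<beta> i t + ennreal (2 * ?w))"
        by (simp add: ac_simps)
      then show ?thesis by (simp add: ennreal_add_left_cancel_le)
    qed
    have "q \<le> q * processed_fraction m I \<sigma> j T" using q T by simp
    then have "ennreal q \<le> ennreal (q * processed_fraction m I \<sigma> j T)" by (rule ennreal_leI)
    also have "q * processed_fraction m I \<sigma> j T = (\<Sum>i<m. q / ptime I i j * measure lborel (X i))"
      by (simp add: processed_fraction_def X_def sum_distrib_left)
    also have "ennreal \<dots> = (\<Sum>i<m. ennreal (q / ptime I i j) * emeasure lborel (X i))"
    proof (subst sum_ennreal[symmetric])
      show "0 \<le> q / ptime I i j * measure lborel (X i)" if "i \<in> {..<m}" for i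
        using q p[of i] that by simp
      show "(\<Sum>i<m. ennreal (q / ptime I i j * measure lborel (X i)))
          = (\<Sum>i<m. ennreal (q / ptime I i j) * emeasure lborel (X i))"
        by (intro sum.cong refl) (simp only: em lessThan_iff ennreal_mult''[OF measure_nonneg])
    qed
    also have "\<dots> \<le> (\<Sum>i<m. \<integral>\<^sup>+t. (\<beta> i t + ennreal (2 * ?w)) * indicator (X i) t \<partial>lborel)"
    proof (rule sum_mono)
      fix i assume "i \<in> {..<m}"
      then have i: "i < m" by simp
      note X[OF i, measurable]
      have "ennreal (q / ptime I i j) * emeasure lborel (X i)
          = (\<integral>\<^sup>+t. ennreal (q / ptime I i j) * indicator (X i) t \<partial>lborel)"
        by (rule nn_integral_cmult_indicator[symmetric]) simp
      also have "\<dots> \<le> (\<integral>\<^sup>+t. (\<beta> i t + ennreal (2 * ?w)) * indicator (X i) t \<partial>lborel)"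
        using bound[OF i] by (intro nn_integral_mono) (auto simp: indicator_def)
      finally show "ennreal (q / ptime I i j) * emeasure lborel (X i)
          \<le> (\<integral>\<^sup>+t. (\<beta> i t + ennreal (2 * ?w)) * indicator (X i) t \<partial>lborel)" .
    qed
    also have "\<dots> = (\<Sum>i<m. (\<integral>\<^sup>+t. \<beta> i t * indicator (X i) t \<partial>lborel) + ennreal (2 * ?w) * emeasure lborel (X i))"
    proof (rule sum.cong)
      fix i assume "i \<in> {..<m}"
      then have i: "i < m" by simp
      note X[OF i, measurable] beta[OF i, measurable]
      show "(\<integral>\<^sup>+t. (\<beta> i t + ennreal (2 * ?w)) * indicator (X i) t \<partial>lborel)
         = (\<integral>\<^sup>+t. \<beta> i t * indicator (X i) t \<partial>lborel) + ennreal (2 * ?w) * emeasure lborel (X i)"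
        by (simp add: distrib_right nn_integral_add nn_integral_cmult_indicator)
    qed simp
    also have "\<dots> = (\<Sum>i<m. \<integral>\<^sup>+t. \<beta> i t * indicator (X i) t \<partial>lborel) + ennreal (2 * ?w) * (\<Sum>i<m. emeasure lborel (X i))"
      by (simp add: sum.distrib sum_distrib_left)
    also have "\<dots> \<le> (\<Sum>i<m. \<integral>\<^sup>+t. \<beta> i t * indicator {t. \<sigma> i t = Some j} t \<partial>lborel) + ennreal (2 * ?w) * ennreal (T - ?r)"
    proof (intro add_mono sum_mono nn_integral_mono mult_left_mono)
      \<comment> \<open>A job never runs on two machines at once, so the sets \<open>X i\<close> are
        disjoint and fit together into the interval from release to \<open>T\<close>.\<close>
      have "(\<Sum>i<m. emeasure lborel (X i)) = emeasure lborel (\<Union>i<m. X i)"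
      proof (rule sum_emeasure)
        show "disjoint_family_on X {..<m}"
          using feas unfolding disjoint_family_on_def feasible_offline_def X_def by blast
      qed auto
      also have "\<dots> \<le> emeasure lborel {?r..T}" using Xsub by (intro emeasure_mono) auto
      finally show "(\<Sum>i<m. emeasure lborel (X i)) \<le> ennreal (T - ?r)" using rT by simp
    qed (auto simp: indicator_def X_def)
    also have "ennreal (2 * ?w) * ennreal (T - ?r) = ennreal (2 * ?w * (T - ?r))"
      using w rT by (simp add: ennreal_mult)
    finally have "ennreal q + ennreal (?w * (T - ?r)) \<le> (\<Sum>i<m. \<integral>\<^sup>+t. \<beta> i t * indicator {t. \<sigma> i t = Some j} t \<partial>lborel)
        + (ennreal (2 * ?w * (T - ?r)) + ennreal (?w * (T - ?r)))"
      unfolding add.assoc[symmetric] by (rule add_right_mono)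
    also have "ennreal (2 * ?w * (T - ?r)) + ennreal (?w * (T - ?r)) = ennreal (3 * (?w * (T - ?r)))"
      using w rT by (subst ennreal_plus[symmetric]) auto
    also have "ennreal q + ennreal (?w * (T - ?r)) = ennreal lam"
      using q w rT by (subst ennreal_plus[symmetric]) (auto simp: q_def)
    finally show ?thesis .
  qed
qed

lemma weak_duality:
  assumes valid: "valid_instance m I" and "m \<ge> 1"
    and lam: "\<And>j. j \<in> jobs I \<Longrightarrow> 0 \<le> lam j"
    and beta: "\<And>i. i < m \<Longrightarrow> \<beta> i \<in> borel_measurable borel"
    and dual: "\<And>i j t. i < m \<Longrightarrow> j \<in> jobs I \<Longrightarrow> release I j \<le> t \<Longrightarrow> ennreal (lam j / ptime I i j) \<le>
        \<beta> i t + ennreal (weight I j / ptime I i j * (t - release I j)) + ennreal (2 * weight I j)"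
    and b: "(\<Sum>i<m. \<integral>\<^sup>+t. \<beta> i t \<partial>lborel) \<le> ennreal b" "0 \<le> b"
  shows "(\<Sum>j\<in>jobs I. lam j) \<le> b + 3 * optimal_weighted_flow_time m I"
proof -
  have fin: "finite (jobs I)" using valid by (simp add: valid_instance_def)
  have w: "\<And>j. j \<in> jobs I \<Longrightarrow> 0 < weight I j" using valid by (auto simp: valid_instance_def)
  have third: "(x - y) / 3 \<le> z" if "x \<le> y + 3 * z" for x y z :: real using that by simp
  have "((\<Sum>j\<in>jobs I. lam j) - b) / 3 \<le> offline_weighted_flow_time m I \<sigma>" if feas: "feasible_offline m I \<sigma>" for \<sigma>
  proof (rule field_le_epsilon)
    fix e :: real assume e: "0 < e"
    \<comment> \<open>Completion times are infima, so times \<open>T j\<close> slightly above them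
      are used. An excess of e / W per job sums to at most e in the weighted flow-time; the added 1
      keeps \<open>W\<close> positive if there are no jobs.\<close>
    define W where "W = (\<Sum>j\<in>jobs I. weight I j) + 1"
    have W: "0 < W" using w by (simp add: W_def sum_nonneg less_imp_le add_nonneg_pos)
    define C where "C j = offline_completion_time m I \<sigma> j" for j
    have "\<exists>T. processed_fraction m I \<sigma> j T \<ge> 1 \<and> T < C j + e / W" if j: "j \<in> jobs I" for j
    proof -
      let ?S = "{t. processed_fraction m I \<sigma> j t \<ge> 1}"
      have "?S \<noteq> {}" using feas j by (auto simp: feasible_offline_def)
      moreover have "bdd_below ?S" using release_le_if_processed[OF feas] by (intro bdd_belowI[of _ "release I j"]) auto
      moreover have "Inf ?S < C j + e / W" using e W by (simp add: C_def offline_completion_time_def)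
      ultimately obtain T where "T \<in> ?S" "T < C j + e / W" by (meson cInf_less_iff)
      then show ?thesis by auto
    qed
    then obtain T where T: "\<And>j. j \<in> jobs I \<Longrightarrow> processed_fraction m I \<sigma> j (T j) \<ge> 1 \<and> T j < C j + e / W"
      by metis
    have rT: "release I j \<le> T j" if "j \<in> jobs I" for j
      using release_le_if_processed[OF feas] T[OF that] by blast
    let ?Y = "\<lambda>i j. {t. \<sigma> i t = Some j}"
    have Y: "?Y i j \<in> sets borel" if "i < m" "j \<in> jobs I" for i j
      using feas that by (auto simp: feasible_offline_def)
    have nnj: "0 \<le> weight I j * (T j - release I j)" if "j \<in> jobs I" for j
      using w[OF that] rT[OF that] by simp
    have nn: "0 \<le> (\<Sum>j\<in>jobs I. 3 * (weight I j * (T j - release I j)))"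
      using nnj by (intro sum_nonneg) simp
    have "ennreal (\<Sum>j\<in>jobs I. lam j) = (\<Sum>j\<in>jobs I. ennreal (lam j))" using lam by (simp add: sum_ennreal)
    also have "\<dots> \<le> (\<Sum>j\<in>jobs I. (\<Sum>i<m. \<integral>\<^sup>+t. \<beta> i t * indicator (?Y i j) t \<partial>lborel)
           + ennreal (3 * (weight I j * (T j - release I j))))"
      using T lam by (intro sum_mono weak_duality_job[OF valid feas _ _ _ beta dual]) auto
    also have "\<dots> = (\<Sum>j\<in>jobs I. \<Sum>i<m. \<integral>\<^sup>+t. \<beta> i t * indicator (?Y i j) t \<partial>lborel)
        + ennreal (\<Sum>j\<in>jobs I. 3 * (weight I j * (T j - release I j)))"
      using nnj by (subst sum_ennreal[symmetric]) (auto simp: sum.distrib)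
    also have "(\<Sum>j\<in>jobs I. \<Sum>i<m. \<integral>\<^sup>+t. \<beta> i t * indicator (?Y i j) t \<partial>lborel) =
        (\<Sum>i<m. \<Sum>j\<in>jobs I. \<integral>\<^sup>+t. \<beta> i t * indicator (?Y i j) t \<partial>lborel)"
      by (rule sum.swap)
    also have "\<dots> \<le> (\<Sum>i<m. \<integral>\<^sup>+t. \<beta> i t \<partial>lborel)"
    proof (rule sum_mono)
      fix i assume "i \<in> {..<m}"
      then have i: "i < m" by simp
      note beta[OF i, measurable]
      have "(\<Sum>j\<in>jobs I. \<integral>\<^sup>+t. \<beta> i t * indicator (?Y i j) t \<partial>lborel)
         = (\<integral>\<^sup>+t. (\<Sum>j\<in>jobs I. \<beta> i t * indicator (?Y i j) t) \<partial>lborel)"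
      proof (rule nn_integral_sum[symmetric])
        fix j assume "j \<in> jobs I"
        note Y[OF i this, measurable]
        show "(\<lambda>t. \<beta> i t * indicator (?Y i j) t) \<in> borel_measurable lborel" by measurable
      qed
      also have "\<dots> \<le> (\<integral>\<^sup>+t. \<beta> i t \<partial>lborel)"
      proof (rule nn_integral_mono)
        fix t
        \<comment> \<open>A machine works on at most one job at a time, so at most one summand is
          nonzero.\<close>
        have "(\<Sum>j\<in>jobs I. \<beta> i t * indicator (?Y i j) t) = (\<Sum>j\<in>jobs I. if Some j = \<sigma> i t then \<beta> i t else 0)"
          by (intro sum.cong) (auto simp: indicator_def)
        also have "\<dots> \<le> \<beta> i t"
          using fin by (cases "\<sigma> i t") (auto simp: sum.delta')
        finally show "(\<Sum>j\<in>jobs I. \<beta> i t * indicator (?Y i j) t) \<le> \<beta> i t" .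
      qed
      finally show "(\<Sum>j\<in>jobs I. \<integral>\<^sup>+t. \<beta> i t * indicator (?Y i j) t \<partial>lborel) \<le> (\<integral>\<^sup>+t. \<beta> i t \<partial>lborel)" .
    qed
    also note b(1)
    finally have "ennreal (\<Sum>j\<in>jobs I. lam j) \<le> ennreal (b + (\<Sum>j\<in>jobs I. 3 * (weight I j * (T j - release I j))))"
      using b(2) nn by (simp add: ennreal_plus add_right_mono)
    then have "(\<Sum>j\<in>jobs I. lam j) \<le> b + (\<Sum>j\<in>jobs I. 3 * (weight I j * (T j - release I j)))"
      using b(2) nn by (subst (asm) ennreal_le_iff) auto
    also have "\<dots> \<le> b + (\<Sum>j\<in>jobs I. 3 * (weight I j * (C j + e / W - release I j)))"
      using w T by (intro add_left_mono sum_mono mult_left_mono) (auto intro!: less_imp_le)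
    also have "(\<Sum>j\<in>jobs I. 3 * (weight I j * (C j + e / W - release I j)))
        = 3 * (\<Sum>j\<in>jobs I. weight I j * (C j - release I j) + weight I j * (e / W))"
      by (simp add: sum_distrib_left algebra_simps)
    also have "\<dots> = 3 * (offline_weighted_flow_time m I \<sigma> + (W - 1) * (e / W))"
      unfolding offline_weighted_flow_time_def C_def[symmetric] sum.distrib W_def sum_distrib_right[symmetric]
      by simp
    finally have "((\<Sum>j\<in>jobs I. lam j) - b) / 3 \<le> offline_weighted_flow_time m I \<sigma> + (W - 1) * (e / W)"
      by (rule third)
    moreover have "(W - 1) * (e / W) \<le> e" using W e by (simp add: field_simps)
    ultimately show "((\<Sum>j\<in>jobs I. lam j) - b) / 3 \<le> offline_weighted_flow_time m I \<sigma> + e"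
      by (rule order.trans[OF _ add_left_mono])
  qed
  then have "((\<Sum>j\<in>jobs I. lam j) - b) / 3 \<le> optimal_weighted_flow_time m I"
    unfolding optimal_weighted_flow_time_def
    using feasible_offline_exists[OF valid \<open>m \<ge> 1\<close>] by (intro cINF_greatest) auto
  then show ?thesis by simp
qed

subsection \<open>The algorithm\<close>

definition speed :: "nat \<Rightarrow> real" where
  "speed K = 1 + 1 / (4 * real K)"

definition dispatch :: "nat \<Rightarrow> nat \<Rightarrow> job_instance \<Rightarrow> nat \<Rightarrow> nat" where
  "dispatch m K I = assign m I (speed K) (arrivals I)"

definition culled_jobs :: "nat \<Rightarrow> nat \<Rightarrow> job_instance \<Rightarrow> nat set" where
  "culled_jobs m K I = culled K I (dispatch m K I) (arrivals I)"

definition assigned :: "nat \<Rightarrow> nat \<Rightarrow> job_instance \<Rightarrow> nat \<Rightarrow> nat set" where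
  "assigned m K I i = {j \<in> jobs I. dispatch m K I j = i}"

definition accepted :: "nat \<Rightarrow> nat \<Rightarrow> job_instance \<Rightarrow> nat \<Rightarrow> nat set" where
  "accepted m K I i = assigned m K I i - culled_jobs m K I"

abbreviation start_on :: "nat \<Rightarrow> nat \<Rightarrow> job_instance \<Rightarrow> nat \<Rightarrow> nat \<Rightarrow> real" where
  "start_on m K I i \<equiv> machine_queue.job_start (assigned m K I i) (accepted m K I i)
     (release I) (weight I) (ptime I i) (dclass I i) (real K)"

abbreviation stop_on :: "nat \<Rightarrow> nat \<Rightarrow> job_instance \<Rightarrow> nat \<Rightarrow> nat \<Rightarrow> real" where
  "stop_on m K I i \<equiv> machine_queue.job_stop (assigned m K I i) (accepted m K I i)
     (release I) (weight I) (ptime I i) (dclass I i) (real K)"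

abbreviation interrupted_on :: "nat \<Rightarrow> nat \<Rightarrow> job_instance \<Rightarrow> nat \<Rightarrow> nat \<Rightarrow> bool" where
  "interrupted_on m K I i \<equiv> machine_queue.interrupted (assigned m K I i) (accepted m K I i)
     (release I) (weight I) (ptime I i) (dclass I i) (real K)"

definition algorithm :: "nat \<Rightarrow> nat \<Rightarrow> job_instance \<Rightarrow> schedule" where
  "algorithm m K I = \<lparr>
     start = (\<lambda>j. if j \<in> jobs I - culled_jobs m K I
        then Some (dispatch m K I j, start_on m K I (dispatch m K I j) j) else None),
     rejection = (\<lambda>j. if j \<in> culled_jobs m K I then Some (release I j)
        else if j \<in> jobs I \<and> interrupted_on m K I (dispatch m K I j) j
          then Some (stop_on m K I (dispatch m K I j) j) else None)\<rparr>"

lemma dispatch_less: "m \<ge> 1 \<Longrightarrow> dispatch m K I j < m"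
  by (simp add: dispatch_def assign_less)

lemma machine_queue_ok:
  assumes "valid_instance m I" "i < m" "K > 0"
  shows "machine_queue_ok (assigned m K I i) (accepted m K I i) (weight I) (ptime I i) (real K)"
  using assms by unfold_locales (auto simp: valid_instance_def assigned_def accepted_def)

text \<open>An alarm lies strictly before the completion of the run, which is what makes an
  interruption an admissible rejection; culled jobs are never started and occupy no machine.\<close>

lemma algorithm_feasible:
  assumes "valid_instance m I" "m \<ge> 1" "K > 0"
  shows "feasible_schedule m I (algorithm m K I)"
proof -
  note dl = dispatch_less[OF assms(2), of K I]
  let ?S = "algorithm m K I"
  have acc: "j \<in> accepted m K I (dispatch m K I j)" if "j \<in> jobs I" "j \<notin> culled_jobs m K I" for j
    using that by (simp add: accepted_def assigned_def)
  have cul: "j \<in> jobs I" if "j \<in> culled_jobs m K I" for j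
    using that culled_subset[of K I "dispatch m K I" "arrivals I"] assms
    by (auto simp: culled_jobs_def valid_instance_def set_arrivals)
  have facts: "release I j \<le> start_on m K I (dispatch m K I j) j"
    "start_on m K I (dispatch m K I j) j < stop_on m K I (dispatch m K I j) j"
    "interrupted_on m K I (dispatch m K I j) j \<Longrightarrow>
        stop_on m K I (dispatch m K I j) j < start_on m K I (dispatch m K I j) j + ptime I (dispatch m K I j) j"
    "\<not> interrupted_on m K I (dispatch m K I j) j \<Longrightarrow>
        stop_on m K I (dispatch m K I j) j = start_on m K I (dispatch m K I j) j + ptime I (dispatch m K I j) j"
    if j: "j \<in> jobs I" "j \<notin> culled_jobs m K I" for j
  proof -
    interpret machine_queue_ok "assigned m K I (dispatch m K I j)" "accepted m K I (dispatch m K I j)" "release I"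
      "weight I" "ptime I (dispatch m K I j)" "dclass I (dispatch m K I j)" "real K"
      by (rule machine_queue_ok[OF assms(1) dl assms(3)])
    have jA: "j \<in> accepted m K I (dispatch m K I j)" "j \<in> assigned m K I (dispatch m K I j)"
      using acc[OF j] by (auto simp: accepted_def)
    show "release I j \<le> start_on m K I (dispatch m K I j) j" by (rule release_le_job_start[OF jA(1)])
    show "start_on m K I (dispatch m K I j) j < stop_on m K I (dispatch m K I j) j"
      using run_end_bounds[OF jA(2)] by (simp add: job_stop_eq[OF jA(1)])
    show "interrupted_on m K I (dispatch m K I j) j \<Longrightarrow>
        stop_on m K I (dispatch m K I j) j < start_on m K I (dispatch m K I j) j + ptime I (dispatch m K I j) j"
      using run_end_alarm(1) by (simp add: job_stop_eq[OF jA(1)] interrupted_def)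
    show "\<not> interrupted_on m K I (dispatch m K I j) j \<Longrightarrow>
        stop_on m K I (dispatch m K I j) j = start_on m K I (dispatch m K I j) j + ptime I (dispatch m K I j) j"
      by (simp add: job_stop_eq[OF jA(1)] interrupted_def run_end_def)
  qed
  have busy: "busy_interval I ?S i j =
     (if j \<in> accepted m K I i then {start_on m K I i j ..< stop_on m K I i j} else {})" if "j \<in> jobs I" for i j
    using that facts[of j] by (auto simp: busy_interval_def algorithm_def accepted_def assigned_def)
  have "busy_interval I ?S i j \<inter> busy_interval I ?S i k = {}"
    if i: "i < m" and jk: "j \<in> jobs I" "k \<in> jobs I" "j \<noteq> k" for i j k
  proof (cases "j \<in> accepted m K I i \<and> k \<in> accepted m K I i")
    case True
    interpret machine_queue_ok "assigned m K I i" "accepted m K I i" "release I" "weight I" "ptime I i" "dclass I i" "real K"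
      by (rule machine_queue_ok[OF assms(1) i assms(3)])
    have "run_index j \<noteq> run_index k" using True jk(3) run_index_prop(2) by metis
    then have "stop_on m K I i j \<le> start_on m K I i k \<or> stop_on m K I i k \<le> start_on m K I i j"
      unfolding job_stop_def job_start_def using True run_intervals_disjoint run_index_prop(1) by blast
    then show ?thesis using busy jk True by auto
  qed (use busy jk in auto)
  moreover have "release I j \<le> stop_on m K I (dispatch m K I j) j"
    if "j \<in> jobs I" "j \<notin> culled_jobs m K I" for j
    using facts(1,2)[OF that] by simp
  ultimately show ?thesis
    unfolding feasible_schedule_def using dl facts cul
    by (auto simp: algorithm_def less_imp_le split: if_splits)
qed

lemma weight_interrupted_on:
  assumes "valid_instance m I" "i < m" "K > 0"
  shows "real K * (\<Sum>j | j \<in> accepted m K I i \<and> interrupted_on m K I i j. weight I j) \<le> (\<Sum>j\<in>assigned m K I i. weight I j)"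
  using machine_queue_ok.interrupted_weight[OF machine_queue_ok[OF assms]] by simp

section \<open>Decisions of the whole algorithm up to a given time\<close>

lemma same_revealed_same_on: "same_revealed m t I I' \<Longrightarrow> same_on m (released I t) I I'"
  by (simp add: same_revealed_def same_on_def)

lemma same_revealed_sym: "same_revealed m t I I' \<Longrightarrow> same_revealed m t I' I"
  by (auto simp: same_revealed_def)

context
  fixes m K :: nat and t :: real and I I' :: job_instance
  assumes valid: "valid_instance m I" "valid_instance m I'" and m: "m \<ge> 1" and K: "K > 0"
    and revealed: "same_revealed m t I I'"
begin

lemma finite_jobs_both: "finite (jobs I)" "finite (jobs I')"
  using valid by (auto simp: valid_instance_def)

lemma arrivals_until_eq: "arrivals_until I t = arrivals_until I' t"
  by (rule arrivals_until_cong[OF finite_jobs_both revealed])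

lemma dispatch_until:
  assumes "finite (jobs J)" "j \<in> released J t"
  shows "dispatch m K J j = assign m J (speed K) (arrivals_until J t) j"
proof -
  have "distinct (filter (\<lambda>j. \<not> release J j \<le> t) (arrivals J) @ arrivals_until J t)"
    using distinct_arrivals[of J] arrivals_split[of J t] by simp
  moreover have "j \<in> set (arrivals_until J t)" using assms by (simp add: set_arrivals_until)
  ultimately show ?thesis
    unfolding dispatch_def using assign_append arrivals_split[of J t] by metis
qed

lemma same_on_until: "same_on m (set (arrivals_until I t)) I I'"
  using same_revealed_same_on[OF revealed] by (simp add: set_arrivals_until[OF finite_jobs_both(1)])

lemma released_eq: "released I' t = released I t"
  using revealed by (simp add: same_revealed_def)

lemma dispatch_eq:
  assumes "j \<in> released I t" shows "dispatch m K I' j = dispatch m K I j"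
  using dispatch_until[OF finite_jobs_both(1) assms] dispatch_until[OF finite_jobs_both(2), of j] assms
  by (simp add: released_eq arrivals_until_eq[symmetric] assign_cong[OF same_on_until])

lemma culled_until:
  assumes "finite (jobs J)" "j \<in> released J t"
  shows "j \<in> culled_jobs m K J \<longleftrightarrow> j \<in> culled K J (dispatch m K J) (arrivals_until J t)"
proof -
  have "distinct (filter (\<lambda>j. \<not> release J j \<le> t) (arrivals J) @ arrivals_until J t)"
    using distinct_arrivals[of J] arrivals_split[of J t] by simp
  moreover have "j \<in> set (arrivals_until J t)" using assms by (simp add: set_arrivals_until)
  ultimately show ?thesis
    unfolding culled_jobs_def using culled_append arrivals_split[of J t] by metis
qed

lemma culled_eq:
  assumes "j \<in> released I t" shows "j \<in> culled_jobs m K I' \<longleftrightarrow> j \<in> culled_jobs m K I"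
proof -
  have "culled K I (dispatch m K I) (arrivals_until I t) = culled K I' (dispatch m K I') (arrivals_until I t)"
  proof (rule culled_cong)
    fix j assume j: "j \<in> set (arrivals_until I t)"
    show "job_class I (dispatch m K I) j = job_class I' (dispatch m K I') j"
      using j by (intro job_class_cong[OF same_on_until j] dispatch_less m dispatch_eq)
        (simp add: set_arrivals_until[OF finite_jobs_both(1)])
  qed
  then show ?thesis using culled_until[OF finite_jobs_both(1) assms] culled_until[OF finite_jobs_both(2), of j] assms
    by (simp add: released_eq arrivals_until_eq[symmetric])
qed

lemma release_le_iff: "j \<in> jobs I \<and> release I j \<le> t \<longleftrightarrow> j \<in> jobs I' \<and> release I' j \<le> t"
  using released_eq by (auto simp: released_def)

lemma queue_pair:
  assumes "i < m"
  shows "machine_queue_pair (assigned m K I i) (accepted m K I i) (release I) (weight I) (ptime I i) (dclass I i)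
    (assigned m K I' i) (accepted m K I' i) (release I') (weight I') (ptime I' i) (dclass I' i) (real K) t"
proof (intro machine_queue_pair.intro machine_queue_ok valid assms K machine_queue_pair_axioms.intro)
  have iff: "j \<in> jobs I \<and> release I j \<le> t \<and> dispatch m K I j = i \<longleftrightarrow> j \<in> jobs I' \<and> release I' j \<le> t \<and> dispatch m K I' j = i" for j
    using release_le_iff[of j] dispatch_eq[of j] by (auto simp: released_def)
  then show "{j \<in> assigned m K I i. release I j \<le> t} = {j \<in> assigned m K I' i. release I' j \<le> t}"
    by (auto simp: assigned_def)
  show "{j \<in> accepted m K I i. release I j \<le> t} = {j \<in> accepted m K I' i. release I' j \<le> t}"
    using iff culled_eq by (auto simp: accepted_def assigned_def released_def)
  show "release I' j = release I j \<and> weight I' j = weight I j \<and> ptime I' i j = ptime I i j \<and> dclass I' i j = dclass I i j"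
    if "j \<in> assigned m K I i" "release I j \<le> t" for j
  proof -
    have j: "j \<in> released I t" using that by (simp add: assigned_def released_def)
    show ?thesis using same_on_class[OF same_revealed_same_on[OF revealed] j assms] revealed j assms
      by (simp add: same_revealed_def)
  qed
qed

text \<open>One implication is enough: the hypotheses are symmetric in the two instances, and
  exchanging them yields the equivalence demanded by \<open>same_decisions\<close>.\<close>

lemma start_transfer:
  assumes "j \<in> released I t" "s \<le> t" "start (algorithm m K I) j = Some (i, s)"
  shows "start (algorithm m K I') j = Some (i, s)"
proof -
  have j: "j \<in> jobs I" "j \<notin> culled_jobs m K I" "dispatch m K I j = i" "s = start_on m K I i j"
    using assms(3) by (auto simp: algorithm_def split: if_splits)
  have i: "i < m" using dispatch_less[OF m] j by auto
  interpret machine_queue_pair "assigned m K I i" "accepted m K I i" "release I" "weight I" "ptime I i" "dclass I i"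
    "assigned m K I' i" "accepted m K I' i" "release I'" "weight I'" "ptime I' i" "dclass I' i" "real K" t
    by (rule queue_pair[OF i])
  have "j \<in> accepted m K I i" using j by (simp add: accepted_def assigned_def)
  from same_job_start[OF this] assms(2) j(4)
  have "j \<in> accepted m K I' i" "start_on m K I' i j = s" by auto
  then show ?thesis by (auto simp: algorithm_def accepted_def assigned_def)
qed

lemma rejection_transfer:
  assumes "j \<in> released I t" "s \<le> t" "rejection (algorithm m K I) j = Some s"
  shows "rejection (algorithm m K I') j = Some s"
proof (cases "j \<in> culled_jobs m K I")
  case True
  then show ?thesis using assms culled_eq[OF assms(1)] revealed
    by (auto simp: algorithm_def same_revealed_def)
next
  case False
  define i where "i = dispatch m K I j"
  have j: "j \<in> jobs I" "interrupted_on m K I i j" "s = stop_on m K I i j"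
    using assms(3) False by (auto simp: algorithm_def i_def split: if_splits)
  have i: "i < m" using dispatch_less[OF m] by (simp add: i_def)
  interpret machine_queue_pair "assigned m K I i" "accepted m K I i" "release I" "weight I" "ptime I i" "dclass I i"
    "assigned m K I' i" "accepted m K I' i" "release I'" "weight I'" "ptime I' i" "dclass I' i" "real K" t
    by (rule queue_pair[OF i])
  have "j \<in> accepted m K I i" using j False by (simp add: accepted_def assigned_def i_def)
  from same_interruption[OF this] assms(2) j
  have "j \<in> accepted m K I' i" "interrupted_on m K I' i j" "stop_on m K I' i j = s" by auto
  then show ?thesis by (auto simp: algorithm_def accepted_def assigned_def)
qed

end

lemma algorithm_online:
  assumes "m \<ge> 1" "K > 0"
  shows "online_algorithm m (algorithm m K)"
proof -
  have "same_decisions (released I t) t (algorithm m K I) (algorithm m K I')"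
    if v: "valid_instance m I" "valid_instance m I'" and r: "same_revealed m t I I'" for I I' t
  proof -
    have eq: "released I' t = released I t" using r by (simp add: same_revealed_def)
    note r' = same_revealed_sym[OF r]
    show ?thesis unfolding same_decisions_def
      using start_transfer[OF v assms r] rejection_transfer[OF v assms r]
        start_transfer[OF v(2,1) assms r', unfolded eq] rejection_transfer[OF v(2,1) assms r', unfolded eq]
      by blast
  qed
  then show ?thesis unfolding online_algorithm_def using algorithm_feasible assms by blast
qed

subsection \<open>Rounding to classes\<close>

lemma geometric_sum_le:
  fixes X :: "int set"
  assumes "finite X" "\<And>a. a \<in> X \<Longrightarrow> a \<le> M"
  shows "(\<Sum>a\<in>X. 2 powr real_of_int a) \<le> 2 * 2 powr real_of_int M"
  using assms
proof (induction X arbitrary: M rule: finite_linorder_max_induct)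
  case (insert b X)
  have "(\<Sum>a\<in>X. 2 powr real_of_int a) \<le> 2 * 2 powr real_of_int (b - 1)"
    using insert by (intro insert.IH) force
  also have "\<dots> = 2 powr real_of_int b" by (simp add: powr_diff)
  finally have "(\<Sum>a\<in>insert b X. 2 powr real_of_int a) \<le> 2 * 2 powr real_of_int b"
    using insert.hyps by (subst sum.insert) auto
  also have "\<dots> \<le> 2 * 2 powr real_of_int M" using insert.prems by auto
  finally show ?case .
qed simp

lemma geometric_sum_le_bound:
  fixes X :: "int set"
  assumes "finite X" "\<And>a. a \<in> X \<Longrightarrow> 2 powr real_of_int a \<le> y" "0 \<le> y"
  shows "(\<Sum>a\<in>X. 2 powr real_of_int a) \<le> 2 * y"
proof (cases "X = {}")
  case False
  have "(\<Sum>a\<in>X. 2 powr real_of_int a) \<le> 2 * 2 powr real_of_int (Max X)"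
    using assms(1) by (intro geometric_sum_le) auto
  also have "\<dots> \<le> 2 * y" using assms(2)[of "Max X"] Max_in[OF assms(1) False] by simp
  finally show ?thesis .
qed (use assms in simp)

text \<open>For fixed d the terms form a geometric series with largest term at most z / 2^d. The
  remaining sum of the 2^(-d) is again geometric, with largest term at most 1 / y. Each series costs
  a factor of 2.\<close>

lemma geometric_pair_sum_le:
  fixes C :: "(int \<times> int) set"
  assumes "finite C" and z: "\<And>d a. (d, a) \<in> C \<Longrightarrow> 2 powr real_of_int a * 2 powr real_of_int d \<le> z"
    and y: "\<And>d a. (d, a) \<in> C \<Longrightarrow> y \<le> 2 powr real_of_int d" and "0 < y" "0 \<le> z"
  shows "(\<Sum>(d, a)\<in>C. 2 powr real_of_int a) \<le> 4 * z / y"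
proof -
  define D where "D = fst ` C"
  define X where "X d = {a. (d, a) \<in> C}" for d
  have fin: "finite D" "finite (X d)" for d
  proof -
    have "X d \<subseteq> snd ` C" by (force simp: X_def)
    then show "finite (X d)" using assms(1) by (meson finite_imageI finite_subset)
  qed (use assms(1) in \<open>simp add: D_def\<close>)
  have "C = Sigma D X" by (force simp: D_def X_def)
  then have "(\<Sum>(d, a)\<in>C. 2 powr real_of_int a) = (\<Sum>d\<in>D. \<Sum>a\<in>X d. 2 powr real_of_int a)"
    using fin by (simp add: sum.Sigma)
  also have "\<dots> \<le> (\<Sum>d\<in>D. 2 * (z / 2 powr real_of_int d))"
    using fin z \<open>0 \<le> z\<close> by (intro sum_mono geometric_sum_le_bound) (auto simp: X_def field_simps)
  also have "\<dots> = 2 * z * (\<Sum>d\<in>D. 2 powr real_of_int (- d))"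
    by (simp add: sum_distrib_left powr_minus divide_inverse mult.assoc)
  also have "(\<Sum>d\<in>D. 2 powr real_of_int (- d)) = (\<Sum>d\<in>uminus ` D. 2 powr real_of_int d)"
    by (subst sum.reindex) (auto simp: inj_on_def)
  also have "2 * z * \<dots> \<le> 2 * z * (2 * (1 / y))"
  proof (intro mult_left_mono geometric_sum_le_bound)
    fix d assume "d \<in> uminus ` D"
    then obtain d' a where d: "d = - d'" "(d', a) \<in> C" by (auto simp: D_def)
    then show "2 powr real_of_int d \<le> 1 / y" using y[OF d(2)] \<open>0 < y\<close>
      by (simp add: powr_minus field_simps)
  qed (use fin assms in auto)
  finally show ?thesis by simp
qed

lemma sclass_bounds:
  assumes "ptime I i j > 0"
  shows "2 powr real_of_int (sclass I i j) \<le> ptime I i j" "ptime I i j \<le> 2 * 2 powr real_of_int (sclass I i j)"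
proof -
  let ?x = "log 2 (ptime I i j)"
  have p: "ptime I i j = 2 powr ?x" using assms by simp
  have "2 powr real_of_int (sclass I i j) \<le> 2 powr ?x" unfolding sclass_def by (subst powr_le_cancel_iff) auto
  then show "2 powr real_of_int (sclass I i j) \<le> ptime I i j" using p by simp
  have "?x \<le> 1 + real_of_int (sclass I i j)" unfolding sclass_def by linarith
  then have "2 powr ?x \<le> 2 powr (1 + real_of_int (sclass I i j))" by (subst powr_le_cancel_iff) auto
  also have "\<dots> = 2 * 2 powr real_of_int (sclass I i j)" by (simp add: powr_add)
  finally show "ptime I i j \<le> 2 * 2 powr real_of_int (sclass I i j)" using p by simp
qed

lemma rdens_pos: "0 < rdens I i j"
  by (simp add: rdens_def)

lemma rdens_bounds:
  assumes "ptime I i j > 0" "weight I j > 0"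
  shows "rdens I i j * ptime I i j \<le> weight I j" "weight I j \<le> 4 * (rdens I i j * ptime I i j)"
proof -
  let ?x = "log 4 (weight I j / ptime I i j)"
  have p: "weight I j / ptime I i j = 4 powr ?x" using assms by simp
  have "rdens I i j \<le> 4 powr ?x" unfolding rdens_def dclass_def by (subst powr_le_cancel_iff) auto
  then show "rdens I i j * ptime I i j \<le> weight I j" using p assms by (simp add: field_simps)
  have "?x \<le> 1 + real_of_int (dclass I i j)" unfolding dclass_def by linarith
  then have "4 powr ?x \<le> 4 powr (1 + real_of_int (dclass I i j))" by (subst powr_le_cancel_iff) auto
  also have "\<dots> = 4 * rdens I i j" by (simp add: powr_add rdens_def)
  finally show "weight I j \<le> 4 * (rdens I i j * ptime I i j)" using p assms by (simp add: field_simps)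
qed

lemma rdens_sqrt: "sqrt (rdens I i j) = 2 powr real_of_int (dclass I i j)"
proof -
  have "rdens I i j = (2 powr real_of_int (dclass I i j))\<^sup>2"
    unfolding rdens_def power2_eq_square powr_mult[symmetric] by simp
  then show ?thesis by simp
qed

text \<open>Which jobs of \<open>ys\<close> are culled depends only on \<open>ys\<close> and the
  earlier jobs \<open>zs\<close>. With a and b jobs of the class in them, the number of culled ones
  in \<open>ys\<close> is the difference of the rounded down values of (a + b) / K and b / K, which
  exceeds a / K - 1.\<close>

lemma culled_window:
  assumes "distinct (us @ ys @ zs)" "K > 0"
  shows "real (length (filter (\<lambda>j. job_class I f j = c) ys)) / real K - 1 \<le>
    real (length (filter (\<lambda>j. job_class I f j = c \<and> j \<in> culled K I f (us @ ys @ zs)) ys))"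
proof -
  let ?N = "\<lambda>xs. length (filter (\<lambda>j. job_class I f j = c) xs)"
  let ?C = "culled K I f"
  have 1: "j \<in> ?C (us @ ys @ zs) \<longleftrightarrow> j \<in> ?C (ys @ zs)" if "j \<in> set (ys @ zs)" for j
    using culled_append[OF assms(1) that] .
  have 2: "j \<in> ?C (ys @ zs) \<longleftrightarrow> j \<in> ?C zs" if "j \<in> set zs" for j
    using culled_append[of ys zs j] assms(1) that by auto
  have "?N (ys @ zs) div K = length (filter (\<lambda>j. job_class I f j = c \<and> j \<in> ?C (ys @ zs)) (ys @ zs))"
    using length_culled[of K "ys @ zs"] assms by auto
  also have "\<dots> = length (filter (\<lambda>j. job_class I f j = c \<and> j \<in> ?C (us @ ys @ zs)) ys)
      + length (filter (\<lambda>j. job_class I f j = c \<and> j \<in> ?C (ys @ zs)) zs)"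
    using 1 by (simp cong: filter_cong)
  also have "filter (\<lambda>j. job_class I f j = c \<and> j \<in> ?C (ys @ zs)) zs
      = filter (\<lambda>j. job_class I f j = c \<and> j \<in> ?C zs) zs"
    using 2 by (intro filter_cong) auto
  also have "length \<dots> = ?N zs div K" using length_culled[of K zs] assms by auto
  finally have eq: "length (filter (\<lambda>j. job_class I f j = c \<and> j \<in> ?C (us @ ys @ zs)) ys) + ?N zs div K = (?N ys + ?N zs) div K"
    by simp
  have fl: "real (n div K) = real_of_int \<lfloor>real n / real K\<rfloor>" for n
    by (simp add: floor_divide_of_nat_eq)
  have "real (?N ys + ?N zs) / K - 1 \<le> real ((?N ys + ?N zs) div K)"
    unfolding fl by linarith
  moreover have "real (?N zs div K) \<le> real (?N zs) / K" unfolding fl by linarith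
  moreover have "real ((?N ys + ?N zs) div K) = real (length (filter (\<lambda>j. job_class I f j = c \<and> j \<in> ?C (us @ ys @ zs)) ys)) + real (?N zs div K)"
    unfolding eq[symmetric] by simp
  ultimately show ?thesis by (simp add: add_divide_distrib)
qed

text \<open>Rounding the density loses a factor of 4 and rounding the size a factor of 2, hence 8
  for the weight within a class.\<close>

lemma job_class_weight:
  assumes "ptime I (f j) j > 0" "weight I j > 0" "job_class I f j = (i, d, a)"
  shows "4 powr real_of_int d * 2 powr real_of_int a \<le> weight I j"
    "weight I j \<le> 8 * (4 powr real_of_int d * 2 powr real_of_int a)"
proof -
  have c: "f j = i" "dclass I i j = d" "sclass I i j = a" using assms(3) by (auto simp: job_class_def)
  have p: "ptime I i j > 0" using assms c by simp
  note s = sclass_bounds[OF p, unfolded c] and r = rdens_bounds[OF p assms(2), unfolded rdens_def c]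
  show "4 powr real_of_int d * 2 powr real_of_int a \<le> weight I j"
    by (rule order.trans[OF mult_left_mono[OF s(1)] r(1)]) simp
  have "4 powr real_of_int d * ptime I i j \<le> 4 powr real_of_int d * (2 * 2 powr real_of_int a)"
    using s(2) by (intro mult_left_mono) auto
  then have "4 * (4 powr real_of_int d * ptime I i j) \<le> 4 * (4 powr real_of_int d * (2 * 2 powr real_of_int a))"
    by (rule mult_left_mono) simp
  from order.trans[OF r(2) this]
  show "weight I j \<le> 8 * (4 powr real_of_int d * 2 powr real_of_int a)" by simp
qed

text \<open>In a class of n jobs whose weights lie between x and 8 x, at most n / K jobs are culled,
  so their weight is at most 8 / K times that of the class.\<close>

lemma weight_culled:
  assumes "valid_instance m I" "m \<ge> 1" "K > 0"
  shows "real K * (\<Sum>j\<in>culled_jobs m K I. weight I j) \<le> 8 * (\<Sum>j\<in>jobs I. weight I j)"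
proof -
  let ?f = "dispatch m K I" and ?B = "culled_jobs m K I"
  let ?g = "job_class I ?f"
  have fin: "finite (jobs I)" using assms by (simp add: valid_instance_def)
  have BJ: "?B \<subseteq> jobs I"
    using culled_subset[of K I ?f "arrivals I"] set_arrivals[OF fin] by (simp add: culled_jobs_def)
  have finB: "finite ?B" using BJ fin finite_subset by auto
  have w: "weight I j > 0" "ptime I (?f j) j > 0" if "j \<in> jobs I" for j
    using assms that dispatch_less[OF assms(2), of K I j] by (auto simp: valid_instance_def)
  have class_bound: "real K * (\<Sum>j | j \<in> ?B \<and> ?g j = c. weight I j) \<le> 8 * (\<Sum>j | j \<in> jobs I \<and> ?g j = c. weight I j)" for c
  proof -
    obtain i d a where c: "c = (i, d, a)" by (cases c)
    define x where "x = 4 powr real_of_int d * 2 powr real_of_int a"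
    have x: "0 \<le> x" by (simp add: x_def)
    note wb = job_class_weight[where f = ?f and i = i and d = d and a = a and I = I, folded x_def c]
    let ?n = "card {j. j \<in> jobs I \<and> ?g j = c}" and ?k = "card {j. j \<in> ?B \<and> ?g j = c}"
    have "{j. ?g j = c} \<inter> set (arrivals I) = {j. j \<in> jobs I \<and> ?g j = c}"
      "{j. ?g j = c \<and> j \<in> ?B} \<inter> set (arrivals I) = {j. j \<in> ?B \<and> ?g j = c}"
      using set_arrivals[OF fin] BJ by auto
    then have "?k = ?n div K"
      using length_culled[OF assms(3) distinct_arrivals, of I ?f c I]
      by (simp add: distinct_length_filter distinct_arrivals culled_jobs_def[symmetric])
    then have kn: "real K * real ?k \<le> real ?n"
      by (simp only: of_nat_mult[symmetric] of_nat_le_iff times_div_less_eq_dividend)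
    have "(\<Sum>j | j \<in> ?B \<and> ?g j = c. weight I j) \<le> of_nat ?k * (8 * x)"
      using BJ w by (intro sum_bounded_above wb(2)) auto
    then have "real K * (\<Sum>j | j \<in> ?B \<and> ?g j = c. weight I j) \<le> real K * (real ?k * (8 * x))"
      by (intro mult_left_mono) auto
    also have "\<dots> = 8 * x * (real K * real ?k)" by simp
    also have "\<dots> \<le> 8 * x * real ?n" using kn x by (intro mult_left_mono) auto
    also have "\<dots> = 8 * (of_nat ?n * x)" by simp
    also have "of_nat ?n * x \<le> (\<Sum>j | j \<in> jobs I \<and> ?g j = c. weight I j)"
      using w by (intro sum_bounded_below wb(1)) auto
    finally show ?thesis by simp
  qed
  have "(\<Sum>j\<in>?B. weight I j) = (\<Sum>c\<in>?g ` jobs I. \<Sum>j | j \<in> ?B \<and> ?g j = c. weight I j)"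
    by (rule sum.group[OF finB finite_imageI[OF fin] image_mono[OF BJ], symmetric])
  then have "real K * (\<Sum>j\<in>?B. weight I j) \<le> (\<Sum>c\<in>?g ` jobs I. 8 * (\<Sum>j | j \<in> jobs I \<and> ?g j = c. weight I j))"
    using sum_mono[of "?g ` jobs I", OF class_bound] by (simp only: sum_distrib_left)
  also have "\<dots> = 8 * (\<Sum>j\<in>jobs I. weight I j)"
    using sum.group[of "jobs I" "?g ` jobs I" ?g "weight I"] fin by (simp add: sum_distrib_left[symmetric])
  finally show ?thesis .
qed

subsection \<open>Comparison of waiting and virtual load\<close>

lemma filter_partition_descending:
  fixes g :: "'a \<Rightarrow> real"
  assumes "sorted_wrt (\<lambda>x y. g y \<le> g x) xs"
  shows "xs = filter (\<lambda>x. t \<le> g x) xs @ filter (\<lambda>x. \<not> t \<le> g x) xs"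
  using assms
proof (induction xs)
  case (Cons x xs)
  then show ?case
  proof (cases "t \<le> g x")
    case False
    then have "\<forall>y\<in>set xs. \<not> t \<le> g y" using Cons.prems by force
    then have "filter (\<lambda>x. t \<le> g x) xs = []" "filter (\<lambda>x. \<not> t \<le> g x) xs = xs" by (auto simp: filter_empty_conv)
    then show ?thesis using False by simp
  qed auto
qed simp

locale machine_analysis =
  fixes m K :: nat and I :: job_instance and i :: nat
  assumes valid: "valid_instance m I" and m_ge: "m \<ge> 1" and K_pos: "K > 0" and i_less: "i < m"
begin

abbreviation "J \<equiv> assigned m K I i"
abbreviation "A \<equiv> accepted m K I i"
abbreviation "r \<equiv> release I"
abbreviation "p \<equiv> ptime I i"
abbreviation "w \<equiv> weight I"
abbreviation "f \<equiv> dispatch m K I"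
abbreviation "g \<equiv> rdens I i"

sublocale machine_queue_ok J A r w p "dclass I i" "real K"
  by (rule machine_queue_ok[OF valid i_less K_pos])

lemma fin_jobs: "finite (jobs I)" using valid by (simp add: valid_instance_def)

lemma job_pos: "j \<in> jobs I \<Longrightarrow> 0 < p j" "j \<in> jobs I \<Longrightarrow> 0 < w j"
  using valid i_less by (auto simp: valid_instance_def)

lemma J_jobs: "J \<subseteq> jobs I" by (auto simp: assigned_def)

definition load :: "real \<Rightarrow> real \<Rightarrow> real" where
  "load \<theta> t = virtual_load I (speed K) f i \<theta> (arrivals I) t"

definition level :: "real \<Rightarrow> nat set" where "level \<theta> = {j. \<theta> \<le> g j}"

definition window :: "real \<Rightarrow> real \<Rightarrow> real \<Rightarrow> nat set" where
  "window \<theta> a b = {j \<in> J \<inter> level \<theta>. a \<le> r j \<and> r j \<le> b}"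

lemma fin_window: "finite (window \<theta> a b)" using finJ by (simp add: window_def)

lemma level_upward: "\<forall>j\<in>level \<theta>. \<forall>l. dclass I i j \<le> dclass I i l \<longrightarrow> l \<in> level \<theta>"
proof (intro ballI allI impI)
  fix j l assume "j \<in> level \<theta>" "dclass I i j \<le> dclass I i l"
  moreover from this(2) have "g j \<le> g l" by (simp add: rdens_def)
  ultimately show "l \<in> level \<theta>" by (simp add: level_def)
qed

lemma speed_pos: "0 < speed K" by (simp add: speed_def add_pos_nonneg)

lemma window_split:
  assumes "t0 \<le> t"
  shows "\<exists>us ys zs. arrivals I = us @ ys @ zs \<and> (\<forall>j\<in>set us. t < r j) \<and>
    (\<forall>j\<in>set ys. t0 \<le> r j \<and> r j \<le> t) \<and> (\<forall>j\<in>set zs. r j < t0) \<and>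
    set ys = {j\<in>jobs I. t0 \<le> r j \<and> r j \<le> t} \<and> distinct ys \<and> distinct (us @ ys @ zs)"
proof -
  let ?X = "arrivals_until I t"
  let ?us = "filter (\<lambda>j. \<not> r j \<le> t) (arrivals I)"
  let ?ys = "filter (\<lambda>j. t0 \<le> r j) ?X" and ?zs = "filter (\<lambda>j. \<not> t0 \<le> r j) ?X"
  have "sorted_wrt (\<lambda>j l. r l \<le> r j) ?X"
    unfolding arrivals_until_def by (rule sorted_wrt_filter[OF sorted_arrivals])
  then have "?X = ?ys @ ?zs" by (rule filter_partition_descending)
  then have eq: "arrivals I = ?us @ ?ys @ ?zs" using arrivals_split[of I t] by simp
  have d: "distinct (?us @ ?ys @ ?zs)" using distinct_arrivals[of I] eq by simp
  have s: "set ?ys = {j\<in>jobs I. t0 \<le> r j \<and> r j \<le> t}"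
    using set_arrivals[OF fin_jobs] by (auto simp: arrivals_until_def)
  show ?thesis
  proof (intro exI conjI)
    show "arrivals I = ?us @ ?ys @ ?zs" by (rule eq)
    show "distinct (?us @ ?ys @ ?zs)" by (rule d)
    show "distinct ?ys" using d by simp
  qed (use s in \<open>auto simp: arrivals_until_def\<close>)
qed

lemma level_size_eq: "level_size I f i \<theta> j = (if j \<in> J \<inter> level \<theta> then p j else 0)" if "j \<in> jobs I"
  using that by (simp add: level_size_def assigned_def level_def)

lemma load_ge_arrived:
  assumes "t0 \<le> t"
  shows "arrived (J \<inter> level \<theta>) t0 t - speed K * (t - t0) \<le> load \<theta> t"
proof -
  obtain us ys zs where s: "arrivals I = us @ ys @ zs" "\<forall>j\<in>set us. t < r j"
    "\<forall>j\<in>set ys. t0 \<le> r j \<and> r j \<le> t" "\<forall>j\<in>set zs. r j < t0"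
    "set ys = {j\<in>jobs I. t0 \<le> r j \<and> r j \<le> t}" "distinct ys" "distinct (us @ ys @ zs)"
    using window_split[OF assms] by (elim exE conjE)
  have ld: "load \<theta> t = workload I (speed K) f i \<theta> (ys @ zs) t"
    unfolding load_def s(1)
  proof (rule virtual_load_eq)
    fix j assume "j \<in> set (ys @ zs)"
    then show "r j \<le> t" using s(3,4) assms by fastforce
  qed (use s(2) in blast)
  have "arrived (J \<inter> level \<theta>) t0 t = (\<Sum>j\<in>set ys. level_size I f i \<theta> j)"
    unfolding arrived_def s(5)
  proof (rule sum.mono_neutral_cong_left)
    show "finite {j \<in> jobs I. t0 \<le> r j \<and> r j \<le> t}" using fin_jobs by simp
    show "{j \<in> J \<inter> level \<theta>. t0 \<le> r j \<and> r j \<le> t} \<subseteq> {j \<in> jobs I. t0 \<le> r j \<and> r j \<le> t}"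
      using J_jobs by blast
  qed (use J_jobs in \<open>auto simp: level_size_eq subset_iff\<close>)
  also have "\<dots> = (\<Sum>j\<leftarrow>ys. level_size I f i \<theta> j)"
    using s(6) by (simp add: sum_list_distinct_conv_sum_set)
  finally show ?thesis unfolding ld
    by (simp only:) (rule workload_ge_arrived; use s(3) assms speed_pos in simp)
qed

text \<open>Every \<open>K\<close>-th job of a class is culled and the sizes in a class differ by at
  most a factor of 2, so at least a fraction 1 / (2 K) of the arrived volume is culled. Since a
  window may just miss a multiple of \<open>K\<close>, one minimal size is lost for each class that
  occurs in it.\<close>

lemma accepted_arrived_le:
  assumes "t0 \<le> t"
  shows "arrived (A \<inter> level \<theta>) t0 t \<le> (1 - 1 / (2 * real K)) * arrived (J \<inter> level \<theta>) t0 t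
    + (\<Sum>(d, a)\<in>(\<lambda>j. (dclass I i j, sclass I i j)) ` window \<theta> t0 t. 2 powr real_of_int a)"
proof -
  let ?W = "window \<theta> t0 t" and ?h = "\<lambda>j. (dclass I i j, sclass I i j)"
  obtain us ys zs where s: "arrivals I = us @ ys @ zs" "\<forall>j\<in>set us. t < r j"
    "\<forall>j\<in>set ys. t0 \<le> r j \<and> r j \<le> t" "\<forall>j\<in>set zs. r j < t0"
    "set ys = {j\<in>jobs I. t0 \<le> r j \<and> r j \<le> t}" "distinct ys" "distinct (us @ ys @ zs)"
    using window_split[OF assms] by (elim exE conjE)
  have "sum p (?W \<inter> {j. ?h j = c} \<inter> A) \<le> (1 - 1 / (2 * real K)) * sum p {j \<in> ?W. ?h j = c} + 2 powr real_of_int (snd c)"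
    if c: "c \<in> ?h ` ?W" for c
  proof -
    obtain d a where da: "c = (d, a)" by (cases c)
    define x where "x = (2::real) powr real_of_int a"
    have x: "0 \<le> x" by (simp add: x_def)
    let ?C = "{j \<in> ?W. ?h j = c}" and ?R = "{j \<in> ?W. ?h j = c \<and> j \<in> culled_jobs m K I}"
    have fin: "finite ?C" "finite ?R" using fin_window by auto
    \<comment> \<open>A density class lies entirely inside a level or entirely outside of it.
      Restriction to the level therefore does not thin out a class, and the counts for the full
      arrival list apply.\<close>
    have lev: "j \<in> level \<theta>" if "dclass I i j = d" for j
    proof -
      obtain l where "l \<in> ?W" "dclass I i l = d" using c da by auto
      then show ?thesis using level_upward[of \<theta>] that by (auto simp: window_def)
    qed
    have C_eq: "?C = {j. job_class I f j = (i, d, a)} \<inter> set ys"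
      using lev J_jobs da s(5) by (auto simp: window_def job_class_def assigned_def)
    have R_eq: "?R = {j. job_class I f j = (i, d, a) \<and> j \<in> culled_jobs m K I} \<inter> set ys"
      using lev J_jobs da s(5) by (auto simp: window_def job_class_def assigned_def)
    have cnt: "real (card ?C) / real K - 1 \<le> real (card ?R)"
      using culled_window[OF s(7) K_pos, of I f "(i, d, a)"]
      unfolding C_eq R_eq by (simp only: distinct_length_filter[OF s(6)] culled_jobs_def s(1))
    have px: "x \<le> p j" "p j \<le> 2 * x" if "j \<in> ?C" for j
      using sclass_bounds[OF job_pos(1), of j] J_jobs that da by (auto simp: window_def x_def)
    have up: "sum p ?C \<le> of_nat (card ?C) * (2 * x)" using px by (intro sum_bounded_above) auto
    have lo: "of_nat (card ?R) * x \<le> sum p ?R" using px by (intro sum_bounded_below) auto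
    have "sum p ?C / (2 * real K) - x \<le> (real (card ?C) / real K - 1) * x"
      using up K_pos by (simp add: field_simps)
    also have "\<dots> \<le> real (card ?R) * x" using cnt x by (intro mult_right_mono) auto
    also have "\<dots> \<le> sum p ?R" using lo by simp
    finally have rej: "sum p ?C / (2 * real K) - x \<le> sum p ?R" .
    have "?W \<inter> {j. ?h j = c} \<inter> A = ?C - ?R" by (auto simp: accepted_def window_def)
    then have "sum p (?W \<inter> {j. ?h j = c} \<inter> A) = sum p ?C - sum p ?R"
      using fin by (simp add: sum_diff Collect_mono)
    then show ?thesis using rej by (simp add: da x_def algebra_simps)
  qed
  then have le: "(\<Sum>c\<in>?h ` ?W. sum p (?W \<inter> {j. ?h j = c} \<inter> A)) \<le>
      (\<Sum>c\<in>?h ` ?W. (1 - 1 / (2 * real K)) * sum p {j \<in> ?W. ?h j = c} + 2 powr real_of_int (snd c))"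
    by (rule sum_mono)
  have e1: "(\<Sum>c\<in>?h ` ?W. sum p (?W \<inter> {j. ?h j = c} \<inter> A)) = arrived (A \<inter> level \<theta>) t0 t"
  proof -
    have "(\<Sum>c\<in>?h ` ?W. sum p {j \<in> ?W \<inter> A. ?h j = c}) = sum p (?W \<inter> A)"
      using fin_window by (intro sum.group) auto
    moreover have "{j \<in> ?W \<inter> A. ?h j = c} = ?W \<inter> {j. ?h j = c} \<inter> A" for c by auto
    moreover have "?W \<inter> A = {j \<in> A \<inter> level \<theta>. t0 \<le> r j \<and> r j \<le> t}"
      using A_sub by (auto simp: window_def)
    ultimately show ?thesis unfolding arrived_def by simp
  qed
  have e2: "(\<Sum>c\<in>?h ` ?W. sum p {j \<in> ?W. ?h j = c}) = arrived (J \<inter> level \<theta>) t0 t"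
  proof -
    have "(\<Sum>c\<in>?h ` ?W. sum p {j \<in> ?W. ?h j = c}) = sum p ?W"
      using fin_window by (intro sum.group) auto
    then show ?thesis unfolding arrived_def window_def by simp
  qed
  show ?thesis using le unfolding sum.distrib sum_distrib_left[symmetric] e1 e2
    by (simp add: case_prod_unfold)
qed

text \<open>For how long the rounding error of a job's class can matter on level \<open>\<theta>\<close>.\<close>

definition lag :: "real \<Rightarrow> nat \<Rightarrow> real" where
  "lag \<theta> j = p j * sqrt (g j / \<theta>) * (32 * real K)"

definition recent :: "real \<Rightarrow> real \<Rightarrow> nat set" where
  "recent \<theta> t = {j \<in> J \<inter> level \<theta>. r j \<le> t \<and> t \<le> r j + lag \<theta> j}"

text \<open>A class with a recent job in the window is paid for by that job. A job of any other
  class has outlived its lag within the window, so its size times the root of its density is at most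
  (t - t0) sqrt \<theta> / (32 K). The double geometric sum with z equal to this bound and y = sqrt
  \<theta> gives 4 / 32 = 1 / 8.\<close>

lemma rounding_error_le:
  assumes "t0 \<le> t" "0 < \<theta>"
  shows "(\<Sum>(d, a)\<in>(\<lambda>j. (dclass I i j, sclass I i j)) ` window \<theta> t0 t. 2 powr real_of_int a)
    \<le> sum p (recent \<theta> t) + (t - t0) / (8 * real K)"
proof -
  let ?W = "window \<theta> t0 t" and ?h = "\<lambda>j. (dclass I i j, sclass I i j)"
  let ?e = "\<lambda>c::int \<times> int. 2 powr real_of_int (snd c) :: real"
  define Y where "Y = ?W \<inter> recent \<theta> t"
  define C where "C = ?h ` ?W - ?h ` Y"
  have finY: "finite Y" using fin_window by (simp add: Y_def)
  have pJ: "0 \<le> p j" if "j \<in> J" for j using p_pos[OF that] by simp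
  have "(\<Sum>c\<in>?h ` Y. ?e c) \<le> (\<Sum>c\<in>?h ` Y. sum p {j \<in> Y. ?h j = c})"
  proof (rule sum_mono)
    fix c assume "c \<in> ?h ` Y"
    then obtain j where j: "j \<in> Y" "?h j = c" by auto
    then have jJ: "j \<in> J" by (auto simp: Y_def window_def)
    have "?e c \<le> p j" using sclass_bounds(1)[of I i j] p_pos[OF jJ] j by auto
    also have "\<dots> \<le> sum p {j \<in> Y. ?h j = c}"
    proof (rule member_le_sum)
      show "finite {j \<in> Y. ?h j = c}" using finY by simp
    qed (use j pJ in \<open>auto simp: Y_def window_def\<close>)
    finally show "?e c \<le> sum p {j \<in> Y. ?h j = c}" .
  qed
  also have "\<dots> = sum p Y" using finY by (intro sum.group) auto
  also have "\<dots> \<le> sum p (recent \<theta> t)"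
    using finJ pJ by (intro sum_mono2) (auto simp: Y_def recent_def)
  finally have young: "(\<Sum>c\<in>?h ` Y. ?e c) \<le> sum p (recent \<theta> t)" .
  have old: "(\<Sum>(d, a)\<in>C. 2 powr real_of_int a) \<le> 4 * ((t - t0) * sqrt \<theta> / (32 * real K)) / sqrt \<theta>"
  proof (rule geometric_pair_sum_le)
    show "finite C" using fin_window by (simp add: C_def)
    fix d a assume "(d, a) \<in> C"
    then obtain j where j: "j \<in> ?W" "j \<notin> recent \<theta> t" "dclass I i j = d" "sclass I i j = a"
      by (auto simp: C_def Y_def)
    have jJ: "j \<in> J" "j \<in> level \<theta>" "t0 \<le> r j" "r j \<le> t" using j by (auto simp: window_def)
    have "lag \<theta> j < t - t0" using j jJ by (auto simp: recent_def)
    then have "p j * (2 powr real_of_int d / sqrt \<theta>) * (32 * real K) < t - t0"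
      by (simp add: lag_def real_sqrt_divide rdens_sqrt j)
    then have "p j * 2 powr real_of_int d \<le> (t - t0) * sqrt \<theta> / (32 * real K)"
      using assms K_pos by (simp add: field_simps)
    moreover have "2 powr real_of_int a \<le> p j" using sclass_bounds(1)[of I i j] p_pos[OF jJ(1)] j by simp
    ultimately show "2 powr real_of_int a * 2 powr real_of_int d \<le> (t - t0) * sqrt \<theta> / (32 * real K)"
      by (meson mult_right_mono order.trans powr_ge_zero)
    have "sqrt \<theta> \<le> sqrt (g j)" using jJ by (simp add: level_def)
    then show "sqrt \<theta> \<le> 2 powr real_of_int d" by (simp add: rdens_sqrt j)
  qed (use assms in auto)
  also have "\<dots> = (t - t0) / (8 * real K)" using assms by simp
  finally have old': "(\<Sum>c\<in>C. ?e c) \<le> (t - t0) / (8 * real K)" by (simp add: case_prod_unfold)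
  have "?h ` ?W = ?h ` Y \<union> C" "?h ` Y \<inter> C = {}" by (auto simp: C_def Y_def)
  moreover have "finite C" using fin_window by (simp add: C_def)
  ultimately have "(\<Sum>c\<in>?h ` ?W. ?e c) = (\<Sum>c\<in>?h ` Y. ?e c) + (\<Sum>c\<in>C. ?e c)"
    using finY sum.union_disjoint[of "?h ` Y" C ?e] by simp
  then show ?thesis using young old' by (simp add: case_prod_unfold)
qed

text \<open>The balance of rates: of the virtual rate 1 + 1 / (4 K), culling leaves (1 - 1 / (2 K))
  (1 + 1 / (4 K)), which is at most 1 - 1 / (4 K). Old rounding errors consume 1 / (8 K) of the gap
  to unit speed; the remaining 1 / (8 K) is the slack in the conclusion.\<close>

lemma accepted_backlog_le:
  assumes "t0 \<le> t" "0 < \<theta>"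
  shows "arrived (A \<inter> level \<theta>) t0 t - (t - t0) \<le> load \<theta> t + sum p (recent \<theta> t) - (t - t0) / (8 * real K)"
proof -
  let ?q = "1 - 1 / (2 * real K)"
  have q: "0 \<le> ?q" "?q \<le> 1" using K_pos by (auto simp: field_simps)
  have x: "0 \<le> t - t0" using assms by simp
  have "?q * arrived (J \<inter> level \<theta>) t0 t \<le> ?q * (load \<theta> t + speed K * (t - t0))"
    using load_ge_arrived[OF assms(1), of \<theta>] q by (intro mult_left_mono) auto
  also have "\<dots> = ?q * load \<theta> t + ?q * speed K * (t - t0)" by (simp only: distrib_left mult.assoc)
  also have "?q * load \<theta> t \<le> load \<theta> t"
    using q by (intro mult_left_le_one_le) (auto simp: load_def virtual_load_nonneg)
  also have "?q * speed K * (t - t0) \<le> (1 - 1 / (4 * real K)) * (t - t0)"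
    using K_pos x by (intro mult_right_mono) (auto simp: speed_def field_simps)
  finally have "?q * arrived (J \<inter> level \<theta>) t0 t \<le> load \<theta> t + (1 - 1 / (4 * real K)) * (t - t0)" by simp
  moreover have "(1 - 1 / (4 * real K)) * (t - t0) = (t - t0) - 2 * ((t - t0) / (8 * real K))"
    using K_pos by (simp add: field_simps)
  ultimately show ?thesis
    using accepted_arrived_le[OF assms(1), of \<theta>] rounding_error_le[OF assms] by linarith
qed

text \<open>Until 8 K \<open>p k\<close> after the stop of a blocking run of \<open>k\<close>, the
  blocked volume is charged. Later the slack since the start of the run, at rate 1 / (8 K), has
  reached \<open>p k\<close>, and the account opened at the start shows no trace of the run.\<close>

lemma waiting_le:
  assumes "0 < \<theta>"
  shows "waiting (level \<theta>) t \<le> load \<theta> t + sum p (recent \<theta> t) +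
    (\<Sum>k\<in>A. blocked (level \<theta>) k * indicator {job_start k..job_stop k + 8 * real K * p k} t)"
proof -
  let ?b = "\<lambda>k. blocked (level \<theta>) k * indicator {job_start k..job_stop k + 8 * real K * p k} t"
  have pJ: "0 \<le> p j" if "j \<in> J" for j using p_pos[OF that] by simp
  have bl: "0 \<le> blocked (level \<theta>) k" for k unfolding blocked_def using pJ by (intro sum_nonneg) auto
  have b: "0 \<le> ?b k" for k using bl by simp
  have sb: "0 \<le> (\<Sum>k\<in>A. ?b k)" using b by (intro sum_nonneg) auto
  have b_le: "?b k \<le> (\<Sum>k\<in>A. ?b k)" if "k \<in> A" for k using that b finA by (intro member_le_sum) auto
  have ld: "0 \<le> load \<theta> t" by (simp add: load_def virtual_load_nonneg)
  have rc: "0 \<le> sum p (recent \<theta> t)" using pJ by (intro sum_nonneg) (auto simp: recent_def)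
  have start_stop: "job_start k < job_stop k" if "k \<in> A" for k
    using run_end_bounds(1)[of k] A_sub that by (auto simp: job_stop_eq)
  show ?thesis
  proof (cases "waiting (level \<theta>) t > 0")
    case False then show ?thesis using ld rc sb by linarith
  next
    case True
    from waiting_bound[OF level_upward True] show ?thesis
    proof (elim disjE bexE exE conjE)
      fix k assume k: "k \<in> A" "job_start k \<le> t" "t < job_stop k" "waiting (level \<theta>) t \<le> blocked (level \<theta>) k"
      have "0 \<le> real K * p k" using pJ k(1) A_sub by auto
      then have "?b k = blocked (level \<theta>) k" using k by (simp add: indicator_def)
      then show ?thesis using b_le[OF k(1)] k(4) ld rc by linarith
    next
      fix t0 assume t0: "t0 \<le> t" "waiting (level \<theta>) t \<le> arrived (A \<inter> level \<theta>) t0 t - (t - t0)"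
      have "0 \<le> (t - t0) / (8 * real K)" using t0 by simp
      then show ?thesis using accepted_backlog_le[OF t0(1) assms] t0(2) sb by linarith
    next
      fix k assume k: "k \<in> A" "job_stop k \<le> t"
        "waiting (level \<theta>) t \<le> blocked (level \<theta>) k + arrived (A \<inter> level \<theta>) (job_stop k) t - (t - job_stop k)"
        "waiting (level \<theta>) t \<le> arrived (A \<inter> level \<theta>) (job_start k) t - (t - job_start k) + p k"
      note ss = start_stop[OF k(1)]
      show ?thesis
      proof (cases "t \<le> job_stop k + 8 * real K * p k")
        case True
        then have "?b k = blocked (level \<theta>) k" using k ss by (simp add: indicator_def)
        moreover have "0 \<le> (t - job_stop k) / (8 * real K)" using k by simp
        ultimately show ?thesis using accepted_backlog_le[OF k(2) assms] k(3) b_le[OF k(1)] by linarith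
      next
        case False
        then have "p k \<le> (t - job_start k) / (8 * real K)" using ss K_pos by (simp add: field_simps)
        moreover have "job_start k \<le> t" using k ss by simp
        ultimately show ?thesis using accepted_backlog_le[of "job_start k" t \<theta>] assms k(4) sb by fastforce
      qed
    qed
  qed
qed

end

section \<open>Integration over time and over density levels\<close>

lemma nn_integral_inverse_sqrt:
  assumes "0 < c"
  shows "(\<integral>\<^sup>+\<theta>. ennreal (sqrt (c / \<theta>)) * indicator {0<..c} \<theta> \<partial>lborel) = ennreal (2 * c)"
proof -
  let ?h = "\<lambda>x::real. if x \<in> {0..c} then sqrt c * x powr (- (1 / 2)) else 0"
  \<comment> \<open>The integrand is unbounded at 0; the gauge integral includes this end point, and
    nonnegativity transfers the value to the Lebesgue integral.\<close>
  have "((\<lambda>x. x powr (- (1 / 2))) has_integral (c powr (- (1 / 2) + 1) / (- (1 / 2) + 1))) {0..c}"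
    using assms by (intro has_integral_powr_from_0) auto
  then have "((\<lambda>x. sqrt c * x powr (- (1 / 2))) has_integral sqrt c * (c powr (- (1 / 2) + 1) / (- (1 / 2) + 1))) {0..c}"
    by (rule has_integral_mult_right)
  moreover have "sqrt c * (c powr (- (1 / 2) + 1) / (- (1 / 2) + 1)) = 2 * c"
    using assms powr_half_sqrt[of c] by simp
  ultimately have "(?h has_integral 2 * c) UNIV"
    by (simp only: has_integral_restrict_UNIV)
  moreover have "?h \<in> borel_measurable borel" by (intro measurable_If) auto
  ultimately have *: "(\<integral>\<^sup>+x. ennreal (?h x) \<partial>lborel) = ennreal (2 * c)"
    using assms by (intro nn_integral_has_integral_lborel) auto
  have "ennreal (sqrt (c / x)) * indicator {0<..c} x = ennreal (?h x)" for x
  proof (cases "0 < x \<and> x \<le> c")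
    case True
    have "sqrt (c / x) = sqrt c * x powr (- (1 / 2))"
      using True powr_half_sqrt[of x] by (simp add: real_sqrt_divide powr_minus_divide)
    then show ?thesis using True by simp
  next
    case False
    then show ?thesis by (cases "x = 0") (auto simp: indicator_def)
  qed
  then show ?thesis using * by simp
qed

lemma nn_integral_level:
  assumes "0 \<le> c"
  shows "(\<integral>\<^sup>+\<theta>. indicator {0<..c} \<theta> * ennreal x \<partial>lborel) = ennreal c * ennreal x"
proof -
  have "(\<integral>\<^sup>+\<theta>. indicator {0<..c} \<theta> * ennreal x \<partial>lborel) = (\<integral>\<^sup>+\<theta>. ennreal x * indicator {0<..c} \<theta> \<partial>lborel)"
    by (simp add: mult.commute)
  also have "\<dots> = ennreal x * emeasure lborel {0<..c}" by (rule nn_integral_cmult_indicator) simp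
  finally show ?thesis using assms by (simp add: mult.commute)
qed

context machine_analysis
begin

lemma load_nonneg: "0 \<le> load \<theta> t"
  by (simp add: load_def virtual_load_nonneg)

lemma load_measurable [measurable (raw)]:
  assumes [measurable]: "a \<in> borel_measurable M" "b \<in> borel_measurable M"
  shows "(\<lambda>x. load (a x) (b x)) \<in> borel_measurable M"
  unfolding load_def by measurable

definition load_volume :: ennreal where
  "load_volume = (\<integral>\<^sup>+\<theta>. indicator {0<..} \<theta> * (\<integral>\<^sup>+t. ennreal (load \<theta> t) \<partial>lborel) \<partial>lborel)"

text \<open>Integrating the waiting volume over time counts the size of each job of the level for as
  long as it waits. On the other side a recent job is counted for its lag, and a blocked job for the
  charging interval of \<open>k\<close>, whose length is at most (1 + 8 K)
  \<open>p k\<close>.\<close>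

lemma weighted_waiting_le:
  assumes "0 < \<theta>"
  shows "(\<Sum>j\<in>A. indicator {0<..g j} \<theta> * ennreal (p j * (job_start j - r j))) \<le>
    (\<integral>\<^sup>+t. ennreal (load \<theta> t) \<partial>lborel) + (\<Sum>j\<in>J. indicator {0<..g j} \<theta> * ennreal (p j * lag \<theta> j)) +
    (\<Sum>k\<in>A. \<Sum>j | j \<in> J \<and> job_start k < r j \<and> r j < job_stop k.
        indicator {0<..g j} \<theta> * ennreal (p j * ((1 + 8 * real K) * p k)))"
proof -
  let ?l = "\<lambda>j. indicator {0<..g j} \<theta> :: ennreal"
  let ?B = "\<lambda>k. {j. j \<in> J \<and> job_start k < r j \<and> r j < job_stop k}"
  have lev: "j \<in> level \<theta> \<longleftrightarrow> \<theta> \<in> {0<..g j}" for j using assms by (simp add: level_def)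
  have pJ: "0 \<le> p j" if "j \<in> J" for j using p_pos[OF that] by simp
  have pA: "0 \<le> p j" if "j \<in> A" for j using pJ A_sub that by auto
  have lag: "0 \<le> lag \<theta> j" if "j \<in> J" for j
    using pJ[OF that] rdens_pos[of I i j] assms by (simp add: lag_def)
  have finB: "finite (?B k)" for k using finJ by simp
  have w_eq: "ennreal (waiting (level \<theta>) t) = (\<Sum>j\<in>A. ?l j * ennreal (p j) * indicator {r j..<job_start j} t)" for t
  proof -
    have "ennreal (waiting (level \<theta>) t) = (\<Sum>j | j \<in> A \<inter> level \<theta> \<and> r j \<le> t \<and> t < job_start j. ennreal (p j))"
      unfolding waiting_def using pA by (intro sum_ennreal[symmetric]) auto
    also have "\<dots> = (\<Sum>j\<in>A. ?l j * ennreal (p j) * indicator {r j..<job_start j} t)"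
      using finA by (intro sum.mono_neutral_cong_left) (auto simp: lev indicator_def)
    finally show ?thesis .
  qed
  have r_eq: "ennreal (sum p (recent \<theta> t)) = (\<Sum>j\<in>J. ?l j * ennreal (p j) * indicator {r j..r j + lag \<theta> j} t)" for t
  proof -
    have "ennreal (sum p (recent \<theta> t)) = (\<Sum>j\<in>recent \<theta> t. ennreal (p j))"
      using pJ by (intro sum_ennreal[symmetric]) (auto simp: recent_def)
    also have "\<dots> = (\<Sum>j\<in>J. ?l j * ennreal (p j) * indicator {r j..r j + lag \<theta> j} t)"
      using finJ by (intro sum.mono_neutral_cong_left) (auto simp: recent_def lev indicator_def)
    finally show ?thesis .
  qed
  have b_eq: "ennreal (blocked (level \<theta>) k) = (\<Sum>j\<in>?B k. ?l j * ennreal (p j))" for k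
  proof -
    have "ennreal (blocked (level \<theta>) k) = (\<Sum>j | j \<in> J \<inter> level \<theta> \<and> job_start k < r j \<and> r j < job_stop k. ennreal (p j))"
      unfolding blocked_def using pJ by (intro sum_ennreal[symmetric]) auto
    also have "\<dots> = (\<Sum>j\<in>?B k. ?l j * ennreal (p j))"
      using finJ by (intro sum.mono_neutral_cong_left) (auto simp: lev indicator_def)
    finally show ?thesis .
  qed
  let ?X = "\<lambda>k. {job_start k..job_stop k + 8 * real K * p k}"
  have bl: "0 \<le> blocked (level \<theta>) k" for k unfolding blocked_def using pJ by (intro sum_nonneg) auto
  have rec: "0 \<le> sum p (recent \<theta> t)" for t using pJ by (intro sum_nonneg) (auto simp: recent_def)
  have point: "(\<Sum>j\<in>A. ?l j * ennreal (p j) * indicator {r j..<job_start j} t) \<le>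
      ennreal (load \<theta> t) + (\<Sum>j\<in>J. ?l j * ennreal (p j) * indicator {r j..r j + lag \<theta> j} t)
      + (\<Sum>k\<in>A. ennreal (blocked (level \<theta>) k) * indicator (?X k) t)" for t
  proof -
    have "ennreal (waiting (level \<theta>) t) \<le> ennreal (load \<theta> t + sum p (recent \<theta> t) +
      (\<Sum>k\<in>A. blocked (level \<theta>) k * indicator (?X k) t))"
      by (rule ennreal_leI[OF waiting_le[OF assms]])
    also have "\<dots> = ennreal (load \<theta> t) + ennreal (sum p (recent \<theta> t))
        + ennreal (\<Sum>k\<in>A. blocked (level \<theta>) k * indicator (?X k) t)"
      using load_nonneg rec bl by (simp add: sum_nonneg)
    also have "ennreal (\<Sum>k\<in>A. blocked (level \<theta>) k * indicator (?X k) t)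
        = (\<Sum>k\<in>A. ennreal (blocked (level \<theta>) k) * indicator (?X k) t)"
    proof (rule trans[OF sum_ennreal[symmetric]])
      show "(\<Sum>k\<in>A. ennreal (blocked (level \<theta>) k * indicator (?X k) t))
          = (\<Sum>k\<in>A. ennreal (blocked (level \<theta>) k) * indicator (?X k) t)"
        by (intro sum.cong refl) (auto simp: indicator_def)
    qed (use bl in simp)
    finally show ?thesis unfolding w_eq r_eq .
  qed
  have "(\<Sum>j\<in>A. ?l j * ennreal (p j * (job_start j - r j)))
      = (\<Sum>j\<in>A. ?l j * ennreal (p j) * emeasure lborel {r j..<job_start j})"
    using release_le_job_start pA by (intro sum.cong) (auto simp: ennreal_mult mult.assoc)
  also have "\<dots> = (\<integral>\<^sup>+t. (\<Sum>j\<in>A. ?l j * ennreal (p j) * indicator {r j..<job_start j} t) \<partial>lborel)"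
    by (subst nn_integral_sum) (auto simp: nn_integral_cmult_indicator)
  also have "\<dots> \<le> (\<integral>\<^sup>+t. ennreal (load \<theta> t) + (\<Sum>j\<in>J. ?l j * ennreal (p j) * indicator {r j..r j + lag \<theta> j} t)
      + (\<Sum>k\<in>A. ennreal (blocked (level \<theta>) k) * indicator (?X k) t) \<partial>lborel)"
    by (rule nn_integral_mono) (rule point)
  also have "\<dots> = (\<integral>\<^sup>+t. ennreal (load \<theta> t) \<partial>lborel) + (\<Sum>j\<in>J. ?l j * ennreal (p j) * emeasure lborel {r j..r j + lag \<theta> j})
      + (\<Sum>k\<in>A. ennreal (blocked (level \<theta>) k) * emeasure lborel (?X k))"
    by (simp add: nn_integral_add nn_integral_sum nn_integral_cmult_indicator)
  also have "(\<Sum>j\<in>J. ?l j * ennreal (p j) * emeasure lborel {r j..r j + lag \<theta> j}) = (\<Sum>j\<in>J. ?l j * ennreal (p j * lag \<theta> j))"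
    using lag pJ by (intro sum.cong) (auto simp: ennreal_mult mult.assoc)
  also have "(\<Sum>k\<in>A. ennreal (blocked (level \<theta>) k) * emeasure lborel (?X k)) \<le>
      (\<Sum>k\<in>A. ennreal (blocked (level \<theta>) k) * ennreal ((1 + 8 * real K) * p k))"
  proof (intro sum_mono mult_left_mono)
    fix k assume k: "k \<in> A"
    then have kJ: "k \<in> J" using A_sub by auto
    have "job_start k \<le> job_stop k" "job_stop k \<le> job_start k + p k"
      using run_end_bounds[OF kJ, of "job_start k"] by (auto simp: job_stop_eq[OF k])
    moreover from this have "job_start k \<le> job_stop k + 8 * real K * p k"
      using pJ[OF kJ] by (simp add: add_increasing2)
    ultimately have "emeasure lborel (?X k) = ennreal (job_stop k + 8 * real K * p k - job_start k)"
      "job_stop k + 8 * real K * p k - job_start k \<le> (1 + 8 * real K) * p k"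
      by (simp_all add: distrib_right)
    then show "emeasure lborel (?X k) \<le> ennreal ((1 + 8 * real K) * p k)"
      by (simp only: ennreal_leI)
  qed simp
  also have "(\<Sum>k\<in>A. ennreal (blocked (level \<theta>) k) * ennreal ((1 + 8 * real K) * p k)) =
      (\<Sum>k\<in>A. \<Sum>j\<in>?B k. ?l j * ennreal (p j * ((1 + 8 * real K) * p k)))"
    unfolding b_eq sum_distrib_right using pJ pA
    by (intro sum.cong) (auto simp: ennreal_mult mult.assoc)
  finally show ?thesis by (simp add: add_left_mono)
qed

lemma lag_integral:
  assumes "j \<in> J"
  shows "(\<integral>\<^sup>+\<theta>. indicator {0<..g j} \<theta> * ennreal (p j * lag \<theta> j) \<partial>lborel) = ennreal (64 * real K * (g j * p j * p j))"
proof -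
  have pJ: "0 \<le> p j" using p_pos[OF assms] by simp
  have "indicator {0<..g j} \<theta> * ennreal (p j * lag \<theta> j) =
      ennreal (p j * p j * (32 * real K)) * (ennreal (sqrt (g j / \<theta>)) * indicator {0<..g j} \<theta>)" for \<theta>
    using pJ rdens_pos[of I i j]
    by (auto simp: lag_def indicator_def ennreal_mult[symmetric] mult.assoc intro!: arg_cong[where f=ennreal])
  then have "(\<integral>\<^sup>+\<theta>. indicator {0<..g j} \<theta> * ennreal (p j * lag \<theta> j) \<partial>lborel)
     = ennreal (p j * p j * (32 * real K)) * ennreal (2 * g j)"
    by (simp add: nn_integral_cmult nn_integral_inverse_sqrt[OF rdens_pos])
  also have "\<dots> = ennreal (64 * real K * (g j * p j * p j))"
    using pJ rdens_pos[of I i j] by (simp add: ennreal_mult[symmetric] mult.assoc mult.left_commute)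
  finally show ?thesis .
qed

lemma rounded_weight_le: "j \<in> J \<Longrightarrow> g j * p j \<le> w j"
  using rdens_bounds(1)[of I i j] p_pos w_pos by simp

text \<open>Integration over \<theta> turns the indicator of \<open>{0<..g j}\<close> into the
  factor \<open>g j\<close>, while the root in the lag integrates to \<open>2 * g j\<close>; this
  doubles 32 K to 64 K. The jobs blocked by \<open>k\<close> weigh at most K \<open>w k\<close> and
  are charged for (1 + 8 K) \<open>p k\<close>, which adds K + 8 K^2.\<close>

lemma total_waiting_le:
  "ennreal (\<Sum>j\<in>A. g j * p j * (job_start j - r j)) \<le> load_volume
     + ennreal ((65 * real K + 8 * (real K)\<^sup>2) * (\<Sum>j\<in>J. w j * p j))"
proof -
  let ?B = "\<lambda>k. {j. j \<in> J \<and> job_start k < r j \<and> r j < job_stop k}"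
  let ?c = "1 + 8 * real K"
  have pJ: "0 \<le> p j" "0 \<le> w j" if "j \<in> J" for j using p_pos[OF that] w_pos[OF that] by auto
  have pA: "0 \<le> p j" "0 \<le> w j" if "j \<in> A" for j using pJ A_sub that by auto
  have g0: "0 \<le> g j" for j using rdens_pos[of I i j] by simp
  have js: "0 \<le> job_start j - r j" if "j \<in> A" for j using release_le_job_start[OF that] by simp
  have "ennreal (\<Sum>j\<in>A. g j * p j * (job_start j - r j)) = (\<Sum>j\<in>A. ennreal (g j) * ennreal (p j * (job_start j - r j)))"
    using g0 pA js by (subst sum_ennreal[symmetric]) (auto simp: ennreal_mult[symmetric] mult.assoc intro!: sum.cong)
  also have "\<dots> = (\<integral>\<^sup>+\<theta>. (\<Sum>j\<in>A. indicator {0<..g j} \<theta> * ennreal (p j * (job_start j - r j))) \<partial>lborel)"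
    by (subst nn_integral_sum) (auto simp: nn_integral_level[OF g0])
  also have "\<dots> \<le> (\<integral>\<^sup>+\<theta>. indicator {0<..} \<theta> * (\<integral>\<^sup>+t. ennreal (load \<theta> t) \<partial>lborel)
     + (\<Sum>j\<in>J. indicator {0<..g j} \<theta> * ennreal (p j * lag \<theta> j))
     + (\<Sum>k\<in>A. \<Sum>j\<in>?B k. indicator {0<..g j} \<theta> * ennreal (p j * (?c * p k))) \<partial>lborel)"
  proof (rule nn_integral_mono)
    fix \<theta> :: real
    show "(\<Sum>j\<in>A. indicator {0<..g j} \<theta> * ennreal (p j * (job_start j - r j))) \<le>
     indicator {0<..} \<theta> * (\<integral>\<^sup>+t. ennreal (load \<theta> t) \<partial>lborel)
     + (\<Sum>j\<in>J. indicator {0<..g j} \<theta> * ennreal (p j * lag \<theta> j))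
     + (\<Sum>k\<in>A. \<Sum>j\<in>?B k. indicator {0<..g j} \<theta> * ennreal (p j * (?c * p k)))"
      using weighted_waiting_le[of \<theta>] by (cases "0 < \<theta>") auto
  qed
  also have "\<dots> = load_volume
     + (\<Sum>j\<in>J. \<integral>\<^sup>+\<theta>. indicator {0<..g j} \<theta> * ennreal (p j * lag \<theta> j) \<partial>lborel)
     + (\<Sum>k\<in>A. \<Sum>j\<in>?B k. \<integral>\<^sup>+\<theta>. indicator {0<..g j} \<theta> * ennreal (p j * (?c * p k)) \<partial>lborel)"
    unfolding load_volume_def lag_def by (simp add: nn_integral_add nn_integral_sum)
  also have "(\<Sum>j\<in>J. \<integral>\<^sup>+\<theta>. indicator {0<..g j} \<theta> * ennreal (p j * lag \<theta> j) \<partial>lborel)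
     = (\<Sum>j\<in>J. ennreal (64 * real K * (g j * p j * p j)))"
    by (intro sum.cong refl lag_integral)
  also have "\<dots> \<le> (\<Sum>j\<in>J. ennreal (64 * real K * (w j * p j)))"
    using rounded_weight_le pJ by (intro sum_mono ennreal_leI mult_left_mono mult_right_mono) auto
  also have "(\<Sum>j\<in>J. ennreal (64 * real K * (w j * p j))) = ennreal (\<Sum>j\<in>J. 64 * real K * (w j * p j))"
    using pJ by (intro sum_ennreal) auto
  also have "(\<Sum>k\<in>A. \<Sum>j\<in>?B k. \<integral>\<^sup>+\<theta>. indicator {0<..g j} \<theta> * ennreal (p j * (?c * p k)) \<partial>lborel)
     = (\<Sum>k\<in>A. \<Sum>j\<in>?B k. ennreal (g j * p j * (?c * p k)))"
    using g0 pJ pA by (intro sum.cong refl) (auto simp: nn_integral_level[OF g0] ennreal_mult[symmetric] mult.assoc)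
  also have "\<dots> \<le> (\<Sum>k\<in>A. ennreal (real K * w k * (?c * p k)))"
  proof (rule sum_mono)
    fix k assume k: "k \<in> A"
    then have kJ: "k \<in> J" using A_sub by auto
    have "(\<Sum>j\<in>?B k. ennreal (g j * p j * (?c * p k))) = ennreal (\<Sum>j\<in>?B k. g j * p j * (?c * p k))"
      using g0 pJ pA[OF k] by (intro sum_ennreal) auto
    also have "(\<Sum>j\<in>?B k. g j * p j * (?c * p k)) = (\<Sum>j\<in>?B k. g j * p j) * (?c * p k)"
      by (simp add: sum_distrib_right)
    also have "ennreal \<dots> \<le> ennreal (real K * w k * (?c * p k))"
    proof (intro ennreal_leI mult_right_mono)
      have "(\<Sum>j\<in>?B k. g j * p j) \<le> (\<Sum>j\<in>?B k. w j)"
        using rounded_weight_le by (intro sum_mono) auto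
      also have "\<dots> \<le> real K * w k"
        using weight_before_run_end[OF kJ, of "job_start k"] by (simp add: job_stop_eq[OF k])
      finally show "(\<Sum>j\<in>?B k. g j * p j) \<le> real K * w k" .
    qed (use pA[OF k] in auto)
    finally show "(\<Sum>j\<in>?B k. ennreal (g j * p j * (?c * p k))) \<le> ennreal (real K * w k * (?c * p k))" .
  qed
  also have "\<dots> = ennreal (\<Sum>k\<in>A. real K * w k * (?c * p k))"
    using pA by (intro sum_ennreal) auto
  also have "\<dots> \<le> ennreal (\<Sum>k\<in>J. real K * w k * (?c * p k))"
    using pJ A_sub finJ by (intro ennreal_leI sum_mono2) auto
  finally have "ennreal (\<Sum>j\<in>A. g j * p j * (job_start j - r j)) \<le> load_volume
     + ennreal (\<Sum>j\<in>J. 64 * real K * (w j * p j)) + ennreal (\<Sum>k\<in>J. real K * w k * (?c * p k))"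
    by (simp add: add_left_mono add_mono)
  also have "\<dots> = load_volume + ennreal ((\<Sum>j\<in>J. 64 * real K * (w j * p j)) + (\<Sum>k\<in>J. real K * w k * (?c * p k)))"
    using pJ by (simp add: add.assoc sum_nonneg)
  also have "(\<Sum>j\<in>J. 64 * real K * (w j * p j)) + (\<Sum>k\<in>J. real K * w k * (?c * p k))
     = (65 * real K + 8 * (real K)\<^sup>2) * (\<Sum>j\<in>J. w j * p j)"
    unfolding sum_distrib_left sum.distrib[symmetric]
    by (intro sum.cong refl) (simp add: power2_eq_square algebra_simps)
  finally show ?thesis .
qed

end

subsection \<open>The dual solution\<close>

definition earlier :: "job_instance \<Rightarrow> nat \<Rightarrow> nat list" where
  "earlier I j = tl (dropWhile (\<lambda>l. l \<noteq> j) (arrivals I))"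

lemma earlier_eq:
  assumes "arrivals I = ys @ j # zs" shows "earlier I j = zs"
proof -
  have "\<forall>l\<in>set ys. l \<noteq> j" using distinct_arrivals[of I] assms by auto
  then have "dropWhile (\<lambda>l. l \<noteq> j) (ys @ j # zs) = j # zs" by (simp add: dropWhile_append2)
  then show ?thesis by (simp add: earlier_def assms)
qed

definition wait_cost :: "nat \<Rightarrow> nat \<Rightarrow> job_instance \<Rightarrow> nat \<Rightarrow> nat \<Rightarrow> ennreal" where
  "wait_cost m K I i j = ennreal (ptime I i j / speed K) * (\<integral>\<^sup>+\<theta>. indicator {0<..rdens I i j} \<theta> *
       ennreal (workload I (speed K) (dispatch m K I) i \<theta> (earlier I j) (release I j)) \<partial>lborel)"

text \<open>The machine of \<open>j\<close> was chosen while only the earlier jobs were dispatched.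
  The final dispatch agrees with that assignment on these jobs, so the price seen then can be
  written in terms of it.\<close>

lemma wait_cost_dispatch_le:
  fixes m K :: nat
  assumes "valid_instance m I" "m \<ge> 1" "j \<in> jobs I" "i < m"
  defines "i0 \<equiv> dispatch m K I j"
  shows "wait_cost m K I i0 j + ennreal (2 * weight I j * ptime I i0 j)
    \<le> wait_cost m K I i j + ennreal (2 * weight I j * ptime I i j)"
proof -
  have "j \<in> set (arrivals I)" using assms by (simp add: set_arrivals valid_instance_def)
  then obtain ys zs where eq: "arrivals I = ys @ j # zs" by (meson split_list)
  let ?f = "assign m I (speed K) zs"
  have dist: "distinct (ys @ j # zs)" using distinct_arrivals[of I] eq by simp
  have "dispatch m K I j = cheapest m I (speed K) ?f zs j"
    using assign_append[OF dist, of j] by (simp add: dispatch_def eq)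
  then have "price I (speed K) ?f zs j i0 \<le> price I (speed K) ?f zs j i"
    using cheapest_prop(2)[OF assms(2,4)] by (simp add: i0_def)
  moreover have "price I (speed K) ?f zs j i' = wait_cost m K I i' j + ennreal (2 * weight I j * ptime I i' j)"
    if "i' < m" for i'
  proof -
    have "?f l = dispatch m K I l" if "l \<in> set zs" for l
      using assign_append[of "ys @ [j]" zs l] dist that by (simp add: dispatch_def eq)
    then have "price I (speed K) ?f zs j i' = price I (speed K) (dispatch m K I) zs j i'"
      using that by (intro price_cong) (auto simp: same_on_def)
    then show ?thesis by (simp add: price_def wait_cost_def earlier_eq[OF eq])
  qed
  ultimately show ?thesis using dispatch_less[OF assms(2)] assms(4) by (simp add: i0_def)
qed

context machine_analysis
begin

lemma level_size_nonneg: "j \<in> jobs I \<Longrightarrow> 0 \<le> level_size I f i \<theta> j"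
  using job_pos(1)[of j] by (simp add: level_size_def)

text \<open>The backlog that \<open>j\<close> meets drains at most at rate \<open>speed K\<close>;
  \<open>j\<close> itself and everything behind it in the arrival order can only add to it.\<close>

lemma load_ge_decay:
  assumes "j \<in> jobs I" "r j \<le> t"
  shows "workload I (speed K) f i \<theta> (earlier I j) (r j) \<le> load \<theta> t + speed K * (t - r j)"
proof -
  have "j \<in> set (arrivals I)" using assms by (simp add: set_arrivals fin_jobs)
  then obtain ys zs where eq: "arrivals I = ys @ j # zs" by (meson split_list)
  have sorted: "sorted_wrt (\<lambda>j l. r l \<le> r j) (ys @ j # zs)" using sorted_arrivals[of I] eq by simp
  let ?ys = "filter (\<lambda>l. r l \<le> t) (ys @ [j])" and ?us = "filter (\<lambda>l. \<not> r l \<le> t) (ys @ [j])"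
  have zs: "r l \<le> r j" if "l \<in> set zs" for l using sorted that by (simp add: sorted_wrt_append)
  have ys: "r j \<le> r l" if "l \<in> set ys" for l using sorted that by (simp add: sorted_wrt_append)
  have zt: "filter (\<lambda>l. r l \<le> t) zs = zs" "filter (\<lambda>l. \<not> r l \<le> t) zs = []"
    using zs assms(2) by (force simp: filter_id_conv filter_empty_conv)+
  have split: "arrivals I = ?us @ (?ys @ zs)"
    using arrivals_split[of I t] zt unfolding arrivals_until_def eq by simp
  have sub: "set ?ys \<subseteq> jobs I" using set_arrivals[OF fin_jobs] eq by auto
  have "load \<theta> t = workload I (speed K) f i \<theta> (?ys @ zs) t"
    unfolding load_def split
  proof (rule virtual_load_eq)
    fix l assume "l \<in> set (?ys @ zs)"
    then show "r l \<le> t" using zs assms(2) by fastforce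
  qed (use assms(2) in auto)
  moreover have "workload I (speed K) f i \<theta> zs (r j) - speed K * (t - r j) \<le> workload I (speed K) f i \<theta> (?ys @ zs) t"
  proof (rule workload_decay)
    fix l assume l: "l \<in> set ?ys"
    then have "l \<in> set ys \<or> l = j" by (auto split: if_splits)
    then show "r j \<le> r l" using ys by auto
    show "0 \<le> level_size I f i \<theta> l" using l sub level_size_nonneg by blast
  qed (use assms speed_pos in auto)
  ultimately show ?thesis by (simp add: earlier_eq[OF eq])
qed

text \<open>On every level the workload is at most the total size of the earlier jobs, and only
  levels up to \<open>g j\<close> enter. Finiteness permits the passage from \<open>ennreal\<close>
  prices to real dual variables.\<close>

lemma wait_cost_finite:
  assumes "j \<in> jobs I"
  shows "wait_cost m K I i j < top"
proof -
  have "j \<in> set (arrivals I)" using assms by (simp add: set_arrivals fin_jobs)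
  then obtain ys zs where eq: "arrivals I = ys @ j # zs" by (meson split_list)
  have sorted: "sorted_wrt (\<lambda>j l. r l \<le> r j) (ys @ j # zs)" using sorted_arrivals[of I] eq by simp
  have sub: "set zs \<subseteq> jobs I" using set_arrivals[OF fin_jobs] eq by auto
  define P where "P = (\<Sum>l\<leftarrow>zs. p l)"
  have le: "workload I (speed K) f i \<theta> zs (r j) \<le> P" for \<theta>
  proof -
    have "workload I (speed K) f i \<theta> zs (r j) \<le> (\<Sum>l\<leftarrow>zs. level_size I f i \<theta> l)"
    proof (rule workload_le_total)
      show "0 \<le> level_size I f i \<theta> l" if "l \<in> set zs" for l using that sub level_size_nonneg by blast
    qed (use sorted speed_pos in \<open>auto simp: sorted_wrt_append\<close>)
    also have "\<dots> \<le> P" unfolding P_def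
    proof (rule sum_list_mono)
      fix l assume "l \<in> set zs"
      then have "0 \<le> p l" using sub job_pos(1)[of l] by auto
      then show "level_size I f i \<theta> l \<le> p l" by (simp add: level_size_def)
    qed
    finally show ?thesis .
  qed
  have "(\<integral>\<^sup>+\<theta>. indicator {0<..g j} \<theta> * ennreal (workload I (speed K) f i \<theta> zs (r j)) \<partial>lborel)
      \<le> (\<integral>\<^sup>+\<theta>. indicator {0<..g j} \<theta> * ennreal P \<partial>lborel)"
    using le by (intro nn_integral_mono mult_left_mono ennreal_leI) auto
  also have "\<dots> < top" using nn_integral_level[of "g j" P] rdens_pos[of I i j]
    by (simp add: ennreal_mult_less_top)
  finally show ?thesis unfolding wait_cost_def earlier_eq[OF eq] by (simp add: ennreal_mult_less_top)
qed

text \<open>A job of the machine contributes p W + p^2 / 2 to the jumps on the levels up to its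
  density. Over all levels the first part becomes \<open>speed K\<close> times its waiting cost, the
  second g p^2 / 2, which is at most w p / 2.\<close>

lemma load_cost_integral:
  assumes "\<exists>ys. arrivals I = ys @ xs"
  shows "(\<integral>\<^sup>+\<theta>. indicator {0<..} \<theta> * ennreal (load_cost I (speed K) f i \<theta> xs) \<partial>lborel)
    \<le> (\<Sum>j | j \<in> set xs \<and> f j = i. ennreal (speed K) * wait_cost m K I i j + ennreal (w j * p j / 2))"
  using assms
proof (induction xs)
  case (Cons j xs)
  then obtain ys where ys: "arrivals I = ys @ j # xs" by auto
  let ?W = "\<lambda>\<theta>. workload I (speed K) f i \<theta> xs (r j)"
  let ?c = "\<lambda>j. ennreal (speed K) * wait_cost m K I i j + ennreal (w j * p j / 2)"
  have sub: "set (j # xs) \<subseteq> jobs I" using set_arrivals[OF fin_jobs] ys by auto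
  have dist: "j \<notin> set xs" using distinct_arrivals[of I] ys by auto
  have pw: "0 < p j" "0 < w j" using job_pos[of j] sub by auto
  have IH: "(\<integral>\<^sup>+\<theta>. indicator {0<..} \<theta> * ennreal (load_cost I (speed K) f i \<theta> xs) \<partial>lborel)
    \<le> (\<Sum>j | j \<in> set xs \<and> f j = i. ?c j)"
    using ys by (intro Cons.IH exI[of _ "ys @ [j]"]) simp
  have lc: "0 \<le> load_cost I (speed K) f i \<theta> xs" for \<theta>
  proof (rule load_cost_nonneg)
    show "0 \<le> level_size I f i \<theta> l" if "l \<in> set xs" for l using that sub level_size_nonneg by auto
  qed
  have m1: "(\<lambda>\<theta>. load_cost I (speed K) f i \<theta> xs) \<in> borel_measurable borel" for xs
    by (induction xs) (simp_all add: level_size_def)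
  note m1[measurable]
  show ?case
  proof (cases "f j = i")
    case False
    then have "level_size I f i \<theta> j = 0" for \<theta> by (simp add: level_size_def)
    moreover have "{l. l \<in> set (j # xs) \<and> f l = i} = {l. l \<in> set xs \<and> f l = i}" using False by auto
    ultimately show ?thesis using IH by simp
  next
    case True
    have set: "{l. l \<in> set (j # xs) \<and> f l = i} = insert j {l. l \<in> set xs \<and> f l = i}" using True by auto
    have "indicator {0<..} \<theta> * ennreal (load_cost I (speed K) f i \<theta> (j # xs)) =
       ennreal (p j) * (indicator {0<..g j} \<theta> * ennreal (?W \<theta>)) + indicator {0<..g j} \<theta> * ennreal (p j * p j / 2)
       + indicator {0<..} \<theta> * ennreal (load_cost I (speed K) f i \<theta> xs)" for \<theta>
    proof (cases "0 < \<theta> \<and> \<theta> \<le> g j")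
      case True
      then have "load_cost I (speed K) f i \<theta> (j # xs) = p j * ?W \<theta> + p j * p j / 2 + load_cost I (speed K) f i \<theta> xs"
        using \<open>f j = i\<close> by (simp add: level_size_def algebra_simps)
      then show ?thesis using True pw lc workload_nonneg[of I "speed K" f i \<theta> xs "r j"]
        by (simp add: ennreal_mult indicator_def)
    next
      case False
      then have "0 < \<theta> \<Longrightarrow> level_size I f i \<theta> j = 0" by (auto simp: level_size_def)
      then show ?thesis using False by (auto simp: indicator_def)
    qed
    then have "(\<integral>\<^sup>+\<theta>. indicator {0<..} \<theta> * ennreal (load_cost I (speed K) f i \<theta> (j # xs)) \<partial>lborel)
      = ennreal (p j) * (\<integral>\<^sup>+\<theta>. indicator {0<..g j} \<theta> * ennreal (?W \<theta>) \<partial>lborel) + ennreal (g j) * ennreal (p j * p j / 2)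
       + (\<integral>\<^sup>+\<theta>. indicator {0<..} \<theta> * ennreal (load_cost I (speed K) f i \<theta> xs) \<partial>lborel)"
      using rdens_pos[of I i j] by (simp add: nn_integral_add nn_integral_cmult nn_integral_level)
    also have "ennreal (p j) * (\<integral>\<^sup>+\<theta>. indicator {0<..g j} \<theta> * ennreal (?W \<theta>) \<partial>lborel) = ennreal (speed K) * wait_cost m K I i j"
    proof -
      have "ennreal (p j) = ennreal (speed K) * ennreal (p j / speed K)"
        using speed_pos pw by (simp add: ennreal_mult[symmetric])
      then show ?thesis by (simp add: wait_cost_def earlier_eq[OF ys] mult.assoc)
    qed
    also have "ennreal (g j) * ennreal (p j * p j / 2) \<le> ennreal (w j * p j / 2)"
    proof -
      have "g j * (p j * p j / 2) \<le> w j * p j / 2"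
        using rdens_bounds(1)[of I i j] pw by (simp add: mult.assoc[symmetric])
      then show ?thesis using pw rdens_pos[of I i j] by (simp add: ennreal_mult[symmetric] ennreal_leI)
    qed
    also note IH
    finally show ?thesis unfolding set using dist by (simp add: add_mono)
  qed
qed simp

text \<open>The factor \<open>speed K\<close> from the potential argument cancels against the one in
  front of the waiting costs; the remaining term can afford it because the speed is at least
  1.\<close>

lemma load_volume_le: "load_volume \<le> (\<Sum>j\<in>J. wait_cost m K I i j + ennreal (w j * p j / 2))"
proof -
  have s: "1 \<le> speed K" by (simp add: speed_def)
  have set: "{j. j \<in> set (arrivals I) \<and> f j = i} = J"
    using set_arrivals[OF fin_jobs] by (auto simp: assigned_def)
  have "ennreal (speed K) * load_volume =
    (\<integral>\<^sup>+\<theta>. ennreal (speed K) * (indicator {0<..} \<theta> * (\<integral>\<^sup>+t. ennreal (load \<theta> t) \<partial>lborel)) \<partial>lborel)"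
    unfolding load_volume_def by (rule nn_integral_cmult[symmetric]) measurable
  also have "\<dots> \<le> (\<integral>\<^sup>+\<theta>. indicator {0<..} \<theta> * ennreal (load_cost I (speed K) f i \<theta> (arrivals I)) \<partial>lborel)"
  proof (rule nn_integral_mono)
    fix \<theta>
    have "ennreal (speed K) * (\<integral>\<^sup>+t. ennreal (load \<theta> t) \<partial>lborel) \<le> ennreal (load_cost I (speed K) f i \<theta> (arrivals I))"
      unfolding load_def using set_arrivals[OF fin_jobs]
      by (intro virtual_load_integral sorted_arrivals speed_pos level_size_nonneg) auto
    then show "ennreal (speed K) * (indicator {0<..} \<theta> * (\<integral>\<^sup>+t. ennreal (load \<theta> t) \<partial>lborel))
       \<le> indicator {0<..} \<theta> * ennreal (load_cost I (speed K) f i \<theta> (arrivals I))"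
      by (simp add: indicator_def)
  qed
  also have "\<dots> \<le> (\<Sum>j\<in>J. ennreal (speed K) * wait_cost m K I i j + ennreal (w j * p j / 2))"
    using load_cost_integral[of "arrivals I"] unfolding set by auto
  also have "\<dots> \<le> (\<Sum>j\<in>J. ennreal (speed K) * (wait_cost m K I i j + ennreal (w j * p j / 2)))"
  proof (rule sum_mono)
    fix j
    have "ennreal (w j * p j / 2) \<le> ennreal (speed K) * ennreal (w j * p j / 2)"
      using mult_right_mono[of 1 "ennreal (speed K)" "ennreal (w j * p j / 2)"] s by simp
    then show "ennreal (speed K) * wait_cost m K I i j + ennreal (w j * p j / 2)
      \<le> ennreal (speed K) * (wait_cost m K I i j + ennreal (w j * p j / 2))"
      by (simp add: distrib_left add_left_mono)
  qed
  also have "\<dots> = ennreal (speed K) * (\<Sum>j\<in>J. wait_cost m K I i j + ennreal (w j * p j / 2))"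
    by (simp add: sum_distrib_left)
  finally show ?thesis using speed_pos by (simp add: ennreal_mult_le_mult_iff)
qed

text \<open>Up to the factor \<open>1 / speed K\<close>, the dual variable of the machine at time
  \<open>t\<close>.\<close>

definition load_density :: "real \<Rightarrow> ennreal" where
  "load_density t = (\<integral>\<^sup>+\<theta>. indicator {0<..} \<theta> * ennreal (load \<theta> t) \<partial>lborel)"

lemma load_density_measurable [measurable]: "load_density \<in> borel_measurable borel"
  unfolding load_density_def by measurable

lemma load_density_integral: "(\<integral>\<^sup>+t. load_density t \<partial>lborel) = load_volume"
proof -
  have "(\<integral>\<^sup>+t. load_density t \<partial>lborel) = (\<integral>\<^sup>+\<theta>. (\<integral>\<^sup>+t. indicator {0<..} \<theta> * ennreal (load \<theta> t) \<partial>lborel) \<partial>lborel)"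
    unfolding load_density_def by (rule lborel_pair.Fubini') measurable
  also have "\<dots> = load_volume" unfolding load_volume_def by (simp add: nn_integral_cmult)
  finally show ?thesis .
qed

text \<open>The waiting part of dual feasibility. On each level up to \<open>g j\<close>, the
  backlog met by \<open>j\<close> is at most the load at \<open>t\<close> plus
  \<open>speed K\<close> times the elapsed time; scaled by p / speed, the second part amounts to g p
  (t - r), at most w (t - r).\<close>

lemma wait_cost_le_density:
  assumes "j \<in> jobs I" "r j \<le> t"
  shows "wait_cost m K I i j \<le> ennreal (p j) * (ennreal (1 / speed K) * load_density t + ennreal (w j / p j * (t - r j)))"
proof -
  have pw: "0 < p j" "0 < w j" using job_pos[of j] assms by auto
  have s: "0 \<le> speed K * (t - r j)" using speed_pos assms by simp
  have "(\<integral>\<^sup>+\<theta>. indicator {0<..g j} \<theta> * ennreal (workload I (speed K) f i \<theta> (earlier I j) (r j)) \<partial>lborel)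
     \<le> (\<integral>\<^sup>+\<theta>. indicator {0<..} \<theta> * ennreal (load \<theta> t) + indicator {0<..g j} \<theta> * ennreal (speed K * (t - r j)) \<partial>lborel)"
  proof (rule nn_integral_mono)
    fix \<theta>
    have "ennreal (workload I (speed K) f i \<theta> (earlier I j) (r j)) \<le> ennreal (load \<theta> t + speed K * (t - r j))"
      by (rule ennreal_leI[OF load_ge_decay[OF assms]])
    also have "\<dots> = ennreal (load \<theta> t) + ennreal (speed K * (t - r j))" using load_nonneg s by simp
    finally show "indicator {0<..g j} \<theta> * ennreal (workload I (speed K) f i \<theta> (earlier I j) (r j))
       \<le> indicator {0<..} \<theta> * ennreal (load \<theta> t) + indicator {0<..g j} \<theta> * ennreal (speed K * (t - r j))"
      by (simp add: indicator_def)
  qed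
  also have "\<dots> = load_density t + ennreal (g j) * ennreal (speed K * (t - r j))"
    unfolding load_density_def using rdens_pos[of I i j] by (simp add: nn_integral_add nn_integral_level)
  finally have "wait_cost m K I i j \<le> ennreal (p j / speed K) * (load_density t + ennreal (g j) * ennreal (speed K * (t - r j)))"
    unfolding wait_cost_def by (rule mult_left_mono) simp
  also have "\<dots> = ennreal (p j) * (ennreal (1 / speed K) * load_density t) + ennreal (p j / speed K * (g j * (speed K * (t - r j))))"
  proof -
    have "ennreal (p j / speed K) = ennreal (p j) * ennreal (1 / speed K)"
      using pw speed_pos by (simp add: ennreal_mult[symmetric])
    moreover have "ennreal (p j / speed K) * (ennreal (g j) * ennreal (speed K * (t - r j)))
        = ennreal (p j / speed K * (g j * (speed K * (t - r j))))"
    proof -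
      have nn: "0 \<le> p j / speed K" "0 \<le> g j" using pw speed_pos rdens_pos[of I i j] by simp_all
      show ?thesis by (simp only: ennreal_mult[OF nn(1) mult_nonneg_nonneg[OF nn(2) s]] ennreal_mult[OF nn(2) s])
    qed
    ultimately show ?thesis by (simp only: distrib_left mult.assoc)
  qed
  also have "p j / speed K * (g j * (speed K * (t - r j))) = g j * p j * (t - r j)"
    using speed_pos by simp
  also have "ennreal (g j * p j * (t - r j)) \<le> ennreal (w j * (t - r j))"
    using rdens_bounds(1)[of I i j] pw assms by (intro ennreal_leI mult_right_mono) auto
  also have "w j * (t - r j) = p j * (w j / p j * (t - r j))" using pw by simp
  also have "ennreal \<dots> = ennreal (p j) * ennreal (w j / p j * (t - r j))"
    using pw assms by (intro ennreal_mult) auto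
  finally show ?thesis by (simp only: distrib_left add_left_mono)
qed

end

subsection \<open>The competitive ratio\<close>

text \<open>The dual value of a job is the price it paid. Being the cheapest, it is at most the
  price on every machine, and that price is controlled by the load density there at any later time.
  In the second inequality the sum of the \<open>a j\<close> stands on both sides; the factor
  \<open>1 / speed K\<close> is all that separates them.\<close>

lemma dual_solution_bound:
  assumes valid: "valid_instance m I" and m: "m \<ge> 1" and K: "K > 0"
  defines "f \<equiv> dispatch m K I"
  defines "a \<equiv> \<lambda>j. enn2real (wait_cost m K I (f j) j)"
  defines "P \<equiv> \<Sum>j\<in>jobs I. weight I j * ptime I (f j) j"
  shows "(\<Sum>i<m. machine_analysis.load_volume m K I i) \<le> ennreal ((\<Sum>j\<in>jobs I. a j) + P / 2)"
    and "(\<Sum>j\<in>jobs I. a j) + 2 * P \<le> 1 / speed K * ((\<Sum>j\<in>jobs I. a j) + P / 2) + 3 * optimal_weighted_flow_time m I"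
proof -
  have ma: "machine_analysis m K I i" if "i < m" for i using assms that by unfold_locales auto
  have fl: "f j < m" for j unfolding f_def by (rule dispatch_less[OF m])
  have fin: "finite (jobs I)" using valid by (simp add: valid_instance_def)
  have pw: "0 < ptime I i j" "0 < weight I j" if "i < m" "j \<in> jobs I" for i j
    using valid that by (auto simp: valid_instance_def)
  have pf: "0 < ptime I (f j) j" "0 < weight I j" if "j \<in> jobs I" for j using pw[OF fl that] that by auto
  have a: "ennreal (a j) = wait_cost m K I (f j) j" "0 \<le> a j" if "j \<in> jobs I" for j
    using machine_analysis.wait_cost_finite[OF ma[OF fl] that] by (auto simp: a_def)
  have s: "0 < speed K" by (simp add: speed_def add_pos_nonneg)
  have group: "(\<Sum>i<m. \<Sum>j\<in>assigned m K I i. h i j) = (\<Sum>j\<in>jobs I. h (f j) j)" for h :: "nat \<Rightarrow> nat \<Rightarrow> ennreal"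
  proof -
    have "(\<Sum>i<m. \<Sum>j\<in>assigned m K I i. h i j) = (\<Sum>i<m. \<Sum>j\<in>{j\<in>jobs I. f j = i}. h (f j) j)"
      by (intro sum.cong) (auto simp: assigned_def f_def)
    also have "\<dots> = (\<Sum>j\<in>jobs I. h (f j) j)"
      using fin fl by (intro sum.group) auto
    finally show ?thesis .
  qed
  have P: "0 \<le> P" unfolding P_def using pf by (intro sum_nonneg) (simp add: less_imp_le)
  have "(\<Sum>i<m. machine_analysis.load_volume m K I i) \<le>
      (\<Sum>i<m. \<Sum>j\<in>assigned m K I i. wait_cost m K I i j + ennreal (weight I j * ptime I i j / 2))"
    using machine_analysis.load_volume_le[OF ma] by (intro sum_mono) auto
  also have "\<dots> = (\<Sum>j\<in>jobs I. wait_cost m K I (f j) j + ennreal (weight I j * ptime I (f j) j / 2))"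
    by (rule group)
  also have "\<dots> = (\<Sum>j\<in>jobs I. ennreal (a j + weight I j * ptime I (f j) j / 2))"
    using a pf by (intro sum.cong refl) (simp add: less_imp_le)
  also have "\<dots> = ennreal (\<Sum>j\<in>jobs I. a j + weight I j * ptime I (f j) j / 2)"
    using a pf by (intro sum_ennreal) (simp add: less_imp_le)
  finally show vol: "(\<Sum>i<m. machine_analysis.load_volume m K I i) \<le> ennreal ((\<Sum>j\<in>jobs I. a j) + P / 2)"
    by (simp add: sum.distrib P_def sum_divide_distrib)
  have b0: "0 \<le> (\<Sum>j\<in>jobs I. a j) + P / 2" using a(2) P by (simp add: sum_nonneg)
  define lam where "lam j = a j + 2 * weight I j * ptime I (f j) j" for j
  define \<beta> where "\<beta> i t = ennreal (1 / speed K) * machine_analysis.load_density m K I i t" for i t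
  have beta_m: "\<beta> i \<in> borel_measurable borel" if "i < m" for i
    unfolding \<beta>_def using machine_analysis.load_density_measurable[OF ma[OF that]] by measurable
  have "(\<Sum>j\<in>jobs I. lam j) \<le> 1 / speed K * ((\<Sum>j\<in>jobs I. a j) + P / 2) + 3 * optimal_weighted_flow_time m I"
  proof (rule weak_duality[OF valid m _ beta_m])
    show "0 \<le> lam j" if "j \<in> jobs I" for j using a(2)[OF that] pf[OF that] by (simp add: lam_def)
    have "(\<Sum>i<m. \<integral>\<^sup>+t. \<beta> i t \<partial>lborel) = (\<Sum>i<m. ennreal (1 / speed K) * machine_analysis.load_volume m K I i)"
    proof (rule sum.cong)
      fix i assume "i \<in> {..<m}"
      then interpret machine_analysis m K I i using ma by simp
      show "(\<integral>\<^sup>+t. \<beta> i t \<partial>lborel) = ennreal (1 / speed K) * load_volume"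
        unfolding \<beta>_def load_density_integral[symmetric] by (rule nn_integral_cmult) measurable
    qed simp
    also have "\<dots> \<le> ennreal (1 / speed K) * ennreal ((\<Sum>j\<in>jobs I. a j) + P / 2)"
      unfolding sum_distrib_left[symmetric] using vol by (rule mult_left_mono) simp
    also have "\<dots> = ennreal (1 / speed K * ((\<Sum>j\<in>jobs I. a j) + P / 2))"
      using s b0 by (intro ennreal_mult[symmetric]) auto
    finally show "(\<Sum>i<m. \<integral>\<^sup>+t. \<beta> i t \<partial>lborel) \<le> ennreal (1 / speed K * ((\<Sum>j\<in>jobs I. a j) + P / 2))" .
    show "0 \<le> 1 / speed K * ((\<Sum>j\<in>jobs I. a j) + P / 2)"
      using s b0 by simp
    fix i j t assume i: "i < m" and j: "j \<in> jobs I" and t: "release I j \<le> t"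
    interpret machine_analysis m K I i by (rule ma[OF i])
    note p = pw[OF i j]
    have "ennreal (p j) * ennreal (lam j / p j) = ennreal (lam j)"
      using p a(2)[OF j] pf[OF j] by (simp add: ennreal_mult[symmetric] lam_def)
    also have "\<dots> = wait_cost m K I (f j) j + ennreal (2 * weight I j * ptime I (f j) j)"
      unfolding lam_def a(1)[OF j, symmetric] using a(2)[OF j] pf[OF j] by (intro ennreal_plus) auto
    also have "\<dots> \<le> wait_cost m K I i j + ennreal (2 * w j * p j)"
      unfolding f_def by (rule wait_cost_dispatch_le[OF valid m j i])
    also have "\<dots> \<le> ennreal (p j) * (\<beta> i t + ennreal (w j / p j * (t - r j))) + ennreal (p j) * ennreal (2 * w j)"
      using wait_cost_le_density[OF j t] p by (intro add_mono) (auto simp: \<beta>_def ennreal_mult[symmetric] ac_simps)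
    finally have "ennreal (p j) * ennreal (lam j / p j) \<le> ennreal (p j) * (\<beta> i t + ennreal (w j / p j * (t - r j)) + ennreal (2 * w j))"
      by (simp only: distrib_left)
    then show "ennreal (lam j / p j) \<le> \<beta> i t + ennreal (w j / p j * (t - r j)) + ennreal (2 * w j)"
      using p by (simp add: ennreal_mult_le_mult_iff)
  qed
  moreover have "(\<Sum>j\<in>jobs I. lam j) = (\<Sum>j\<in>jobs I. a j) + 2 * P"
    by (simp add: lam_def sum.distrib P_def sum_distrib_left mult.assoc)
  ultimately show "(\<Sum>j\<in>jobs I. a j) + 2 * P \<le> 1 / speed K * ((\<Sum>j\<in>jobs I. a j) + P / 2) + 3 * optimal_weighted_flow_time m I"
    by simp
qed

lemma algorithm_flow_time:
  assumes valid: "valid_instance m I" and m: "m \<ge> 1" and K: "K > 0"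
  shows "weighted_flow_time I (algorithm m K I) \<le> 650 * (real K)\<^sup>2 * optimal_weighted_flow_time m I"
proof -
  define f where "f = dispatch m K I"
  define R where "R = (\<Sum>j\<in>jobs I. enn2real (wait_cost m K I (f j) j))"
  define P where "P = (\<Sum>j\<in>jobs I. weight I j * ptime I (f j) j)"
  define opt where "opt = optimal_weighted_flow_time m I"
  have ma: "machine_analysis m K I i" if "i < m" for i using assms that by unfold_locales auto
  have fl: "f j < m" for j unfolding f_def by (rule dispatch_less[OF m])
  have fin: "finite (jobs I)" using valid by (simp add: valid_instance_def)
  have pw: "0 < ptime I (f j) j" "0 < weight I j" if "j \<in> jobs I" for j
    using valid that fl[of j] by (auto simp: valid_instance_def)
  have group: "(\<Sum>i<m. \<Sum>j\<in>{j\<in>X. f j = i}. h i j) = (\<Sum>j\<in>X. h (f j) j)"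
    if "X \<subseteq> jobs I" for X and h :: "nat \<Rightarrow> nat \<Rightarrow> real"
  proof -
    have "(\<Sum>i<m. \<Sum>j\<in>{j\<in>X. f j = i}. h i j) = (\<Sum>i<m. \<Sum>j\<in>{j\<in>X. f j = i}. h (f j) j)"
      by (intro sum.cong) auto
    also have "\<dots> = (\<Sum>j\<in>X. h (f j) j)"
      using finite_subset[OF that fin] fl by (intro sum.group) auto
    finally show ?thesis .
  qed
  have K1: "1 \<le> real K" using K by simp
  have R: "0 \<le> R" unfolding R_def by (intro sum_nonneg) simp
  have P: "0 \<le> P" unfolding P_def using pw by (intro sum_nonneg) (simp add: less_imp_le)
  have dual: "R + 2 * P \<le> 1 / speed K * (R + P / 2) + 3 * opt"
    using dual_solution_bound(2)[OF assms] by (simp add: R_def P_def f_def opt_def)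
  \<comment> \<open>The gap created by the speed: it multiplies \<open>R\<close> and is the source
    of the factor of order K in the bound on \<open>R\<close>.\<close>
  have inv: "1 / speed K = 1 - 1 / (4 * real K + 1)"
    using K1 by (simp add: speed_def field_simps)
  \<comment> \<open>For \<open>P / 2\<close> the factor \<open>1 / speed K\<close> is simply
    dropped, which still leaves 2 P - P / 2 = 3 / 2 P in favour of the prices.\<close>
  have "1 / speed K * (R + P / 2) \<le> R - R / (4 * real K + 1) + P / 2"
    unfolding inv using K1 P by (simp add: field_simps)
  then have main: "R / (4 * real K + 1) + 3 / 2 * P \<le> 3 * opt" using dual by simp
  have "0 \<le> R / (4 * real K + 1)" using R K1 by simp
  then have P_le: "P \<le> 2 * opt" using main by simp
  then have opt: "0 \<le> opt" using P by simp
  have "R / (4 * real K + 1) \<le> 3 * opt" using main P by simp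
  then have R_le: "R \<le> 3 * opt * (4 * real K + 1)" using K1 by (simp add: divide_le_eq)
  let ?c = "65 * real K + 8 * (real K)\<^sup>2"
  let ?A = "jobs I - culled_jobs m K I"
  let ?start = "\<lambda>i. start_on m K I i"
  have A_eq: "accepted m K I i = {j \<in> ?A. f j = i}" for i
    by (auto simp: accepted_def assigned_def f_def)
  have J_eq: "assigned m K I i = {j \<in> jobs I. f j = i}" for i
    by (auto simp: assigned_def f_def)
  have wait0: "0 \<le> ?start (f j) j - release I j" if "j \<in> ?A" for j
  proof -
    interpret machine_analysis m K I "f j" by (rule ma[OF fl])
    show ?thesis using release_le_job_start[of j] that by (simp add: A_eq)
  qed
  define h where "h i j = rdens I i j * ptime I i j * (?start i j - release I j)" for i j
  define W where "W = (\<Sum>j\<in>?A. h (f j) j)"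
  have h: "0 \<le> h (f j) j" if "j \<in> ?A" for j
    using that pw[of j] wait0[of j] less_imp_le[OF rdens_pos] by (simp add: h_def less_imp_le)
  have "W = (\<Sum>i<m. \<Sum>j\<in>accepted m K I i. h i j)"
    unfolding A_eq W_def by (rule group[symmetric]) auto
  then have "ennreal W = (\<Sum>i<m. ennreal (\<Sum>j\<in>accepted m K I i. h i j))"
    using h by (simp only:) (intro sum_ennreal[symmetric] sum_nonneg, auto simp: A_eq)
  also have "\<dots> \<le> (\<Sum>i<m. machine_analysis.load_volume m K I i + ennreal (?c * (\<Sum>j\<in>assigned m K I i. weight I j * ptime I i j)))"
    using machine_analysis.total_waiting_le[OF ma] unfolding h_def by (intro sum_mono) auto
  also have "\<dots> = (\<Sum>i<m. machine_analysis.load_volume m K I i) + ennreal (\<Sum>i<m. ?c * (\<Sum>j\<in>assigned m K I i. weight I j * ptime I i j))"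
    unfolding sum.distrib using pw
    by (subst sum_ennreal) (auto simp: J_eq less_imp_le intro!: mult_nonneg_nonneg sum_nonneg)
  also have "(\<Sum>i<m. ?c * (\<Sum>j\<in>assigned m K I i. weight I j * ptime I i j)) = ?c * P"
    unfolding J_eq sum_distrib_left[symmetric] P_def by (subst group[where h = "\<lambda>i j. weight I j * ptime I i j"]) auto
  also have "(\<Sum>i<m. machine_analysis.load_volume m K I i) \<le> ennreal (R + P / 2)"
    using dual_solution_bound(1)[OF assms] by (simp add: R_def P_def f_def)
  also have "ennreal (R + P / 2) + ennreal (?c * P) = ennreal (R + P / 2 + ?c * P)"
    using R P by (intro ennreal_plus[symmetric]) auto
  finally have "ennreal W \<le> ennreal (R + P / 2 + ?c * P)" by (simp add: add_right_mono)
  then have W: "W \<le> R + P / 2 + ?c * P" using R P by (subst (asm) ennreal_le_iff) auto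
  have start_eq: "completion_time I (algorithm m K I) j - release I j = (?start (f j) j - release I j) + ptime I (f j) j"
    if "j \<in> ?A" for j using that by (simp add: completion_time_def algorithm_def f_def)
  have sub: "jobs I - rejected_jobs I (algorithm m K I) \<subseteq> ?A"
    by (auto simp: rejected_jobs_def algorithm_def)
  have "weighted_flow_time I (algorithm m K I) =
      (\<Sum>j\<in>jobs I - rejected_jobs I (algorithm m K I). weight I j * ((?start (f j) j - release I j) + ptime I (f j) j))"
    unfolding weighted_flow_time_def using sub by (intro sum.cong refl) (simp add: start_eq subset_iff)
  also have "\<dots> \<le> (\<Sum>j\<in>?A. weight I j * ((?start (f j) j - release I j) + ptime I (f j) j))"
  proof (rule sum_mono2[OF _ sub])
    fix j assume "j \<in> ?A - (jobs I - rejected_jobs I (algorithm m K I))"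
    then show "0 \<le> weight I j * ((?start (f j) j - release I j) + ptime I (f j) j)"
      using wait0[of j] pw[of j] by simp
  qed (use fin in simp)
  also have "\<dots> = (\<Sum>j\<in>?A. weight I j * (?start (f j) j - release I j)) + (\<Sum>j\<in>?A. weight I j * ptime I (f j) j)"
    by (simp add: distrib_left sum.distrib)
  also have "(\<Sum>j\<in>?A. weight I j * ptime I (f j) j) \<le> P"
    unfolding P_def using fin pw by (intro sum_mono2) (auto simp: less_imp_le)
  \<comment> \<open>The analysis by levels measures a job by its rounded weight, density times size;
    returning to the true weight costs a factor of 4.\<close>
  also have "(\<Sum>j\<in>?A. weight I j * (?start (f j) j - release I j))
     \<le> (\<Sum>j\<in>?A. 4 * (rdens I (f j) j * ptime I (f j) j) * (?start (f j) j - release I j))"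
    using rdens_bounds(2) pw wait0 by (intro sum_mono mult_right_mono) auto
  also have "\<dots> = 4 * W" by (simp add: W_def h_def sum_distrib_left mult.assoc)
  finally have "weighted_flow_time I (algorithm m K I) \<le> 4 * W + P" by simp
  also have "\<dots> \<le> 4 * R + (3 + 4 * ?c) * P" using W by (simp add: algebra_simps)
  also have "\<dots> \<le> 4 * (3 * opt * (4 * real K + 1)) + (3 + 4 * ?c) * (2 * opt)"
    using R_le P_le by (intro add_mono mult_left_mono) auto
  also have "\<dots> = (568 * real K + 64 * (real K)\<^sup>2 + 18) * opt" by (simp add: algebra_simps)
  \<comment> \<open>As K is at least 1, all terms are absorbed by K^2, with 568 + 64 + 18 =
    650.\<close>
  also have "\<dots> \<le> 650 * (real K)\<^sup>2 * opt"
  proof (rule mult_right_mono[OF _ opt])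
    have "real K \<le> (real K)\<^sup>2" "1 \<le> (real K)\<^sup>2" using K1 by (simp_all add: power2_eq_square mult_ge1_I)
    then show "568 * real K + 64 * (real K)\<^sup>2 + 18 \<le> 650 * (real K)\<^sup>2" by linarith
  qed
  finally show ?thesis by (simp add: opt_def)
qed

text \<open>Culling costs at most 8 / K of the total weight and interruptions at most 1 / K. The two
  kinds of rejected jobs are disjoint.\<close>

lemma algorithm_rejected_weight:
  assumes valid: "valid_instance m I" and m: "m \<ge> 1" and K: "K > 0"
  shows "(\<Sum>j\<in>rejected_jobs I (algorithm m K I). weight I j) \<le> 9 / real K * (\<Sum>j\<in>jobs I. weight I j)"
proof -
  let ?f = "dispatch m K I"
  have fin: "finite (jobs I)" and w: "\<And>j. j \<in> jobs I \<Longrightarrow> 0 \<le> weight I j"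
    using valid m by (auto simp: valid_instance_def less_imp_le)
  have fl: "?f j < m" for j by (rule dispatch_less[OF m])
  define X where "X = {j \<in> jobs I - culled_jobs m K I. interrupted_on m K I (?f j) j}"
  have finX: "finite X" using fin by (simp add: X_def)
  have cul: "culled_jobs m K I \<subseteq> jobs I"
    using culled_subset[of K I ?f "arrivals I"] set_arrivals[OF fin] by (simp add: culled_jobs_def)
  have rej: "rejected_jobs I (algorithm m K I) = culled_jobs m K I \<union> X"
    using cul by (auto simp: rejected_jobs_def algorithm_def X_def)
  have "(\<Sum>j\<in>X. weight I j) = (\<Sum>i<m. \<Sum>j\<in>{j\<in>X. ?f j = i}. weight I j)"
    using finX fl by (intro sum.group[symmetric]) auto
  also have "\<dots> = (\<Sum>i<m. \<Sum>j | j \<in> accepted m K I i \<and> interrupted_on m K I i j. weight I j)"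
    by (intro sum.cong) (auto simp: X_def accepted_def assigned_def)
  finally have "real K * (\<Sum>j\<in>X. weight I j) =
      (\<Sum>i<m. real K * (\<Sum>j | j \<in> accepted m K I i \<and> interrupted_on m K I i j. weight I j))"
    by (simp add: sum_distrib_left)
  also have "\<dots> \<le> (\<Sum>i<m. \<Sum>j\<in>assigned m K I i. weight I j)"
    using weight_interrupted_on[OF valid _ K] by (intro sum_mono) auto
  also have "\<dots> = (\<Sum>i<m. \<Sum>j\<in>{j\<in>jobs I. ?f j = i}. weight I j)" by (simp add: assigned_def)
  also have "\<dots> = (\<Sum>j\<in>jobs I. weight I j)" using fin fl by (intro sum.group) auto
  finally have X: "real K * (\<Sum>j\<in>X. weight I j) \<le> (\<Sum>j\<in>jobs I. weight I j)" .
  have "(\<Sum>j\<in>rejected_jobs I (algorithm m K I). weight I j) = (\<Sum>j\<in>culled_jobs m K I. weight I j) + (\<Sum>j\<in>X. weight I j)"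
    unfolding rej using finX finite_subset[OF cul fin] by (intro sum.union_disjoint) (auto simp: X_def)
  then have "real K * (\<Sum>j\<in>rejected_jobs I (algorithm m K I). weight I j) \<le> 9 * (\<Sum>j\<in>jobs I. weight I j)"
    using X weight_culled[OF assms] by (simp add: distrib_left)
  then show ?thesis using K by (simp add: field_simps)
qed

theorem theorem1p1:
  "\<exists>C::real. C > 0 \<and>
     (\<forall>(\<epsilon>::real) (m::nat). \<epsilon> > 0 \<and> \<epsilon>\<^sup>2 \<le> 1 / 2 \<and> 1 / \<epsilon> \<in> \<int> \<and> m \<ge> 1 \<longrightarrow>
        (\<exists>A. online_algorithm m A \<and>
           (\<forall>I. valid_instance m I \<longrightarrow>
              (\<Sum>j\<in>rejected_jobs I (A I). weight I j) \<le> \<epsilon> * (\<Sum>j\<in>jobs I. weight I j) \<and>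
              weighted_flow_time I (A I) \<le> C / \<epsilon> ^ 3 * optimal_weighted_flow_time m I)))"
proof (intro exI[of _ "650 * 81"] conjI allI impI)
  fix \<epsilon> :: real and m :: nat
  assume asm: "\<epsilon> > 0 \<and> \<epsilon>\<^sup>2 \<le> 1 / 2 \<and> 1 / \<epsilon> \<in> \<int> \<and> m \<ge> 1"
  then obtain z where z: "1 / \<epsilon> = of_int z" by (auto elim: Ints_cases)
  have "0 < z" using asm z by (metis of_int_0_less_iff zero_less_divide_1_iff)
  \<comment> \<open>The rejected fraction 9 / K has to be \<epsilon>; since 1 / \<epsilon> is an
    integer, 9 / \<epsilon> is a natural number and can serve as the culling period.\<close>
  define K where "K = 9 * nat z"
  have K: "K > 0" "real K = 9 / \<epsilon>" using \<open>0 < z\<close> z by (simp_all add: K_def)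
  have "\<epsilon> \<le> 1"
  proof (rule ccontr)
    assume "\<not> \<epsilon> \<le> 1"
    then have "1\<^sup>2 < \<epsilon>\<^sup>2" by (intro power_strict_mono) auto
    then show False using asm by simp
  qed
  show "\<exists>A. online_algorithm m A \<and>
           (\<forall>I. valid_instance m I \<longrightarrow>
              (\<Sum>j\<in>rejected_jobs I (A I). weight I j) \<le> \<epsilon> * (\<Sum>j\<in>jobs I. weight I j) \<and>
              weighted_flow_time I (A I) \<le> 650 * 81 / \<epsilon> ^ 3 * optimal_weighted_flow_time m I)"
  proof (intro exI[of _ "algorithm m K"] conjI allI impI)
    show "online_algorithm m (algorithm m K)" using asm K by (intro algorithm_online) auto
    fix I assume v: "valid_instance m I"
    show "(\<Sum>j\<in>rejected_jobs I (algorithm m K I). weight I j) \<le> \<epsilon> * (\<Sum>j\<in>jobs I. weight I j)"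
      using algorithm_rejected_weight[OF v _ K(1)] asm K(2) by simp
    have flow: "weighted_flow_time I (algorithm m K I) \<le> 650 * (real K)\<^sup>2 * optimal_weighted_flow_time m I"
      using algorithm_flow_time[OF v _ K(1)] asm by simp
    have opt: "0 \<le> optimal_weighted_flow_time m I"
      unfolding optimal_weighted_flow_time_def
    proof (rule cINF_greatest)
      show "{\<sigma>. feasible_offline m I \<sigma>} \<noteq> {}" using feasible_offline_exists[OF v] asm by auto
      fix \<sigma> assume \<sigma>: "\<sigma> \<in> {\<sigma>. feasible_offline m I \<sigma>}"
      have "release I j \<le> offline_completion_time m I \<sigma> j" if "j \<in> jobs I" for j
        unfolding offline_completion_time_def using \<sigma> that release_le_if_processed[of m I \<sigma> j]
        by (intro cInf_greatest) (auto simp: feasible_offline_def)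
      then show "0 \<le> offline_weighted_flow_time m I \<sigma>"
        unfolding offline_weighted_flow_time_def using v
        by (intro sum_nonneg mult_nonneg_nonneg) (auto simp: valid_instance_def less_imp_le)
    qed
    have "650 * (real K)\<^sup>2 = 650 * 81 / \<epsilon>\<^sup>2" by (simp add: K power_divide)
    \<comment> \<open>The analysis yields the rate 1 / \<epsilon>^2, which is at most 1 /
      \<epsilon>^3 because \<epsilon> is at most 1.\<close>
    also have "\<dots> \<le> 650 * 81 / \<epsilon> ^ 3"
      using asm \<open>\<epsilon> \<le> 1\<close> by (intro divide_left_mono power_decreasing) auto
    finally show "weighted_flow_time I (algorithm m K I) \<le> 650 * 81 / \<epsilon> ^ 3 * optimal_weighted_flow_time m I"
      using flow opt by (meson mult_right_mono order.trans)
  qed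
qed simp

end
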